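(* For $2\le\alpha\le5$ let $(X,Y,Z)$ be the random variables with $X,Y\in\{0,1,2\}$ (arithmetic modulo $3$) whose joint distribution is as follows: $P(X=x,Y=y)=\frac{2}{21}$ if $y=x$, $P(X=x,Y=y)=\frac{\alpha}{21}$ if $y-x\equiv1\pmod 3$, $P(X=x,Y=y)=\frac{5-\alpha}{21}$ if $y-x\equiv 2\pmod 3$; and $Z=\bot$ if $X=Y$, while $Z=(X,Y)$ if $X\neq Y$. Then $S(X;Y\Vert Z)>0$ for every $3<\alpha\le5$, whereas $I_{\rm form}(X;Y\mid Z)=0$ for every $2\le\alpha\le3$. Here $S$ is the secret-key rate and $I_{\rm form}$ the formation cost.
   Context: All alphabets are finite and logarithms are base two. $I(\cdot;\cdot)$ is mutual information, $H$ is Shannon entropy. Secret-key rate. Let $(X,Y,Z)$ have a joint distribution on finite alphabets. An $n$-copy protocol: Alice holds $X^n$, Bob holds $Y^n$, Eve holds $Z^n$, where $(X^n,Y^n,Z^n)$ are $n$ i.i.d. copies of $(X,Y,Z)$. Alice and Bob have private local randomness (independent of each other and of the source) and exchange an arbitrary finite number of rounds of public messages, each message being a function of the sender's data, the sender's private randomness and the previous messages; $F$ denotes the full public transcript. At the end Alice computes $K_A$ and Bob computes $K_B$, with values in a finite set $\mathcal K_n$, from their own data, randomness and $F$. A sequence of such protocols is admissible if, as $n\to\infty$, $\Pr[K_A=K_B]\to1$, $\log|\mathcal K_n|-H(K_A)\to0$, and $I(K_A;Z^n,F)\to0$; its rate is $\liminf_{n\to\infty}\frac1n\log|\mathcal K_n|$.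 $S(X;Y\Vert Z)$ is the supremum of the rates of admissible sequences. Formation cost. $I_{\rm form}(X;Y\mid Z)$ is the minimal rate of pre-shared secret bits needed to generate samples of $(X,Y)$ by public discussion while ensuring that the public transcript can be simulated from $Z$. Precisely: it is the infimum of all $R\ge0$ such that for every $\varepsilon>0$ and all sufficiently large $N$ there is an interactive public-discussion protocol in which Alice and Bob start with $\lfloor RN\rfloor$ shared uniform secret bits and private local randomness, exchange a public transcript $C$, and output $\tilde X^N$ and $\tilde Y^N$ respectively, and there is a channel $P_{\bar C\mid Z^N}$, such that the law of $(\tilde X^N,\tilde Y^N,C)$ is within total variation distance $\varepsilon$ of the law of $(X^N,Y^N,\bar C)$, where $(X^N,Y^N,Z^N)$ are $N$ i.i.d. copies of $(X,Y,Z)$ and $\bar C$ is obtained from $Z^N$ through this channel. *)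

theory Defs
  imports "HOL-Probability.Probability"
begin

section \<open>Interactive public discussion\<close>

text \<open>
  Alice and Bob hold data of types \<open>'a\<close> and \<open>'b\<close> and end with outputs of types
  \<open>'c\<close> and \<open>'d\<close>. Private randomness and public messages range over \<open>nat\<close>,
  which hosts an arbitrary finite alphabet. The list \<open>speakers\<close> says who sends the message in
  each round, so its length is the number of rounds. A message depends on the sender's data,
  the sender's private randomness and the list of all previous messages, oldest first.
\<close>

datatype party = Alice | Bob

record ('a, 'b, 'c, 'd) protocol =
  alice_rand :: "nat pmf"
  bob_rand :: "nat pmf"
  speakers :: "party list"
  alice_msg :: "'a \<Rightarrow> nat \<Rightarrow> nat list \<Rightarrow> nat"
  bob_msg :: "'b \<Rightarrow> nat \<Rightarrow> nat list \<Rightarrow> nat"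
  alice_out :: "'a \<Rightarrow> nat \<Rightarrow> nat list \<Rightarrow> 'c"
  bob_out :: "'b \<Rightarrow> nat \<Rightarrow> nat list \<Rightarrow> 'd"

definition finite_randomness :: "('a, 'b, 'c, 'd) protocol \<Rightarrow> bool" where
  "finite_randomness p \<longleftrightarrow>
     finite (set_pmf (alice_rand p)) \<and> finite (set_pmf (bob_rand p))"

definition next_message ::
    "('a, 'b, 'c, 'd) protocol \<Rightarrow> 'a \<Rightarrow> nat \<Rightarrow> 'b \<Rightarrow> nat \<Rightarrow> party \<Rightarrow> nat list \<Rightarrow> nat" where
  "next_message p a r b s t F =
     (case t of Alice \<Rightarrow> alice_msg p a r F | Bob \<Rightarrow> bob_msg p b s F)"

definition transcript ::
    "('a, 'b, 'c, 'd) protocol \<Rightarrow> 'a \<Rightarrow> nat \<Rightarrow> 'b \<Rightarrow> nat \<Rightarrow> nat list" where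
  "transcript p a r b s =
     foldl (\<lambda>F t. F @ [next_message p a r b s t F]) [] (speakers p)"

text \<open>Joint law of Alice's output, Bob's output and the public transcript for given data.\<close>

definition run_protocol ::
    "('a, 'b, 'c, 'd) protocol \<Rightarrow> 'a \<Rightarrow> 'b \<Rightarrow> ('c \<times> 'd \<times> nat list) pmf" where
  "run_protocol p a b =
     map_pmf (\<lambda>(r, s). let F = transcript p a r b s
                        in (alice_out p a r F, bob_out p b s F, F))
       (pair_pmf (alice_rand p) (bob_rand p))"


section \<open>Secret-key rate\<close>

text \<open>
  An outcome of \<open>replicate_pmf n P\<close> is a list of \<open>n\<close> independent triples; these maps extract
  the parts seen by Alice, Bob and Eve.
\<close>

abbreviation Xs :: "('x \<times> 'y \<times> 'z) list \<Rightarrow> 'x list" where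
  "Xs \<equiv> map (\<lambda>(x, y, z). x)"

abbreviation Ys :: "('x \<times> 'y \<times> 'z) list \<Rightarrow> 'y list" where
  "Ys \<equiv> map (\<lambda>(x, y, z). y)"

abbreviation Zs :: "('x \<times> 'y \<times> 'z) list \<Rightarrow> 'z list" where
  "Zs \<equiv> map (\<lambda>(x, y, z). z)"

text \<open>Joint law of \<open>(K\<^sub>A, K\<^sub>B, Z\<^sup>n, F)\<close>.\<close>

definition key_law ::
    "('x \<times> 'y \<times> 'z) pmf \<Rightarrow> nat \<Rightarrow> ('x list, 'y list, nat, nat) protocol
      \<Rightarrow> (nat \<times> nat \<times> 'z list \<times> nat list) pmf" where
  "key_law P n p =
     do {w \<leftarrow> replicate_pmf n P;
         (ka, kb, F) \<leftarrow> run_protocol p (Xs w) (Ys w);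
         return_pmf (ka, kb, Zs w, F)}"

definition admissible ::
    "('x::finite \<times> 'y::finite \<times> 'z::finite) pmf
      \<Rightarrow> (nat \<Rightarrow> ('x list, 'y list, nat, nat) protocol) \<Rightarrow> (nat \<Rightarrow> nat set) \<Rightarrow> bool" where
  "admissible P p K \<longleftrightarrow>
     (\<forall>n. finite_randomness (p n)) \<and>
     (\<forall>n. finite (K n)) \<and>
     (\<forall>n. \<forall>(ka, kb, zs, F) \<in> set_pmf (key_law P n (p n)). ka \<in> K n \<and> kb \<in> K n) \<and>
     (\<lambda>n. measure_pmf.prob (key_law P n (p n)) {(ka, kb, zs, F). ka = kb}) \<longlonglongrightarrow> 1 \<and>
     (\<lambda>n. log 2 (real (card (K n)))
           - prob_space.entropy (measure_pmf (key_law P n (p n))) 2 (count_space UNIV)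
               (\<lambda>(ka, kb, zs, F). ka)) \<longlonglongrightarrow> 0 \<and>
     (\<lambda>n. prob_space.mutual_information (measure_pmf (key_law P n (p n))) 2
             (count_space UNIV) (count_space UNIV)
             (\<lambda>(ka, kb, zs, F). ka) (\<lambda>(ka, kb, zs, F). (zs, F))) \<longlonglongrightarrow> 0"

definition key_rate :: "(nat \<Rightarrow> nat set) \<Rightarrow> ereal" where
  "key_rate K = liminf (\<lambda>n. ereal (log 2 (real (card (K n))) / real n))"

definition secret_key_rate :: "('x::finite \<times> 'y::finite \<times> 'z::finite) pmf \<Rightarrow> ereal" where
  "secret_key_rate P = Sup {key_rate K |p K. admissible P p K}"


section \<open>Formation cost\<close>

definition total_variation :: "'a pmf \<Rightarrow> 'a pmf \<Rightarrow> real" where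
  "total_variation p q = (SUP A. \<bar>measure_pmf.prob p A - measure_pmf.prob q A\<bar>)"

text \<open>
  Law of Alice's output, Bob's output and the transcript when both parties start with the same
  \<open>m\<close> uniform secret bits.
\<close>

definition formation_law ::
    "nat \<Rightarrow> (bool list, bool list, 'x list, 'y list) protocol
      \<Rightarrow> ('x list \<times> 'y list \<times> nat list) pmf" where
  "formation_law m p =
     do {k \<leftarrow> pmf_of_set {k :: bool list. length k = m}; run_protocol p k k}"

text \<open>Law of \<open>N\<close> copies of \<open>(X, Y)\<close> together with the output of the channel \<open>W\<close> fed with \<open>Z\<^sup>N\<close>.\<close>

definition simulated_law ::
    "('x \<times> 'y \<times> 'z) pmf \<Rightarrow> nat \<Rightarrow> ('z list \<Rightarrow> nat list pmf)
      \<Rightarrow> ('x list \<times> 'y list \<times> nat list) pmf" where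
  "simulated_law P N W =
     do {w \<leftarrow> replicate_pmf N P; C \<leftarrow> W (Zs w); return_pmf (Xs w, Ys w, C)}"

definition formation_achievable ::
    "('x::finite \<times> 'y::finite \<times> 'z::finite) pmf \<Rightarrow> real \<Rightarrow> bool" where
  "formation_achievable P R \<longleftrightarrow>
     (\<forall>\<epsilon>>0. \<forall>\<^sub>F N in sequentially. \<exists>p W.
        finite_randomness p \<and>
        (\<forall>zs. finite (set_pmf (W zs))) \<and>
        (\<forall>(xs, ys, C) \<in> set_pmf (formation_law (nat \<lfloor>R * real N\<rfloor>) p).
            length xs = N \<and> length ys = N) \<and>
        total_variation (formation_law (nat \<lfloor>R * real N\<rfloor>) p) (simulated_law P N W) \<le> \<epsilon>)"

definition formation_cost :: "('x::finite \<times> 'y::finite \<times> 'z::finite) pmf \<Rightarrow> ereal" where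
  "formation_cost P = Inf {ereal R |R. R \<ge> 0 \<and> formation_achievable P R}"


section \<open>The family of distributions\<close>

text \<open>The numeral type \<open>3\<close> is the ring of integers modulo \<open>3\<close>, with elements \<open>0\<close>, \<open>1\<close>, \<open>2\<close>.\<close>

definition XY_pmf :: "real \<Rightarrow> (3 \<times> 3) pmf" where
  "XY_pmf \<alpha> = embed_pmf (\<lambda>(x, y).
     if y = x then 2 / 21 else if y - x = 1 then \<alpha> / 21 else (5 - \<alpha>) / 21)"

text \<open>\<open>None\<close> stands for \<open>\<bottom>\<close>.\<close>

definition XYZ_pmf :: "real \<Rightarrow> (3 \<times> 3 \<times> (3 \<times> 3) option) pmf" where
  "XYZ_pmf \<alpha> = map_pmf (\<lambda>(x, y). (x, y, if x = y then None else Some (x, y))) (XY_pmf \<alpha>)"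

text \<open>The weights form a probability mass function in the parameter range of interest.\<close>

lemma UNIV_mod3: "(UNIV :: 3 set) = {0, 1, 2}"
proof -
  have "card {0, 1, 2 :: 3} = CARD(3)" by simp
  then have "{0, 1, 2 :: 3} = UNIV" by (intro card_subset_eq) auto
  then show ?thesis by (rule sym)
qed

lemma pmf_XY_pmf:
  assumes "2 \<le> \<alpha>" "\<alpha> \<le> 5"
  shows "y - x = 0 \<Longrightarrow> pmf (XY_pmf \<alpha>) (x, y) = 2 / 21"
    and "y - x = 1 \<Longrightarrow> pmf (XY_pmf \<alpha>) (x, y) = \<alpha> / 21"
    and "y - x = 2 \<Longrightarrow> pmf (XY_pmf \<alpha>) (x, y) = (5 - \<alpha>) / 21"
proof -
  let ?f = "\<lambda>(x :: 3, y :: 3).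
    if y = x then 2 / 21 else if y - x = 1 then \<alpha> / 21 else (5 - \<alpha>) / 21"
  have nn: "?f q \<ge> 0" for q
    using assms by (auto split: prod.split)
  have "(\<Sum>q\<in>UNIV. ?f q) = (\<Sum>x\<in>UNIV. \<Sum>y\<in>UNIV. ?f (x, y))"
    unfolding UNIV_Times_UNIV[symmetric] sum.cartesian_product by (rule sum.cong) auto
  also have "\<dots> = 3 * (2 / 21 + \<alpha> / 21 + (5 - \<alpha>) / 21)"
    unfolding UNIV_mod3 by (simp add: diff_divide_distrib)
  also have "\<dots> = 1"
    by (simp add: field_simps)
  finally have "(\<integral>\<^sup>+q. ennreal (?f q) \<partial>count_space UNIV) = 1"
    using nn by (simp add: nn_integral_count_space_finite)
  then have *: "pmf (XY_pmf \<alpha>) q = ?f q" for q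
    unfolding XY_pmf_def using nn by (subst pmf_embed_pmf) auto
  show "y - x = 0 \<Longrightarrow> pmf (XY_pmf \<alpha>) (x, y) = 2 / 21"
    and "y - x = 1 \<Longrightarrow> pmf (XY_pmf \<alpha>) (x, y) = \<alpha> / 21"
    and "y - x = 2 \<Longrightarrow> pmf (XY_pmf \<alpha>) (x, y) = (5 - \<alpha>) / 21"
    by (auto simp: *)
qed

end

theory Submission
  imports Defs
begin

text \<open>
  For \<open>2 \<le> \<alpha> \<le> 3\<close> the variable \<open>Z\<close> can be degraded so that, given the degraded variable, \<open>X\<close> and
  \<open>Y\<close> are independent. Publishing it costs no secret bits.

  For \<open>\<alpha> > 3\<close> put \<open>e = X - Y\<close>, which Eve always knows, whereas she knows \<open>Y\<close> only if \<open>e \<noteq> 0\<close>.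
  The value \<open>e = 1\<close> has the smaller weight \<open>5 - \<alpha> < 2\<close>. A run of \<open>m\<close> copies in which Alice and Bob
  agree on all differences of their letters behaves like a single copy in which \<open>e = 0\<close> and
  \<open>e = 1\<close> have weights \<open>\<epsilon>\<close> and \<open>\<eta>\<close> relative to \<open>e = 2\<close>, where \<open>\<epsilon> \<rightarrow> 0\<close> and
  \<open>\<eta> / \<epsilon> \<rightarrow> 0\<close> as \<open>m\<close> grows. In a group of \<open>k \<approx> 1 / (8 \<epsilon>)\<close> runs the number of runs with
  \<open>e = 0\<close> is then roughly Poisson, and with \<open>x = k \<epsilon>\<close> the probabilities of \<open>0\<close>, \<open>1\<close>, \<open>2\<close> such
  runs are in the ratio \<open>1 : x : x\<^sup>2 / 2\<close>. The sum modulo three of Bob's run letters is hidden from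
  Eve once one run is erased. Since \<open>x\<^sup>2\<close> exceeds \<open>1 \<cdot> x\<^sup>2 / 2\<close>, a repetition code over groups with
  alternating signs makes Alice and Bob agree on such a sum, up to arbitrarily rare exceptions,
  whenever they accept. A linear code with good distance and good dual distance, which exists by
  counting, turns the resulting bits into a key that is exactly uniform given Eve's view unless
  exceptions are too frequent.
\<close>

section \<open>Entropy and mutual information of an almost uniform key\<close>

text \<open>Both halves turn on comparing the weights \<open>5 - \<alpha>\<close> and
  \<open>2\<close>. For \<alpha> between 2 and 3 every unequal pair is at least as likely as an
  equal one, so enough of its mass can be erased to level all nine pairs. For \<alpha> > 3 one has
  \<open>\<eta> / \<epsilon> = ((5 - \<alpha>) / 2) ^ m\<close>; near 3 the base is close to 1, so
  no fixed block size serves all \<alpha>. The obstacle is that the likeliest number of erased runs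
  in a group is 0, where Eve knows everything. Under plain repetition the pattern without any
  erasure would be accepted too and would outweigh the wanted one. Alternating signs force every
  wrong pattern to pair a group of type 0 with one of type 2, so that weights are compared two
  groups at a time. The deficit and the leakage must tend to zero without division by
  \<open>n\<close>. Uniformity is therefore kept exact: it is stated as invariance of a law under a
  bijection and passed through the code by linear algebra. Only the exponentially rare event of too
  many exceptions costs anything, and no typicality argument is needed.\<close>

lemma measure_pmf_finite_support:
  assumes "finite (set_pmf p)"
  shows "measure_pmf.prob p A = (\<Sum>x\<in>{x\<in>set_pmf p. x \<in> A}. pmf p x)"
proof -
  have "measure_pmf.prob p A = measure_pmf.prob p (A \<inter> set_pmf p)"
    by (simp add: measure_Int_set_pmf)
  also have "A \<inter> set_pmf p = {x\<in>set_pmf p. x \<in> A}" by auto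
  finally show ?thesis
    using assms by (simp add: measure_measure_pmf_finite)
qed

lemma entropy_map_pmf:
  fixes X :: "'a \<Rightarrow> 'k::countable"
  assumes fin: "finite (set_pmf p)"
  shows "prob_space.entropy (measure_pmf p) 2 (count_space UNIV) X =
    - (\<Sum>k\<in>set_pmf (map_pmf X p). pmf (map_pmf X p) k * log 2 (pmf (map_pmf X p) k))"
proof -
  interpret information_space "measure_pmf p" "2::real"
    by unfold_locales simp
  have "distributed (measure_pmf p) (count_space UNIV) X (pmf (map_pmf X p))"
    unfolding distributed_def
    by (simp add: map_pmf_rep_eq[symmetric] measure_pmf_eq_density[symmetric])
  then have "prob_space.entropy (measure_pmf p) 2 (count_space UNIV) X =
      - (\<integral>k. pmf (map_pmf X p) k * log 2 (pmf (map_pmf X p) k) \<partial>count_space UNIV)"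
    by (rule entropy_distr) simp
  also have "(\<integral>k. pmf (map_pmf X p) k * log 2 (pmf (map_pmf X p) k) \<partial>count_space UNIV) =
      (\<Sum>k\<in>set_pmf (map_pmf X p). pmf (map_pmf X p) k * log 2 (pmf (map_pmf X p) k))"
  proof -
    have "finite (set_pmf (map_pmf X p))" using fin by simp
    then show ?thesis
      by (subst lebesgue_integral_count_space_finite_support)
         (auto intro!: sum.mono_neutral_left elim!: rev_finite_subset
               simp: set_pmf_iff simp del: set_map_pmf)
  qed
  finally show ?thesis .
qed

text \<open>Countability of the value types makes the product of the two counting measures a
  counting measure again, so the pmfs themselves are the densities. Finite support supplies the
  integrability behind nonnegativity.\<close>

lemma mutual_information_map_pmf:
  fixes X :: "'a \<Rightarrow> 'k::countable" and Y :: "'a \<Rightarrow> 'w::countable"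
  assumes fin: "finite (set_pmf p)"
  defines "q \<equiv> map_pmf (\<lambda>a. (X a, Y a)) p"
  shows "prob_space.mutual_information (measure_pmf p) 2 (count_space UNIV) (count_space UNIV) X Y =
      (\<Sum>(k, w)\<in>set_pmf q. pmf q (k, w) *
        log 2 (pmf q (k, w) / (pmf (map_pmf fst q) k * pmf (map_pmf snd q) w)))" (is "?I = ?S")
    and "0 \<le> prob_space.mutual_information (measure_pmf p) 2 (count_space UNIV) (count_space UNIV) X Y"
proof -
  interpret information_space "measure_pmf p" "2::real"
    by unfold_locales simp
  have st: "count_space (UNIV :: 'k set) \<Otimes>\<^sub>M count_space (UNIV :: 'w set) = count_space UNIV"
    by (subst pair_measure_countable) auto
  have m: "map_pmf fst q = map_pmf X p" "map_pmf snd q = map_pmf Y p"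
    by (simp_all add: q_def pmf.map_comp comp_def)
  have finq: "finite (set_pmf q)"
    using fin by (simp add: q_def)
  have sf: "sigma_finite_measure (count_space (UNIV :: 'k set))"
      "sigma_finite_measure (count_space (UNIV :: 'w set))"
    by (auto intro: sigma_finite_measure_count_space_countable)
  have dX: "distributed (measure_pmf p) (count_space UNIV) X (pmf (map_pmf X p))"
   and dY: "distributed (measure_pmf p) (count_space UNIV) Y (pmf (map_pmf Y p))"
    unfolding distributed_def
    by (simp_all add: map_pmf_rep_eq[symmetric] measure_pmf_eq_density[symmetric])
  have dXY: "distributed (measure_pmf p) (count_space UNIV \<Otimes>\<^sub>M count_space UNIV)
      (\<lambda>a. (X a, Y a)) (pmf q)"
    unfolding distributed_def st q_def
    by (simp add: map_pmf_rep_eq[symmetric] measure_pmf_eq_density[symmetric])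
  let ?f = "\<lambda>x. pmf q x * log 2 (pmf q x / (pmf (map_pmf X p) (fst x) * pmf (map_pmf Y p) (snd x)))"
  have "?I = integral\<^sup>L (count_space UNIV \<Otimes>\<^sub>M count_space UNIV) ?f"
    by (rule mutual_information_distr[OF sf dX _ dY _ dXY]) simp_all
  also have "\<dots> = (\<Sum>x\<in>set_pmf q. ?f x)"
    unfolding st using finq
    by (subst lebesgue_integral_count_space_finite_support)
       (auto intro!: sum.mono_neutral_left intro: finite_subset[where B="set_pmf q"]
             simp: set_pmf_iff)
  finally show "?I = ?S"
    unfolding m by (simp add: case_prod_unfold)
  have "integrable (count_space UNIV) ?f"
    using integrable_measure_pmf_finite[OF finq, of
        "\<lambda>x. log 2 (pmf q x / (pmf (map_pmf X p) (fst x) * pmf (map_pmf Y p) (snd x)))"]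
    by (simp add: measure_pmf_eq_density integrable_density)
  then show "0 \<le> ?I"
    by (intro mutual_information_nonneg[OF sf dX _ dY _ dXY]) (simp_all add: st)
qed

text \<open>Gibbs' inequality against the uniform law on \<open>K\<close>, from
  \<open>ln t \<le> t - 1\<close> at \<open>t = 1 / (M * pmf q k)\<close> with
  \<open>M = card K\<close>.\<close>

lemma entropy_le_log_card:
  fixes q :: "'k pmf"
  assumes fin: "finite K" and sub: "set_pmf q \<subseteq> K"
  shows "- (\<Sum>k\<in>set_pmf q. pmf q k * log 2 (pmf q k)) \<le> log 2 (real (card K))"
proof -
  let ?S = "set_pmf q"
  have finS: "finite ?S" using fin sub by (rule finite_subset[rotated])
  have pos: "card K > 0" using fin sub set_pmf_not_empty[of q] by (auto simp: card_gt_0_iff)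
  let ?M = "real (card K)"
  have one: "(\<Sum>k\<in>?S. pmf q k) = 1"
    using finS by (rule sum_pmf_eq_1) simp
  have "(\<Sum>k\<in>?S. pmf q k * - ln (?M * pmf q k)) \<le> (\<Sum>k\<in>?S. 1 / ?M - pmf q k)"
  proof (rule sum_mono)
    fix k assume "k \<in> ?S"
    then have p: "pmf q k > 0" by (simp add: pmf_positive)
    have "- ln (?M * pmf q k) = ln (1 / (?M * pmf q k))"
      using p pos by (simp add: ln_div ln_mult)
    also have "\<dots> \<le> 1 / (?M * pmf q k) - 1"
      using p pos by (intro ln_le_minus_one) auto
    finally have "pmf q k * - ln (?M * pmf q k) \<le> pmf q k * (1 / (?M * pmf q k) - 1)"
      using p by (intro mult_left_mono) auto
    also have "\<dots> = 1 / ?M - pmf q k"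
      using p pos by (simp add: field_simps)
    finally show "pmf q k * - ln (?M * pmf q k) \<le> 1 / ?M - pmf q k" .
  qed
  also have "\<dots> = real (card ?S) / ?M - 1"
    by (simp add: sum_subtractf one)
  also have "\<dots> \<le> 0"
    using pos card_mono[OF fin sub] by simp
  finally have neg: "(\<Sum>k\<in>?S. pmf q k * - ln (?M * pmf q k)) \<le> 0" .
  have "(\<Sum>k\<in>?S. pmf q k * - ln (?M * pmf q k)) =
      (\<Sum>k\<in>?S. - (pmf q k * ln (pmf q k)) - ln ?M * pmf q k)"
    using pos by (intro sum.cong refl) (auto simp: ln_mult pmf_positive algebra_simps)
  also have "\<dots> = - (\<Sum>k\<in>?S. pmf q k * ln (pmf q k)) - ln ?M"
    by (simp add: sum_subtractf sum_negf sum_distrib_left[symmetric] one)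
  finally have "- (\<Sum>k\<in>?S. pmf q k * ln (pmf q k)) \<le> ln ?M"
    using neg by simp
  then have "- (\<Sum>k\<in>?S. pmf q k * ln (pmf q k)) / ln 2 \<le> ln ?M / ln 2"
    by (intro divide_right_mono) auto
  then show ?thesis
    by (simp add: log_def sum_divide_distrib)
qed

text \<open>
  The deficit \<open>log |K| - H(K)\<close> and the leakage \<open>I(K; W)\<close> add up to the expectation of
  \<open>log (|K| P(K | W))\<close>, which vanishes where the key is uniform given \<open>W\<close>.
\<close>

lemma uniform_key_bounds:
  fixes X :: "'a \<Rightarrow> 'k::countable" and Y :: "'a \<Rightarrow> 'w::countable"
  assumes fin: "finite (set_pmf p)" and finK: "finite K"
    and sub: "\<And>a. a \<in> set_pmf p \<Longrightarrow> X a \<in> K"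
    and unif: "\<And>w k k'. w \<in> E \<Longrightarrow> k \<in> K \<Longrightarrow> k' \<in> K \<Longrightarrow>
      measure_pmf.prob p {a. X a = k \<and> Y a = w} = measure_pmf.prob p {a. X a = k' \<and> Y a = w}"
    and bad: "measure_pmf.prob p {a. Y a \<notin> E} \<le> \<epsilon>"
  defines "D \<equiv> log 2 (real (card K)) - prob_space.entropy (measure_pmf p) 2 (count_space UNIV) X"
    and "I \<equiv> prob_space.mutual_information (measure_pmf p) 2 (count_space UNIV) (count_space UNIV) X Y"
  shows "0 \<le> D" "0 \<le> I" "D + I \<le> \<epsilon> * log 2 (real (card K))"
proof -
  define q where "q = map_pmf (\<lambda>a. (X a, Y a)) p"
  let ?M = "real (card K)"
  let ?S = "set_pmf q"
  have m: "map_pmf fst q = map_pmf X p" "map_pmf snd q = map_pmf Y p"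
    by (simp_all add: q_def pmf.map_comp comp_def)
  have finq: "finite ?S" using fin by (simp add: q_def)
  have one: "(\<Sum>z\<in>?S. pmf q z) = 1"
    using finq by (rule sum_pmf_eq_1) simp
  have subK: "set_pmf (map_pmf X p) \<subseteq> K" using sub by auto
  obtain a0 where "a0 \<in> set_pmf p" using set_pmf_not_empty[of p] by auto
  with sub finK have M: "?M \<ge> 1"
    by (metis card_gt_0_iff empty_iff less_eq_Suc_le of_nat_1 of_nat_le_iff One_nat_def)
  show "0 \<le> D"
    unfolding D_def entropy_map_pmf[OF fin] using entropy_le_log_card[OF finK subK] by simp
  show "0 \<le> I"
    unfolding I_def by (rule mutual_information_map_pmf(2)[OF fin])
  have pq: "pmf q (k, w) = measure_pmf.prob p {a. X a = k \<and> Y a = w}" for k w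
    by (auto simp: q_def pmf_map vimage_def intro!: arg_cong[where f="measure_pmf.prob p"])
  have fst_q: "pmf (map_pmf fst q) k = (\<Sum>z\<in>{z\<in>?S. fst z = k}. pmf q z)" for k
    unfolding pmf_map by (subst measure_pmf_finite_support[OF finq]) simp
  have entr: "(\<Sum>k\<in>set_pmf (map_pmf X p). pmf (map_pmf X p) k * log 2 (pmf (map_pmf X p) k)) =
      (\<Sum>z\<in>?S. pmf q z * log 2 (pmf (map_pmf fst q) (fst z)))"
  proof -
    have "(\<Sum>z\<in>?S. pmf q z * log 2 (pmf (map_pmf fst q) (fst z))) =
      (\<Sum>k\<in>fst ` ?S. \<Sum>z\<in>{z\<in>?S. fst z = k}. pmf q z * log 2 (pmf (map_pmf fst q) (fst z)))"
      using finq by (rule sum.image_gen)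
    also have "\<dots> = (\<Sum>k\<in>fst ` ?S. pmf (map_pmf fst q) k * log 2 (pmf (map_pmf fst q) k))"
      by (intro sum.cong refl) (simp add: fst_q sum_distrib_right)
    also have "fst ` ?S = set_pmf (map_pmf X p)"
      by (simp add: q_def image_image)
    finally show ?thesis by (simp add: m)
  qed
  have pointwise: "pmf q z * (log 2 ?M + log 2 (pmf (map_pmf fst q) (fst z))) +
      pmf q z * log 2 (pmf q z / (pmf (map_pmf fst q) (fst z) * pmf (map_pmf snd q) (snd z)))
      \<le> (if snd z \<notin> E then pmf q z * log 2 ?M else 0)" if "z \<in> ?S" for z
  proof -
    obtain k w where z: "z = (k, w)" by force
    have p0: "pmf q (k, w) > 0" using that z by (simp add: pmf_positive)
    have f0: "pmf (map_pmf fst q) k > 0" and s0: "pmf (map_pmf snd q) w > 0"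
      using that z by (force intro!: pmf_positive)+
    have "log 2 ?M + log 2 (pmf (map_pmf fst q) k) +
        log 2 (pmf q (k, w) / (pmf (map_pmf fst q) k * pmf (map_pmf snd q) w)) =
        log 2 (?M * pmf q (k, w) / pmf (map_pmf snd q) w)"
      using p0 f0 s0 M by (simp add: log_mult log_divide)
    also have "\<dots> \<le> (if w \<notin> E then log 2 ?M else 0)"
    proof (cases "w \<in> E")
      case True
      have kK: "k \<in> K" using that z sub by (auto simp: q_def)
      have "?M * pmf q (k, w) = (\<Sum>k'\<in>K. pmf q (k', w))"
        using unif[OF True _ kK] by (simp add: pq)
      also have "\<dots> = measure_pmf.prob q ((\<lambda>k'. (k', w)) ` K)"
        using finK by (subst measure_measure_pmf_finite) (auto simp: sum.reindex inj_on_def)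
      also have "\<dots> = pmf (map_pmf snd q) w"
      proof -
        have "set_pmf q \<subseteq> K \<times> UNIV" using sub by (auto simp: q_def)
        then have "(\<lambda>k'. (k', w)) ` K \<inter> set_pmf q = snd -` {w} \<inter> set_pmf q" by auto
        then show ?thesis
          unfolding pmf_map by (metis measure_Int_set_pmf)
      qed
      finally show ?thesis using True s0 by simp
    next
      \<comment> \<open>Outside \<open>E\<close> only \<open>P(k | w) \<le> 1\<close> is available,
        so such a view costs at most the full \<open>log |K|\<close>.\<close>
      case False
      have "pmf q (k, w) \<le> pmf (map_pmf snd q) w"
        using measure_pmf.finite_measure_mono[of "{(k, w)}" "snd -` {w}" q]
        by (simp add: pmf_map[of snd] measure_pmf_single)
      then have "?M * pmf q (k, w) / pmf (map_pmf snd q) w \<le> ?M"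
        using s0 M by (simp add: divide_le_eq mult_left_mono)
      then show ?thesis using False p0 s0 M by simp
    qed
    finally have "pmf q (k, w) * (log 2 ?M + log 2 (pmf (map_pmf fst q) k) +
        log 2 (pmf q (k, w) / (pmf (map_pmf fst q) k * pmf (map_pmf snd q) w))) \<le>
        pmf q (k, w) * (if w \<notin> E then log 2 ?M else 0)"
      using p0 by (intro mult_left_mono) auto
    then show ?thesis by (simp add: z distrib_left split: if_splits)
  qed
  have "D + I = (\<Sum>z\<in>?S. pmf q z * (log 2 ?M + log 2 (pmf (map_pmf fst q) (fst z))) +
      pmf q z * log 2 (pmf q z / (pmf (map_pmf fst q) (fst z) * pmf (map_pmf snd q) (snd z))))"
    unfolding D_def I_def entropy_map_pmf[OF fin] mutual_information_map_pmf(1)[OF fin] entr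
      q_def[symmetric]
    by (simp add: sum.distrib distrib_left sum_distrib_right[symmetric] one case_prod_unfold)
  also have "\<dots> \<le> (\<Sum>z\<in>?S. if snd z \<notin> E then pmf q z * log 2 ?M else 0)"
    by (rule sum_mono) (rule pointwise)
  also have "\<dots> = (\<Sum>z\<in>{z\<in>?S. snd z \<notin> E}. pmf q z) * log 2 ?M"
    using finq by (simp add: sum.If_cases sum_distrib_right Int_def)
  also have "(\<Sum>z\<in>{z\<in>?S. snd z \<notin> E}. pmf q z) = measure_pmf.prob q {z. snd z \<notin> E}"
    by (subst measure_pmf_finite_support[OF finq]) simp
  also have "\<dots> = measure_pmf.prob p {a. Y a \<notin> E}"
    by (simp add: q_def vimage_def)
  also have "\<dots> * log 2 ?M \<le> \<epsilon> * log 2 ?M"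
    using bad M by (intro mult_right_mono) auto
  finally show "D + I \<le> \<epsilon> * log 2 ?M" .
qed

section \<open>Binary linear codes as families of finite sets\<close>

text \<open>
  Vectors over the field with two elements are finite sets under symmetric difference, and the
  inner product of two vectors is the parity of the cardinality of their intersection.
\<close>

definition parity_sign :: "nat set \<Rightarrow> nat set \<Rightarrow> real" where
  "parity_sign R C = (- 1) ^ card (R \<inter> C)"

lemma parity_sign_cases: "parity_sign R C = (if even (card (R \<inter> C)) then 1 else - 1)"
  by (simp add: parity_sign_def)

lemma parity_sign_Un:
  assumes "finite C" "finite D" "C \<inter> D = {}"
  shows "parity_sign R (C \<union> D) = parity_sign R C * parity_sign R D"
proof -
  have "card (R \<inter> (C \<union> D)) = card (R \<inter> C) + card (R \<inter> D)"
    using assms by (subst Int_Un_distrib, subst card_Un_disjoint) auto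
  then show ?thesis by (simp add: parity_sign_def power_add)
qed

lemma parity_sign_eq_prod:
  assumes "finite C"
  shows "parity_sign R C = (\<Prod>u\<in>C. if u \<in> R then - 1 else 1)"
  using assms by (simp add: parity_sign_def prod.If_cases Int_commute)

text \<open>Orthogonality of characters: the sum over all subsets factors into
  \<open>\<plusminus>1 + 1\<close> over the elements of \<open>U\<close>, and one element of
  \<open>R\<close> makes a factor vanish.\<close>

lemma sum_parity_sign:
  assumes "finite U"
  shows "(\<Sum>C\<in>Pow U. parity_sign R C) = (if R \<inter> U = {} then 2 ^ card U else 0)"
proof -
  have "(\<Sum>C\<in>Pow U. parity_sign R C) =
      (\<Sum>C\<in>Pow U. (\<Prod>u\<in>C. if u \<in> R then - 1 else 1) * (\<Prod>u\<in>U - C. 1))"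
    using assms by (intro sum.cong refl) (simp add: parity_sign_eq_prod finite_subset)
  also have "\<dots> = (\<Prod>u\<in>U. (if u \<in> R then - 1 else 1) + 1 :: real)"
    using assms by (rule prod_add[symmetric])
  also have "\<dots> = (if R \<inter> U = {} then 2 ^ card U else 0)"
  proof (cases "R \<inter> U = {}")
    case True
    then have "(\<Prod>u\<in>U. (if u \<in> R then - 1 else 1) + 1 :: real) = (\<Prod>u\<in>U. 2)"
      by (intro prod.cong) auto
    then show ?thesis using True by simp
  next
    case False
    then show ?thesis using assms by (auto intro!: prod_zero)
  qed
  finally show ?thesis .
qed

lemma card_even_inter:
  fixes U E :: "nat set"
  assumes "finite U" "E \<inter> U \<noteq> {}"
  shows "2 * card {R \<in> Pow U. even (card (R \<inter> E))} = 2 ^ card U"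
proof -
  let ?A = "{R \<in> Pow U. even (card (R \<inter> E))}"
  have "0 = (\<Sum>R\<in>Pow U. parity_sign E R)"
    using assms by (simp add: sum_parity_sign)
  also have "\<dots> = (\<Sum>R\<in>Pow U. 2 * (if even (card (R \<inter> E)) then 1 else 0) - 1)"
    by (intro sum.cong) (auto simp: parity_sign_cases Int_commute)
  also have "\<dots> = 2 * real (card ?A) - 2 ^ card U"
    using assms
    by (simp add: sum_subtractf sum_distrib_left[symmetric] card_Pow sum.If_cases Int_def)
  finally have "real (2 * card ?A) = real (2 ^ card U)" by simp
  then show ?thesis by (subst (asm) of_nat_eq_iff)
qed

text \<open>The linear combination over the two-element field of the rows in \<open>V\<close>, cut
  to the first \<open>N\<close> coordinates.\<close>

definition row_sum :: "nat \<Rightarrow> (nat \<Rightarrow> nat set) \<Rightarrow> nat set \<Rightarrow> nat set" where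
  "row_sum N \<rho> V = {j. j < N \<and> odd (card {i \<in> V. j \<in> \<rho> i})}"

lemma prod_parity_sign_rows:
  assumes "finite V" "C \<subseteq> {..<N}"
  shows "(\<Prod>i\<in>V. parity_sign (\<rho> i) C) = parity_sign (row_sum N \<rho> V) C"
proof -
  have fin: "finite C" using assms(2) by (rule finite_subset) simp
  have "(\<Prod>i\<in>V. parity_sign (\<rho> i) C) = (\<Prod>i\<in>V. \<Prod>j\<in>C. if j \<in> \<rho> i then - 1 else 1)"
    using fin by (simp add: parity_sign_eq_prod)
  also have "\<dots> = (\<Prod>j\<in>C. \<Prod>i\<in>V. if j \<in> \<rho> i then - 1 else 1)"
    by (rule prod.swap)
  also have "\<dots> = (\<Prod>j\<in>C. if j \<in> row_sum N \<rho> V then - 1 else 1)"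
    using assms by (intro prod.cong refl) (auto simp: prod.If_cases row_sum_def Int_def)
  finally show ?thesis using fin by (simp add: parity_sign_eq_prod)
qed

section \<open>Syndromes and their equidistribution over free coordinates\<close>

definition syndrome :: "nat \<Rightarrow> (nat \<Rightarrow> nat set) \<Rightarrow> nat set \<Rightarrow> nat set" where
  "syndrome m \<rho> C = {i. i < m \<and> odd (card (\<rho> i \<inter> C))}"

lemma syndrome_subset: "syndrome m \<rho> C \<subseteq> {..<m}"
  by (auto simp: syndrome_def)

text \<open>
  Expand the indicator of a syndrome into characters: by independence of the rows on \<open>U\<close>, only the
  trivial one has a nonzero sum.
\<close>

lemma card_syndrome_fiber:
  assumes U: "U \<subseteq> {..<N}" and D: "D \<subseteq> {..<N} - U" and B: "B \<subseteq> {..<m}"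
    and indep: "\<And>V. V \<subseteq> {..<m} \<Longrightarrow> V \<noteq> {} \<Longrightarrow> row_sum N \<rho> V \<inter> U \<noteq> {}"
  shows "2 ^ m * card {C \<in> Pow U. syndrome m \<rho> (C \<union> D) = B} = 2 ^ card U"
proof -
  have finU: "finite U" and finD: "finite D" using U D by (auto intro: finite_subset)
  \<comment> \<open>The coordinates in \<open>D\<close> are fixed; their contribution and the
    prescribed bit of \<open>B\<close> merge into one constant sign per row.\<close>
  define s where "s i = (if i \<in> B then - 1 else 1) * parity_sign (\<rho> i) D" for i
  have char: "(if syndrome m \<rho> (C \<union> D) = B then 2 ^ m else 0) =
      (\<Sum>V\<in>Pow {..<m}. (\<Prod>i\<in>V. s i) * parity_sign (row_sum N \<rho> V) C)" if C: "C \<in> Pow U" for C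
  proof -
    have finC: "finite C" and CN: "C \<subseteq> {..<N}" using C finU U by (auto intro: finite_subset)
    have sg: "s i * parity_sign (\<rho> i) C =
        (if i \<in> B \<longleftrightarrow> i \<in> syndrome m \<rho> (C \<union> D) then 1 else - 1)" if "i < m" for i
    proof -
      have "parity_sign (\<rho> i) D * parity_sign (\<rho> i) C = parity_sign (\<rho> i) (C \<union> D)"
        using C D finC finD by (subst parity_sign_Un) auto
      then show ?thesis using that
        by (auto simp: s_def syndrome_def parity_sign_cases[of "\<rho> i" "C \<union> D"])
    qed
    have "(\<Sum>V\<in>Pow {..<m}. (\<Prod>i\<in>V. s i) * parity_sign (row_sum N \<rho> V) C) =
        (\<Sum>V\<in>Pow {..<m}. (\<Prod>i\<in>V. s i * parity_sign (\<rho> i) C) * (\<Prod>i\<in>{..<m} - V. 1))"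
      using CN by (intro sum.cong refl)
        (simp add: prod.distrib prod_parity_sign_rows[symmetric] finite_subset)
    also have "\<dots> = (\<Prod>i<m. s i * parity_sign (\<rho> i) C + 1)"
      by (rule prod_add[symmetric]) simp
    also have "\<dots> = (if syndrome m \<rho> (C \<union> D) = B then 2 ^ m else 0)"
    proof (cases "syndrome m \<rho> (C \<union> D) = B")
      case True
      then show ?thesis by (simp add: sg)
    next
      case False
      then obtain i where "i < m" "\<not> (i \<in> B \<longleftrightarrow> i \<in> syndrome m \<rho> (C \<union> D))"
        using B syndrome_subset[of m \<rho> "C \<union> D"] by blast
      then show ?thesis using False sg[of i] by (auto intro!: prod_zero bexI[of _ i])
    qed
    finally show ?thesis by simp
  qed
  have "2 ^ m * real (card {C \<in> Pow U. syndrome m \<rho> (C \<union> D) = B}) =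
      (\<Sum>C\<in>Pow U. if syndrome m \<rho> (C \<union> D) = B then 2 ^ m else 0)"
    using finU by (simp add: sum.If_cases Int_def)
  also have "\<dots> = (\<Sum>C\<in>Pow U. \<Sum>V\<in>Pow {..<m}. (\<Prod>i\<in>V. s i) * parity_sign (row_sum N \<rho> V) C)"
    by (rule sum.cong) (simp_all only: char)
  also have "\<dots> = (\<Sum>V\<in>Pow {..<m}. (\<Prod>i\<in>V. s i) * (\<Sum>C\<in>Pow U. parity_sign (row_sum N \<rho> V) C))"
    by (subst sum.swap) (simp only: sum_distrib_left)
  also have "\<dots> = (\<Sum>V\<in>Pow {..<m}. if V = {} then 2 ^ card U else 0)"
  proof (rule sum.cong)
    fix V assume "V \<in> Pow {..<m}"
    then show "(\<Prod>i\<in>V. s i) * (\<Sum>C\<in>Pow U. parity_sign (row_sum N \<rho> V) C) =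
        (if V = {} then 2 ^ card U else 0)"
      using indep[of V] by (auto simp: sum_parity_sign[OF finU] row_sum_def)
  qed simp
  also have "\<dots> = real (2 ^ card U)"
    by simp
  finally have "real (2 ^ m * card {C \<in> Pow U. syndrome m \<rho> (C \<union> D) = B}) = real (2 ^ card U)"
    by simp
  then show ?thesis by (subst (asm) of_nat_eq_iff)
qed

text \<open>Linearity of the syndrome: \<open>C \<inter> D\<close> contributes its sign twice and
  cancels.\<close>

lemma syndrome_eq_imp_even:
  assumes "finite C" "finite D" "syndrome m \<rho> C = syndrome m \<rho> D" "i < m"
  shows "even (card (\<rho> i \<inter> sym_diff C D))"
proof -
  have "parity_sign (\<rho> i) C * parity_sign (\<rho> i) D = parity_sign (\<rho> i) (sym_diff C D)"
  proof -
    have C: "C = (C - D) \<union> (C \<inter> D)" and D: "D = (D - C) \<union> (C \<inter> D)" by auto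
    have "parity_sign (\<rho> i) C = parity_sign (\<rho> i) (C - D) * parity_sign (\<rho> i) (C \<inter> D)"
      using assms by (subst C, subst parity_sign_Un) auto
    moreover have "parity_sign (\<rho> i) D = parity_sign (\<rho> i) (D - C) * parity_sign (\<rho> i) (C \<inter> D)"
      using assms by (subst D, subst parity_sign_Un) auto
    moreover have "parity_sign (\<rho> i) (sym_diff C D) =
        parity_sign (\<rho> i) (C - D) * parity_sign (\<rho> i) (D - C)"
      using assms by (subst parity_sign_Un) auto
    ultimately show ?thesis by (simp add: parity_sign_cases)
  qed
  moreover have "odd (card (\<rho> i \<inter> C)) \<longleftrightarrow> odd (card (\<rho> i \<inter> D))"
    using assms(3,4) by (auto simp: syndrome_def set_eq_iff)
  ultimately show ?thesis
    by (auto simp: parity_sign_cases split: if_splits)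
qed

subsection \<open>Existence by counting\<close>

text \<open>Chernoff's trick: a set of at most \<open>s\<close> elements has weight
  \<open>z ^ card W / z ^ s \<ge> 1\<close>, and the total weight of all sets is binomial.\<close>

lemma card_small_subsets_le:
  fixes z :: real
  assumes "0 < z" "z \<le> 1"
  shows "real (card {W \<in> Pow {..<N}. card W \<le> s}) \<le> (1 + z) ^ N / z ^ s"
proof -
  have "real (card {W \<in> Pow {..<N}. card W \<le> s}) = (\<Sum>W\<in>{W \<in> Pow {..<N}. card W \<le> s}. 1)"
    by simp
  also have "\<dots> \<le> (\<Sum>W\<in>{W \<in> Pow {..<N}. card W \<le> s}. z ^ card W / z ^ s)"
    using assms by (intro sum_mono) (auto simp: power_decreasing)
  also have "\<dots> \<le> (\<Sum>W\<in>Pow {..<N}. z ^ card W / z ^ s)"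
    using assms by (intro sum_mono2) auto
  also have "\<dots> = (\<Sum>W\<in>Pow {..<N}. (\<Prod>j\<in>W. z) * (\<Prod>j\<in>{..<N} - W. 1)) / z ^ s"
    by (simp add: sum_divide_distrib)
  also have "\<dots> = (\<Prod>j<N. z + 1) / z ^ s"
    by (subst prod_add[symmetric]) auto
  finally show ?thesis by (simp add: add.commute)
qed

text \<open>Rows are chosen independently and each is orthogonal to \<open>E\<close> in exactly half
  of the cases; only the first \<open>h\<close> rows are constrained.\<close>

lemma card_rows_orthogonal:
  assumes E: "E \<subseteq> {..<N}" "E \<noteq> {}" and hm: "h \<le> m"
  shows "2 ^ h * card {\<rho> \<in> {..<m} \<rightarrow>\<^sub>E Pow {..<N}. \<forall>i<h. even (card (\<rho> i \<inter> E))} = 2 ^ (N * m)"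
proof -
  let ?A = "{R \<in> Pow {..<N}. even (card (R \<inter> E))}"
  have A: "2 * card ?A = 2 ^ N"
    using card_even_inter[of "{..<N}" E] E by auto
  have "{\<rho> \<in> {..<m} \<rightarrow>\<^sub>E Pow {..<N}. \<forall>i<h. even (card (\<rho> i \<inter> E))} =
      (\<Pi>\<^sub>E i\<in>{..<m}. if i < h then ?A else Pow {..<N})"
    (is "?L = ?R")
  proof (intro set_eqI iffI)
    fix \<rho> assume "\<rho> \<in> ?L"
    then show "\<rho> \<in> ?R" by (simp add: PiE_iff)
  next
    fix \<rho> assume \<rho>: "\<rho> \<in> ?R"
    then have *: "\<rho> i \<in> (if i < h then ?A else Pow {..<N})" if "i < m" for i
      using that by (simp only: PiE_iff) simp
    have "\<rho> i \<in> Pow {..<N}" if "i < m" for i using *[OF that] by (simp split: if_splits)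
    moreover have "even (card (\<rho> i \<inter> E))" if "i < h" for i using *[of i] that hm by simp
    ultimately show "\<rho> \<in> ?L" using \<rho> by (simp add: PiE_iff)
  qed
  then have "card {\<rho> \<in> {..<m} \<rightarrow>\<^sub>E Pow {..<N}. \<forall>i<h. even (card (\<rho> i \<inter> E))} =
      (\<Prod>i<m. card (if i < h then ?A else Pow {..<N}))"
    by (simp add: card_PiE)
  also have "\<dots> = (\<Prod>i\<in>{..<h} \<union> {h..<m}. card (if i < h then ?A else Pow {..<N}))"
    using hm by (simp only: ivl_disj_un_one)
  also have "\<dots> = card ?A ^ h * (2 ^ N) ^ (m - h)"
    by (subst prod.union_disjoint) (auto simp: card_Pow)
  finally have "2 ^ h * card {\<rho> \<in> {..<m} \<rightarrow>\<^sub>E Pow {..<N}. \<forall>i<h. even (card (\<rho> i \<inter> E))} =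
      (2 * card ?A) ^ h * (2 ^ N) ^ (m - h)"
    by (simp add: power_mult_distrib)
  also have "\<dots> = (2 ^ N) ^ (h + (m - h))"
    unfolding A by (rule power_add[symmetric])
  also have "\<dots> = 2 ^ (N * m)"
    using hm by (simp add: power_mult)
  finally show ?thesis .
qed

text \<open>Pick \<open>i0\<close> in \<open>V\<close>. The other rows together with the combination
  \<open>W\<close> determine row \<open>i0\<close>, so forgetting that row is injective on the
  matrices counted.\<close>

lemma card_rows_combination:
  assumes V: "V \<subseteq> {..<m}" "V \<noteq> {}"
  shows "card {\<rho> \<in> {..<m} \<rightarrow>\<^sub>E Pow {..<N}. row_sum N \<rho> V = W} * 2 ^ N \<le> 2 ^ (N * m)"
proof -
  let ?A = "{\<rho> \<in> {..<m} \<rightarrow>\<^sub>E Pow {..<N}. row_sum N \<rho> V = W}"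
  obtain i0 where i0: "i0 \<in> V" "i0 < m" using V by auto
  have finV: "finite V" using V by (auto intro: finite_subset)
  let ?I = "{..<m} - {i0}"
  have "inj_on (\<lambda>\<rho>. restrict \<rho> ?I) ?A"
  proof (rule inj_onI)
    fix \<rho> \<sigma> assume \<rho>: "\<rho> \<in> ?A" and \<sigma>: "\<sigma> \<in> ?A" and eq: "restrict \<rho> ?I = restrict \<sigma> ?I"
    have same: "\<rho> i = \<sigma> i" if "i < m" "i \<noteq> i0" for i
      using that fun_cong[OF eq, of i] by simp
    have step: "j \<in> \<tau> i0 \<longleftrightarrow> (j \<in> W \<longleftrightarrow> even (card {i \<in> V - {i0}. j \<in> \<tau> i}))"
      if "j < N" "\<tau> \<in> ?A" for \<tau> j
    proof -
      have "{i \<in> V. j \<in> \<tau> i} =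
          (if j \<in> \<tau> i0 then insert i0 {i \<in> V - {i0}. j \<in> \<tau> i} else {i \<in> V - {i0}. j \<in> \<tau> i})"
        using i0 by auto
      then have "card {i \<in> V. j \<in> \<tau> i} =
          card {i \<in> V - {i0}. j \<in> \<tau> i} + (if j \<in> \<tau> i0 then 1 else 0)"
        using finV by auto
      moreover have "j \<in> W \<longleftrightarrow> odd (card {i \<in> V. j \<in> \<tau> i})"
        using that by (auto simp: row_sum_def)
      ultimately show ?thesis by auto
    qed
    have "\<rho> i0 = \<sigma> i0"
    proof (rule set_eqI)
      fix j
      have "{i \<in> V - {i0}. j \<in> \<rho> i} = {i \<in> V - {i0}. j \<in> \<sigma> i}"
        using same V by auto
      moreover have "\<rho> i0 \<subseteq> {..<N}" "\<sigma> i0 \<subseteq> {..<N}"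
        using \<rho> \<sigma> i0 by (auto simp: PiE_iff)
      ultimately show "j \<in> \<rho> i0 \<longleftrightarrow> j \<in> \<sigma> i0"
        using step[OF _ \<rho>, of j] step[OF _ \<sigma>, of j] by (cases "j < N") auto
    qed
    with same have "\<rho> i = \<sigma> i" if "i < m" for i using that by metis
    then show "\<rho> = \<sigma>" using \<rho> \<sigma> by (intro PiE_ext[of \<rho> "{..<m}" _ \<sigma>]) auto
  qed
  moreover have "(\<lambda>\<rho>. restrict \<rho> ?I) ` ?A \<subseteq> ?I \<rightarrow>\<^sub>E Pow {..<N}"
    by (intro image_subsetI) (simp add: PiE_iff)
  ultimately have "card ?A \<le> card (?I \<rightarrow>\<^sub>E Pow {..<N})"
    by (intro card_inj_on_le) (auto intro: finite_PiE)
  also have "\<dots> = (2 ^ N) ^ (m - 1)"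
    using i0 by (simp add: card_PiE card_Pow)
  finally have "card ?A * 2 ^ N \<le> (2 ^ N) ^ (m - 1) * 2 ^ N" by simp
  also have "\<dots> = (2 ^ N) ^ Suc (m - 1)" by simp
  also have "\<dots> = 2 ^ (N * m)" using i0 by (simp add: power_mult)
  finally show ?thesis .
qed

text \<open>The first clause says that the code checked by the first \<open>h\<close> rows has
  minimum distance above \<open>2 * t\<close>, hence corrects \<open>t\<close> errors. The second is
  a dual distance: no nonzero combination of all \<open>h + l\<close> rows has weight at most
  \<open>t\<close>, so knowing \<open>t\<close> positions says nothing about the syndrome.\<close>

definition key_code :: "nat \<Rightarrow> nat \<Rightarrow> nat \<Rightarrow> nat \<Rightarrow> (nat \<Rightarrow> nat set) \<Rightarrow> bool" where
  "key_code N h l t \<rho> \<longleftrightarrow>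
     (\<forall>E \<subseteq> {..<N}. E \<noteq> {} \<longrightarrow> card E \<le> 2 * t \<longrightarrow> (\<exists>i<h. odd (card (\<rho> i \<inter> E)))) \<and>
     (\<forall>V \<subseteq> {..<h + l}. V \<noteq> {} \<longrightarrow> t < card (row_sum N \<rho> V))"

text \<open>Union bound over all matrices: each clause of \<open>key_code\<close> fails for at most
  a quarter of them.\<close>

lemma key_code_exists_aux:
  assumes few: "4 * card {W \<in> Pow {..<N}. card W \<le> 2 * t} \<le> 2 ^ h"
    and few': "2 ^ (h + l) * (4 * card {W \<in> Pow {..<N}. card W \<le> t}) \<le> 2 ^ N"
  shows "\<exists>\<rho>. key_code N h l t \<rho>"
proof -
  define \<Omega> where "\<Omega> = {..<h + l} \<rightarrow>\<^sub>E Pow {..<N}"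
  define T :: nat where "T = 2 ^ (N * (h + l))"
  define Es where "Es = {W \<in> Pow {..<N}. card W \<le> 2 * t}"
  define Ws where "Ws = {W \<in> Pow {..<N}. card W \<le> t}"
  define A1 where "A1 E = {\<rho> \<in> \<Omega>. \<forall>i<h. even (card (\<rho> i \<inter> E))}" for E
  define A2 where "A2 = (\<lambda>(V, W). {\<rho> \<in> \<Omega>. row_sum N \<rho> V = W})"
  define Vs where "Vs = Pow {..<h + l} - {{}}"
  have card\<Omega>: "card \<Omega> = T"
    by (simp add: \<Omega>_def T_def card_PiE card_Pow power_mult)
  have fin: "finite \<Omega>" "finite Es" "finite Ws" "finite Vs"
    by (auto simp: \<Omega>_def Es_def Ws_def Vs_def intro: finite_PiE)
  have b1: "4 * card (\<Union>E\<in>Es - {{}}. A1 E) \<le> T"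
  proof -
    have "2 ^ h * card (\<Union>E\<in>Es - {{}}. A1 E) \<le> 2 ^ h * (\<Sum>E\<in>Es - {{}}. card (A1 E))"
      using fin by (intro mult_left_mono card_UN_le) auto
    also have "\<dots> = (\<Sum>E\<in>Es - {{}}. 2 ^ h * card (A1 E))"
      by (rule sum_distrib_left)
    also have "\<dots> = (\<Sum>E\<in>Es - {{}}. T)"
      unfolding A1_def \<Omega>_def T_def
      by (intro sum.cong refl card_rows_orthogonal) (auto simp: Es_def)
    also have "\<dots> = card (Es - {{}}) * T" by simp
    also have "\<dots> \<le> card Es * T"
      using fin by (intro mult_right_mono card_mono) auto
    finally have "4 * (2 ^ h * card (\<Union>E\<in>Es - {{}}. A1 E)) \<le> 4 * (card Es * T)"
      by (rule mult_left_mono) simp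
    also have "\<dots> \<le> 2 ^ h * T"
      using mult_right_mono[OF few, of T] by (simp add: Es_def mult.assoc)
    finally have "2 ^ h * (4 * card (\<Union>E\<in>Es - {{}}. A1 E)) \<le> 2 ^ h * T"
      by (simp add: mult.left_commute)
    then show ?thesis by (simp only: mult_le_cancel1) simp
  qed
  have b2: "4 * card (\<Union>x\<in>Vs \<times> Ws. A2 x) \<le> T"
  proof -
    have "card (\<Union>x\<in>Vs \<times> Ws. A2 x) * 2 ^ N \<le> (\<Sum>x\<in>Vs \<times> Ws. card (A2 x)) * 2 ^ N"
      using fin by (intro mult_right_mono card_UN_le) auto
    also have "\<dots> = (\<Sum>x\<in>Vs \<times> Ws. card (A2 x) * 2 ^ N)"
      by (rule sum_distrib_right)
    also have "\<dots> \<le> (\<Sum>x\<in>Vs \<times> Ws. T)"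
    proof (rule sum_mono)
      fix x assume "x \<in> Vs \<times> Ws"
      then obtain V W where x: "x = (V, W)" "V \<subseteq> {..<h + l}" "V \<noteq> {}"
        by (auto simp: Vs_def)
      show "card (A2 x) * 2 ^ N \<le> T"
        unfolding x(1) A2_def T_def \<Omega>_def prod.case
        by (rule card_rows_combination) (use x in auto)
    qed
    also have "\<dots> = card Vs * card Ws * T"
      by (simp add: card_cartesian_product)
    also have "\<dots> \<le> 2 ^ (h + l) * card Ws * T"
      using card_mono[of "Pow {..<h + l}" Vs] by (intro mult_right_mono) (auto simp: Vs_def card_Pow)
    finally have "4 * (card (\<Union>x\<in>Vs \<times> Ws. A2 x) * 2 ^ N) \<le> 4 * (2 ^ (h + l) * card Ws * T)"
      by (rule mult_left_mono) simp
    also have "\<dots> \<le> 2 ^ N * T"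
      using mult_right_mono[OF few', of T] by (simp add: Ws_def mult_ac)
    finally have "2 ^ N * (4 * card (\<Union>x\<in>Vs \<times> Ws. A2 x)) \<le> 2 ^ N * T"
      by (simp add: mult_ac)
    then show ?thesis by (simp only: mult_le_cancel1) simp
  qed
  let ?B = "(\<Union>E\<in>Es - {{}}. A1 E) \<union> (\<Union>x\<in>Vs \<times> Ws. A2 x)"
  have sub: "?B \<subseteq> \<Omega>" by (auto simp: A1_def A2_def)
  have "card ?B \<le> card (\<Union>E\<in>Es - {{}}. A1 E) + card (\<Union>x\<in>Vs \<times> Ws. A2 x)"
    by (rule card_Un_le)
  moreover have "T > 0" by (simp add: T_def)
  ultimately have "card ?B < card \<Omega>"
    using b1 b2 unfolding card\<Omega> by linarith
  then have "?B \<noteq> \<Omega>" by auto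
  with sub obtain \<rho> where \<rho>: "\<rho> \<in> \<Omega>" "\<rho> \<notin> ?B" by blast
  have "key_code N h l t \<rho>"
    unfolding key_code_def
  proof (intro conjI allI impI)
    fix E assume E: "E \<subseteq> {..<N}" "E \<noteq> {}" "card E \<le> 2 * t"
    then have "E \<in> Es - {{}}" by (auto simp: Es_def)
    then have "\<rho> \<notin> A1 E" using \<rho> by blast
    then show "\<exists>i<h. odd (card (\<rho> i \<inter> E))" using \<rho> by (auto simp: A1_def)
  next
    fix V assume V: "V \<subseteq> {..<h + l}" "V \<noteq> {}"
    show "t < card (row_sum N \<rho> V)"
    proof (rule ccontr)
      assume "\<not> t < card (row_sum N \<rho> V)"
      then have "(V, row_sum N \<rho> V) \<in> Vs \<times> Ws"
        using V by (auto simp: Vs_def Ws_def row_sum_def)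
      then have "\<rho> \<notin> A2 (V, row_sum N \<rho> V)" using \<rho> by blast
      then show False using \<rho> by (simp add: A2_def)
    qed
  qed
  then show ?thesis by (rule exI[where x = \<rho>])
qed

lemma key_code_exists: "\<exists>\<rho>. key_code N (N div 4) (N div 4) (N div 1000) \<rho>"
proof -
  define h where "h = N div 4"
  define t where "t = N div 1000"
  show ?thesis
  proof (cases "N < 1000")
    \<comment> \<open>Here \<open>t = 0\<close>: no nonempty \<open>E\<close> has to be detected,
      and independence of the rows is enough, which singletons provide.\<close>
    case True
    then have t0: "t = 0" by (simp add: t_def)
    have "row_sum N (\<lambda>i. {i}) V = V" if "V \<subseteq> {..<h + h}" for V
    proof -
      have "{i \<in> V. j = i} = (if j \<in> V then {j} else {})" for j by auto
      then show ?thesis using that by (auto simp: row_sum_def h_def)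
    qed
    moreover have "finite V" if "V \<subseteq> {..<M}" for V and M :: nat
      using that by (rule finite_subset) simp
    ultimately have "key_code N h h t (\<lambda>i. {i})"
      by (auto simp: key_code_def t0 card_gt_0_iff)
    then show ?thesis unfolding h_def t_def by (rule exI[where x = "\<lambda>i. {i}"])
  next
    case False
    have small: "real (card {W \<in> Pow {..<N}. card W \<le> s}) \<le> 2 powr (N / 16)" if "s \<le> 2 * t" for s
    proof -
      \<comment> \<open>With \<open>z = 1/32\<close> the two factors are easy powers of two:
        \<open>(33/32) ^ 20 \<le> 2\<close> gives \<open>2 powr (N / 20)\<close>, and
        \<open>s \<le> N / 500\<close> turns \<open>32 ^ s\<close> into at most
        \<open>2 powr (N / 100)\<close>. The sum of exponents is below \<open>N / 16\<close>, far
        from the \<open>N / 4\<close> available.\<close>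
      have "real (card {W \<in> Pow {..<N}. card W \<le> s}) \<le> (1 + 1 / 32) ^ N / (1 / 32) ^ s"
        by (rule card_small_subsets_le) auto
      also have "\<dots> = (33 / 32) ^ N * 32 ^ s"
        by (simp add: field_simps)
      also have "\<dots> \<le> 2 powr (N / 20) * 2 powr (N / 100)"
      proof (intro mult_mono)
        have e20: "(33 / 32 :: real) powr 20 \<le> 2"
          by (simp add: power_divide)
        have "(33 / 32 :: real) ^ N = (33 / 32) powr (20 * (N / 20))"
          by (simp add: powr_realpow)
        also have "\<dots> = ((33 / 32) powr 20) powr (N / 20)"
          by (simp only: powr_powr)
        also have "\<dots> \<le> 2 powr (N / 20)"
          using e20 by (intro powr_mono2) auto
        finally show "(33 / 32 :: real) ^ N \<le> 2 powr (N / 20)" .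
        have "500 * s \<le> N" using that by (simp add: t_def)
        then have "5 * real s \<le> N / 100" by linarith
        have "(32 :: real) ^ s = (2 ^ 5) ^ s" by simp
        also have "\<dots> = 2 ^ (5 * s)" by (rule power_mult[symmetric])
        also have "\<dots> = 2 powr (5 * real s)" by (simp add: powr_realpow[symmetric])
        also have "\<dots> \<le> 2 powr (N / 100)"
          using \<open>5 * real s \<le> N / 100\<close> by (intro powr_mono) auto
        finally show "(32 :: real) ^ s \<le> 2 powr (N / 100)" .
      qed auto
      also have "\<dots> = 2 powr (N / 20 + N / 100)" by (rule powr_add[symmetric])
      also have "\<dots> \<le> 2 powr (N / 16)" by (intro powr_mono) auto
      finally show ?thesis .
    qed
    have h: "real h \<ge> N / 4 - 1" "real h \<le> N / 4" unfolding h_def by linarith+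
    have "real (4 * card {W \<in> Pow {..<N}. card W \<le> 2 * t}) \<le> 2 powr 2 * 2 powr (N / 16)"
      using small[of "2 * t"] by simp
    also have "\<dots> = 2 powr (2 + N / 16)" by (rule powr_add[symmetric])
    also have "\<dots> \<le> 2 powr h" using h False by (intro powr_mono) auto
    also have "\<dots> = real (2 ^ h)" by (simp add: powr_realpow)
    finally have 1: "4 * card {W \<in> Pow {..<N}. card W \<le> 2 * t} \<le> 2 ^ h"
      by (simp only: of_nat_le_iff)
    have "real (2 ^ (h + h) * (4 * card {W \<in> Pow {..<N}. card W \<le> t})) \<le>
        2 powr (2 * real h) * (2 powr 2 * 2 powr (N / 16))"
      using small[of t] by (auto simp: powr_realpow[symmetric] intro!: mult_mono)
    also have "\<dots> = 2 powr (2 * real h + (2 + N / 16))" by (simp only: powr_add)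
    also have "\<dots> \<le> 2 powr N" using h False by (intro powr_mono) auto
    also have "\<dots> = real (2 ^ N)" by (simp add: powr_realpow)
    finally have 2: "2 ^ (h + h) * (4 * card {W \<in> Pow {..<N}. card W \<le> t}) \<le> 2 ^ N"
      by (simp only: of_nat_le_iff)
    show ?thesis using key_code_exists_aux[OF 1 2] by (simp add: h_def t_def)
  qed
qed

section \<open>Independent repetitions\<close>

lemma map_replicate_pmf: "map_pmf (map f) (replicate_pmf n p) = replicate_pmf n (map_pmf f p)"
proof (induction n)
  case (Suc n)
  have "map_pmf (map f) (replicate_pmf (Suc n) p) =
      p \<bind> (\<lambda>x. map_pmf (map f) (replicate_pmf n p) \<bind> (\<lambda>xs. return_pmf (f x # xs)))"
    by (simp add: map_bind_pmf bind_map_pmf)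
  then show ?case by (simp add: Suc.IH bind_map_pmf)
qed simp

lemma pair_replicate_pmf:
  "pair_pmf (replicate_pmf n p) (replicate_pmf n q) =
    map_pmf (\<lambda>l. (map fst l, map snd l)) (replicate_pmf n (pair_pmf p q))"
proof (induction n)
  case 0
  then show ?case by (simp add: pair_pmf_def bind_return_pmf)
next
  case (Suc n)
  have "pair_pmf (replicate_pmf (Suc n) p) (replicate_pmf (Suc n) q) =
      p \<bind> (\<lambda>x. replicate_pmf n p \<bind> (\<lambda>xs. q \<bind> (\<lambda>y. replicate_pmf n q \<bind> (\<lambda>ys.
        return_pmf (x # xs, y # ys)))))"
    by (simp add: pair_pmf_def bind_assoc_pmf bind_return_pmf)
  also have "\<dots> = p \<bind> (\<lambda>x. q \<bind> (\<lambda>y. replicate_pmf n p \<bind> (\<lambda>xs. replicate_pmf n q \<bind> (\<lambda>ys.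
        return_pmf (x # xs, y # ys)))))"
    by (subst bind_commute_pmf) (rule refl)
  also have "\<dots> = pair_pmf p q \<bind> (\<lambda>(x, y). pair_pmf (replicate_pmf n p) (replicate_pmf n q) \<bind>
        (\<lambda>(xs, ys). return_pmf (x # xs, y # ys)))"
    by (simp add: pair_pmf_def bind_assoc_pmf bind_return_pmf)
  also have "\<dots> = map_pmf (\<lambda>l. (map fst l, map snd l)) (replicate_pmf (Suc n) (pair_pmf p q))"
    by (simp add: Suc.IH map_bind_pmf bind_map_pmf case_prod_unfold)
  finally show ?case .
qed

lemma finite_set_replicate_pmf:
  assumes "finite (set_pmf p)"
  shows "finite (set_pmf (replicate_pmf n p))"
proof -
  have "set_pmf (replicate_pmf n p) = {xs. set xs \<subseteq> set_pmf p \<and> length xs = n}"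
    by (auto simp: set_replicate_pmf)
  then show ?thesis using assms by (simp only: finite_lists_length_eq)
qed

lemma length_replicate_pmf: "w \<in> set_pmf (replicate_pmf n p) \<Longrightarrow> length w = n"
  by (simp add: set_replicate_pmf)


section \<open>The formation cost\<close>

lemma formation_cost_eq_0I:
  assumes "formation_achievable P 0"
  shows "formation_cost P = 0"
proof -
  have "formation_cost P \<le> 0"
    unfolding formation_cost_def using assms
    by (intro Inf_lower) (auto simp: zero_ereal_def)
  moreover have "0 \<le> formation_cost P"
    unfolding formation_cost_def by (intro Inf_greatest) auto
  ultimately show ?thesis by (rule antisym)
qed

lemma total_variation_refl: "total_variation p p = 0"
  by (simp add: total_variation_def)

text \<open>
  Given the degraded variable, \<open>X\<close> and \<open>Y\<close> are either determined or independent and uniform, so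
  Alice can publish it and both parties complete their samples locally.
\<close>

locale uniform_degradation =
  fixes P :: "('x::finite \<times> 'y::finite \<times> 'z::finite) pmf"
    and ch :: "'z \<Rightarrow> ('x \<times> 'y) option pmf"
  fixes J :: "('x \<times> 'y \<times> ('x \<times> 'y) option) pmf"
  defines "J \<equiv> P \<bind> (\<lambda>(x, y, z). map_pmf (\<lambda>c. (x, y, c)) (ch z))"
  assumes None_const: "\<And>x y x' y'. pmf J (x, y, None) = pmf J (x', y', None)"
    and Some_det: "\<And>x y a b. (x, y, Some (a, b)) \<in> set_pmf J \<Longrightarrow> x = a \<and> y = b"
begin

definition "cl = map_pmf (\<lambda>(x, y, c). c) J"

fun completion :: "(('x \<times> 'y) option \<times> 'x) \<times> 'y \<Rightarrow> 'x \<times> 'y \<times> ('x \<times> 'y) option" where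
  "completion ((c, x), y) = (case c of None \<Rightarrow> x | Some (a, b) \<Rightarrow> a,
                             case c of None \<Rightarrow> y | Some (a, b) \<Rightarrow> b, c)"

text \<open>The two uniform letters are always drawn and simply ignored when \<open>c\<close>
  determines the pair. This presents \<open>J\<close> as the image of a product law whose factors
  can be split between Alice and Bob.\<close>

lemma J_eq: "J = map_pmf completion (pair_pmf (pair_pmf cl (pmf_of_set UNIV)) (pmf_of_set UNIV))"
proof (rule pmf_eqI)
  fix q :: "'x \<times> 'y \<times> ('x \<times> 'y) option"
  obtain x y c where q: "q = (x, y, c)" by (cases q)
  let ?R = "pair_pmf (pair_pmf cl (pmf_of_set (UNIV :: 'x set))) (pmf_of_set (UNIV :: 'y set))"
  have cx: "real CARD('x) \<noteq> 0" and cy: "real CARD('y) \<noteq> 0" by auto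
  have cl: "pmf cl c = (\<Sum>(x, y)\<in>UNIV. pmf J (x, y, c))" for c
  proof -
    have "pmf cl c = measure_pmf.prob J ((\<lambda>(x, y). (x, y, c)) ` UNIV)"
      by (auto simp: cl_def pmf_map vimage_def image_def intro!: arg_cong[where f="measure_pmf.prob J"])
    also have "\<dots> = (\<Sum>(x, y)\<in>UNIV. pmf J (x, y, c))"
      by (subst measure_measure_pmf_finite)
         (auto simp: sum.reindex inj_on_def case_prod_unfold)
    finally show ?thesis .
  qed
  show "pmf J q = pmf (map_pmf completion ?R) q"
  proof (cases c)
    case None
    have "completion -` {q} = {((None, x), y)}"
      by (auto simp: q None split: option.splits)
    then have "pmf (map_pmf completion ?R) q = pmf cl None / (CARD('x) * CARD('y))"
      by (simp add: pmf_map measure_pmf_single pmf_pair)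
    also have "pmf cl None = (\<Sum>(x' :: 'x, y' :: 'y)\<in>UNIV. pmf J (x, y, None))"
      unfolding cl by (intro sum.cong) (auto intro: None_const)
    also have "\<dots> / (CARD('x) * CARD('y)) = pmf J q"
      using cx cy by (simp add: case_prod_unfold q None UNIV_Times_UNIV[symmetric]
        card_cartesian_product del: UNIV_Times_UNIV)
    finally show ?thesis by simp
  next
    case (Some d)
    obtain a b where d: "d = (a, b)" by force
    have zero: "pmf J (x', y', Some (a, b)) = 0" if "(x', y') \<noteq> (a, b)" for x' y'
      using Some_det[of x' y' a b] that by (auto simp: set_pmf_iff)
    have "pmf cl (Some (a, b)) = (\<Sum>(x, y)\<in>{(a, b)}. pmf J (x, y, Some (a, b)))"
      unfolding cl
    proof (intro sum.mono_neutral_right ballI)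
      fix i :: "'x \<times> 'y" assume "i \<in> UNIV - {(a, b)}"
      then show "(case i of (x, y) \<Rightarrow> pmf J (x, y, Some (a, b))) = 0"
        using zero[of "fst i" "snd i"] by (simp add: case_prod_unfold prod_eq_iff)
    qed auto
    then have clS: "pmf cl (Some (a, b)) = pmf J (a, b, Some (a, b))" by simp
    show ?thesis
    proof (cases "(x, y) = (a, b)")
      case True
      then have "completion -` {q} = ({Some (a, b)} \<times> UNIV) \<times> UNIV"
        by (auto simp: q Some d split: option.splits)
      then have "pmf (map_pmf completion ?R) q = pmf cl (Some (a, b))"
        by (simp add: pmf_map measure_pmf_prob_product measure_pmf_single)
      then show ?thesis using True clS by (simp add: q Some d)
    next
      case False
      then have "completion -` {q} = {}"
        by (auto simp: q Some d split: option.splits)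
      then show ?thesis using zero False by (simp add: q Some d pmf_map)
    qed
  qed
qed

section \<open>The letterwise channel and the protocol that forms the samples\<close>

primrec chs :: "'z list \<Rightarrow> ('x \<times> 'y) option list pmf" where
  "chs [] = return_pmf []"
| "chs (z # zs) = ch z \<bind> (\<lambda>c. map_pmf ((#) c) (chs zs))"

lemma finite_chs: "finite (set_pmf (chs zs))"
  by (induction zs) auto

lemma replicate_J:
  "replicate_pmf n P \<bind> (\<lambda>w. map_pmf (\<lambda>cs. (Xs w, Ys w, cs)) (chs (Zs w))) =
    map_pmf (\<lambda>l. (Xs l, Ys l, Zs l)) (replicate_pmf n J)"
proof (induction n)
  case 0
  then show ?case by (simp add: bind_return_pmf)
next
  case (Suc n)
  have "replicate_pmf (Suc n) P \<bind> (\<lambda>w. map_pmf (\<lambda>cs. (Xs w, Ys w, cs)) (chs (Zs w))) =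
      P \<bind> (\<lambda>(x, y, z). replicate_pmf n P \<bind> (\<lambda>w. ch z \<bind> (\<lambda>c. chs (Zs w) \<bind> (\<lambda>cs.
        return_pmf (x # Xs w, y # Ys w, c # cs)))))"
    by (simp add: bind_assoc_pmf bind_return_pmf map_bind_pmf map_pmf_def case_prod_unfold)
  also have "\<dots> = P \<bind> (\<lambda>(x, y, z). ch z \<bind> (\<lambda>c. replicate_pmf n P \<bind> (\<lambda>w. chs (Zs w) \<bind> (\<lambda>cs.
        return_pmf (x # Xs w, y # Ys w, c # cs)))))"
    by (subst bind_commute_pmf) (rule refl)
  also have "\<dots> = J \<bind> (\<lambda>(x, y, c). replicate_pmf n P \<bind>
        (\<lambda>w. map_pmf (\<lambda>cs. (Xs w, Ys w, cs)) (chs (Zs w))) \<bind>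
        (\<lambda>(xs, ys, cs). return_pmf (x # xs, y # ys, c # cs)))"
    by (simp add: J_def bind_assoc_pmf bind_return_pmf map_pmf_def case_prod_unfold)
  also have "\<dots> = map_pmf (\<lambda>l. (Xs l, Ys l, Zs l)) (replicate_pmf (Suc n) J)"
    unfolding Suc.IH
    by (simp add: map_pmf_def bind_assoc_pmf bind_return_pmf case_prod_unfold)
  finally show ?case .
qed

text \<open>Alice samples the degraded values from their marginal \<open>cl\<close>, with no access
  to \<open>Z\<close>, and sends only them; her letters for the erased positions stay private.
  Randomness and messages are lists coded as numbers.\<close>

definition forming_protocol :: "nat \<Rightarrow> (bool list, bool list, 'x list, 'y list) protocol" where
  "forming_protocol n = \<lparr>
     alice_rand = map_pmf to_nat (replicate_pmf n (pair_pmf cl (pmf_of_set (UNIV :: 'x set)))),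
     bob_rand = map_pmf to_nat (replicate_pmf n (pmf_of_set (UNIV :: 'y set))),
     speakers = [Alice],
     alice_msg = (\<lambda>_ r _. to_nat (map fst (from_nat r :: (('x \<times> 'y) option \<times> 'x) list))),
     bob_msg = (\<lambda>_ _ _. 0),
     alice_out = (\<lambda>_ r _. map (\<lambda>(c, x). case c of None \<Rightarrow> x | Some (a, b) \<Rightarrow> a)
       (from_nat r :: (('x \<times> 'y) option \<times> 'x) list)),
     bob_out = (\<lambda>_ s F. map2 (\<lambda>c y. case c of None \<Rightarrow> y | Some (a, b) \<Rightarrow> b)
       (from_nat (hd F) :: ('x \<times> 'y) option list) (from_nat s))\<rparr>"

text \<open>The simulation is exact: both sides are images of \<open>n\<close> independent copies of
  \<open>J\<close>, once generated from \<open>cl\<close> and once from the source through the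
  channel.\<close>

lemma formation_law_forming_protocol:
  "formation_law 0 (forming_protocol n) = simulated_law P n (\<lambda>zs. map_pmf (\<lambda>cs. [to_nat cs]) (chs zs))"
proof -
  let ?R = "replicate_pmf n (pair_pmf (pair_pmf cl (pmf_of_set (UNIV :: 'x set))) (pmf_of_set (UNIV :: 'y set)))"
  have "{k :: bool list. length k = 0} = {[]}" by auto
  then have "formation_law 0 (forming_protocol n) = run_protocol (forming_protocol n) [] []"
    unfolding formation_law_def by (simp only: pmf_of_set_singleton bind_return_pmf)
  also have "\<dots> = map_pmf (\<lambda>(rs, ss). (map (\<lambda>(c, x). case c of None \<Rightarrow> x | Some (a, b) \<Rightarrow> a) rs,
        map2 (\<lambda>c y. case c of None \<Rightarrow> y | Some (a, b) \<Rightarrow> b) (map fst rs) ss, [to_nat (map fst rs)]))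
      (pair_pmf (replicate_pmf n (pair_pmf cl (pmf_of_set UNIV))) (replicate_pmf n (pmf_of_set UNIV)))"
    unfolding run_protocol_def forming_protocol_def transcript_def next_message_def Let_def
      protocol.simps map_pair[symmetric] pmf.map_comp
    by (rule map_pmf_cong) (auto simp: split_beta)
  also have "\<dots> = map_pmf (\<lambda>l. (Xs (map completion l), Ys (map completion l),
      [to_nat (Zs (map completion l))])) ?R"
  proof -
    have "map (\<lambda>(c, x). case c of None \<Rightarrow> x | Some (a, b) \<Rightarrow> a) (map fst l) = Xs (map completion l)"
      "map2 (\<lambda>c y. case c of None \<Rightarrow> y | Some (a, b) \<Rightarrow> b) (map fst (map fst l)) (map snd l) =
        Ys (map completion l)"
      "map fst (map fst l) = Zs (map completion l)" for l
      by (induction l) (auto split: option.splits)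
    then show ?thesis
      unfolding pair_replicate_pmf pmf.map_comp by (simp only: comp_def prod.case)
  qed
  also have "\<dots> = map_pmf (\<lambda>(xs, ys, cs). (xs, ys, [to_nat cs]))
      (map_pmf (\<lambda>l. (Xs l, Ys l, Zs l)) (map_pmf (map completion) ?R))"
    by (simp add: pmf.map_comp comp_def)
  also have "map_pmf (map completion) ?R = replicate_pmf n J"
    by (simp add: map_replicate_pmf J_eq)
  also have "map_pmf (\<lambda>(xs, ys, cs). (xs, ys, [to_nat cs]))
      (map_pmf (\<lambda>l. (Xs l, Ys l, Zs l)) (replicate_pmf n J)) =
      simulated_law P n (\<lambda>zs. map_pmf (\<lambda>cs. [to_nat cs]) (chs zs))"
    unfolding replicate_J[symmetric]
    by (simp add: simulated_law_def map_bind_pmf bind_map_pmf map_pmf_def bind_assoc_pmf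
        bind_return_pmf)
  finally show ?thesis .
qed

lemma formation_cost_eq_0: "formation_cost P = 0"
proof (rule formation_cost_eq_0I, unfold formation_achievable_def, intro allI impI always_eventually)
  fix \<epsilon> :: real and N :: nat assume "\<epsilon> > 0"
  let ?W = "\<lambda>zs. map_pmf (\<lambda>cs. [to_nat cs]) (chs zs)"
  have "finite_randomness (forming_protocol N)"
    by (simp add: finite_randomness_def forming_protocol_def finite_set_replicate_pmf)
  moreover have "\<forall>(xs, ys, C) \<in> set_pmf (simulated_law P N ?W). length xs = N \<and> length ys = N"
    by (auto simp: simulated_law_def dest: length_replicate_pmf)
  ultimately show "\<exists>p W. finite_randomness p \<and> (\<forall>zs. finite (set_pmf (W zs))) \<and>
      (\<forall>(xs, ys, C) \<in> set_pmf (formation_law (nat \<lfloor>0 * real N\<rfloor>) p). length xs = N \<and> length ys = N) \<and>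
      total_variation (formation_law (nat \<lfloor>0 * real N\<rfloor>) p) (simulated_law P N W) \<le> \<epsilon>"
    using \<open>\<epsilon> > 0\<close>
    by (intro exI[of _ "forming_protocol N"] exI[of _ ?W])
       (simp add: finite_chs formation_law_forming_protocol total_variation_refl)
qed

end

section \<open>From bits hidden with high probability to a secret key\<close>

subsection \<open>Cutting lists into blocks\<close>

primrec chunk :: "nat \<Rightarrow> nat \<Rightarrow> 'a list \<Rightarrow> 'a list list" where
  "chunk L 0 xs = []"
| "chunk L (Suc n) xs = take L xs # chunk L n (drop L xs)"

lemma length_chunk [simp]: "length (chunk L n xs) = n"
  by (induction n arbitrary: xs) auto

lemma chunk_map: "chunk L n (map f xs) = map (map f) (chunk L n xs)"
  by (induction n arbitrary: xs) (auto simp: take_map drop_map)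

lemma concat_chunk: "concat (chunk L n xs) @ drop (n * L) xs = xs"
proof (induction n arbitrary: xs)
  case (Suc n)
  have "drop (Suc n * L) xs = drop (n * L) (drop L xs)" by (simp add: add.commute)
  then show ?case using Suc[of "drop L xs"] by simp
qed simp

lemma nth_chunk: "i < n \<Longrightarrow> chunk L n xs ! i = take L (drop (i * L) xs)"
proof (induction n arbitrary: xs i)
  case (Suc n)
  then show ?case by (cases i) (auto simp: add.commute)
qed simp

text \<open>The incomplete last block is kept as a second component because Eve observes its
  \<open>Z\<close> part as well; independence makes that harmless.\<close>

lemma chunk_replicate_pmf:
  "map_pmf (\<lambda>w. (chunk L n w, drop (n * L) w)) (replicate_pmf (n * L + e) p) =
    pair_pmf (replicate_pmf n (replicate_pmf L p)) (replicate_pmf e p)"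
proof (induction n)
  case 0
  then show ?case by (simp add: pair_return_pmf1)
next
  case (Suc n)
  let ?f = "\<lambda>w. (chunk L n w, drop (n * L) w)"
  have "map_pmf (\<lambda>w. (chunk L (Suc n) w, drop (Suc n * L) w)) (replicate_pmf (Suc n * L + e) p) =
      replicate_pmf L p \<bind> (\<lambda>xs. replicate_pmf (n * L + e) p \<bind> (\<lambda>ys.
        return_pmf (chunk L (Suc n) (xs @ ys), drop (Suc n * L) (xs @ ys))))"
    by (simp add: replicate_pmf_distrib[of L "n * L + e", unfolded add.assoc[symmetric]]
        map_bind_pmf del: chunk.simps)
  also have "\<dots> = replicate_pmf L p \<bind> (\<lambda>xs. map_pmf ?f (replicate_pmf (n * L + e) p) \<bind> (\<lambda>(bs, ex).
        return_pmf (xs # bs, ex)))"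
    by (intro bind_pmf_cong refl)
       (auto simp: map_pmf_def bind_assoc_pmf bind_return_pmf dest!: length_replicate_pmf
          intro!: bind_pmf_cong)
  also have "\<dots> = pair_pmf (replicate_pmf (Suc n) (replicate_pmf L p)) (replicate_pmf e p)"
    unfolding Suc.IH
    by (simp add: pair_pmf_def bind_assoc_pmf bind_return_pmf)
  finally show ?case .
qed

lemma chunk_replicate_pmf_exact:
  "map_pmf (chunk L n) (replicate_pmf (n * L) p) = replicate_pmf n (replicate_pmf L p)"
proof -
  have "map_pmf fst (map_pmf (\<lambda>w. (chunk L n w, drop (n * L) w)) (replicate_pmf (n * L + 0) p)) =
      replicate_pmf n (replicate_pmf L p)"
    unfolding chunk_replicate_pmf by (rule map_fst_pair_pmf)
  then show ?thesis by (simp add: pmf.map_comp comp_def)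
qed

lemma prob_pair_pmf_Times:
  "measure_pmf.prob (pair_pmf p q) (A \<times> B) = measure_pmf.prob p A * measure_pmf.prob q B"
proof -
  have "A \<times> B \<inter> set_pmf (pair_pmf p q) = (A \<inter> set_pmf p) \<times> (B \<inter> set_pmf q)" by auto
  then have "measure_pmf.prob (pair_pmf p q) (A \<times> B) =
      measure_pmf.prob (pair_pmf p q) ((A \<inter> set_pmf p) \<times> (B \<inter> set_pmf q))"
    by (metis measure_Int_set_pmf)
  also have "\<dots> = measure_pmf.prob p (A \<inter> set_pmf p) * measure_pmf.prob q (B \<inter> set_pmf q)"
    by (intro measure_pmf_prob_product countable_Int2 countable_set_pmf)
  finally show ?thesis by (simp only: measure_Int_set_pmf)
qed

lemma prob_replicate_pmf_nth:
  "measure_pmf.prob (replicate_pmf n p) {xs. \<forall>i<n. xs ! i \<in> S i} = (\<Prod>i<n. measure_pmf.prob p (S i))"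
proof (induction n arbitrary: S)
  case (Suc n)
  have "replicate_pmf (Suc n) p = map_pmf (\<lambda>(x, xs). x # xs) (pair_pmf p (replicate_pmf n p))"
    by (simp add: pair_pmf_def map_bind_pmf map_pmf_def bind_assoc_pmf bind_return_pmf)
  moreover have "(\<lambda>(x, xs). x # xs) -` {xs. \<forall>i<Suc n. xs ! i \<in> S i} =
      S 0 \<times> {xs. \<forall>i<n. xs ! i \<in> S (Suc i)}"
    by (auto simp: All_less_Suc2)
  ultimately have "measure_pmf.prob (replicate_pmf (Suc n) p) {xs. \<forall>i<Suc n. xs ! i \<in> S i} =
      measure_pmf.prob p (S 0) * measure_pmf.prob (replicate_pmf n p) {xs. \<forall>i<n. xs ! i \<in> S (Suc i)}"
    by (simp add: prob_pair_pmf_Times)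
  then show ?case by (simp only: Suc.IH prod.lessThan_Suc_shift)
qed simp

lemma pmf_replicate_pmf_nth:
  assumes "length xs = n"
  shows "pmf (replicate_pmf n p) xs = (\<Prod>i<n. pmf p (xs ! i))"
proof -
  have "pmf (replicate_pmf n p) xs = measure_pmf.prob (replicate_pmf n p) {ys. \<forall>i<n. ys ! i \<in> {xs ! i}}"
    unfolding measure_pmf_single[symmetric]
    using assms
    by (intro measure_pmf.finite_measure_eq_AE)
       (auto simp: AE_measure_pmf_iff list_eq_iff_nth_eq dest: length_replicate_pmf)
  then show ?thesis by (simp only: prob_replicate_pmf_nth measure_pmf_single)
qed

subsection \<open>Balancedness and decoding for a good code\<close>

text \<open>By the dual distance no nonzero combination of rows is supported in \<open>T\<close>, so
  the rows stay independent on the complement. Every pattern \<open>D\<close> on \<open>T\<close>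
  then has equally many completions with syndrome \<open>B\<close>, and the right-hand side is free
  of \<open>B\<close>.\<close>

lemma sum_syndrome_fiber_indep:
  fixes W :: "nat set \<Rightarrow> real"
  assumes code: "key_code N h l t \<rho>" and T: "T \<subseteq> {..<N}" "card T \<le> t"
    and W: "\<And>A. A \<subseteq> {..<N} \<Longrightarrow> W A = W (A \<inter> T)"
    and B: "B \<subseteq> {..<h + l}"
  shows "(\<Sum>A | A \<subseteq> {..<N} \<and> syndrome (h + l) \<rho> A = B. W A) =
    (\<Sum>D\<in>Pow T. W D) * 2 ^ card ({..<N} - T) / 2 ^ (h + l)"
proof -
  let ?U = "{..<N} - T"
  have finT: "finite T" using T by (auto intro: finite_subset)
  have indep: "row_sum N \<rho> V \<inter> ?U \<noteq> {}" if "V \<subseteq> {..<h + l}" "V \<noteq> {}" for V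
  proof
    assume "row_sum N \<rho> V \<inter> ?U = {}"
    then have "row_sum N \<rho> V \<subseteq> T" by (auto simp: row_sum_def)
    then have "card (row_sum N \<rho> V) \<le> t" using T finT by (meson card_mono order_trans)
    then show False using code that unfolding key_code_def by (meson not_le)
  qed
  have fiber: "real (card {C \<in> Pow ?U. syndrome (h + l) \<rho> (C \<union> D) = B}) = 2 ^ card ?U / 2 ^ (h + l)"
    if "D \<subseteq> T" for D
  proof -
    have "2 ^ (h + l) * card {C \<in> Pow ?U. syndrome (h + l) \<rho> (C \<union> D) = B} = 2 ^ card ?U"
    proof (rule card_syndrome_fiber[OF _ _ B indep])
      show "?U \<subseteq> {..<N}" and "D \<subseteq> {..<N} - ?U" using T that by auto
    qed
    then have "real (2 ^ (h + l) * card {C \<in> Pow ?U. syndrome (h + l) \<rho> (C \<union> D) = B}) = real (2 ^ card ?U)"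
      by (rule arg_cong)
    then have "2 ^ (h + l) * real (card {C \<in> Pow ?U. syndrome (h + l) \<rho> (C \<union> D) = B}) = 2 ^ card ?U"
      by (simp only: of_nat_mult of_nat_power of_nat_numeral)
    then show ?thesis
      by (rule iffD2[OF nonzero_eq_divide_eq, OF _ trans[OF mult.commute], rotated]) simp
  qed
  have "(\<Sum>A | A \<subseteq> {..<N} \<and> syndrome (h + l) \<rho> A = B. W A) =
      (\<Sum>(D, C)\<in>Sigma (Pow T) (\<lambda>D. {C \<in> Pow ?U. syndrome (h + l) \<rho> (C \<union> D) = B}). W D)"
  proof (rule sum.reindex_bij_witness[where i = "\<lambda>(D, C). C \<union> D" and j = "\<lambda>A. (A \<inter> T, A - T)"])
    fix A assume "A \<in> {A. A \<subseteq> {..<N} \<and> syndrome (h + l) \<rho> A = B}"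
    moreover have "(A - T) \<union> (A \<inter> T) = A" by auto
    ultimately show "(A \<inter> T, A - T) \<in> Sigma (Pow T) (\<lambda>D. {C \<in> Pow ?U. syndrome (h + l) \<rho> (C \<union> D) = B})"
      and "(case (A \<inter> T, A - T) of (D, C) \<Rightarrow> C \<union> D) = A"
      and "(case (A \<inter> T, A - T) of (D, C) \<Rightarrow> W D) = W A"
      using W[of A] by auto
  qed (use T in auto)
  also have "\<dots> = (\<Sum>D\<in>Pow T. \<Sum>C\<in>{C \<in> Pow ?U. syndrome (h + l) \<rho> (C \<union> D) = B}. W D)"
    using finT by (subst sum.Sigma) auto
  also have "\<dots> = (\<Sum>D\<in>Pow T. W D * (2 ^ card ?U / 2 ^ (h + l)))"
    by (intro sum.cong refl) (simp only: sum_constant fiber PowD mult.commute)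
  also have "\<dots> = (\<Sum>D\<in>Pow T. W D) * 2 ^ card ?U / 2 ^ (h + l)"
    by (simp add: sum_distrib_right sum_divide_distrib)
  finally show ?thesis .
qed

text \<open>Two candidates within \<open>t\<close> of \<open>B\<close> differ in at most
  \<open>2 * t\<close> places, which the checks would detect.\<close>

lemma key_code_decode:
  assumes code: "key_code N h l t \<rho>" and "A \<subseteq> {..<N}" "C \<subseteq> {..<N}"
    and "syndrome h \<rho> A = syndrome h \<rho> C"
    and "card (sym_diff A B) \<le> t" "card (sym_diff C B) \<le> t" "B \<subseteq> {..<N}"
  shows "A = C"
proof (rule ccontr)
  assume "A \<noteq> C"
  have fin: "finite A" "finite B" "finite C" using assms by (auto intro: finite_subset)
  have "card (sym_diff A C) \<le> card (sym_diff A B \<union> sym_diff C B)"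
    using fin by (intro card_mono) auto
  also have "\<dots> \<le> card (sym_diff A B) + card (sym_diff C B)" by (rule card_Un_le)
  also have "\<dots> \<le> 2 * t" using assms by simp
  finally have "card (sym_diff A C) \<le> 2 * t" .
  moreover have "sym_diff A C \<noteq> {}" "sym_diff A C \<subseteq> {..<N}" using \<open>A \<noteq> C\<close> assms by auto
  ultimately obtain i where "i < h" "odd (card (\<rho> i \<inter> sym_diff A C))"
    using code unfolding key_code_def by blast
  then show False
    using syndrome_eq_imp_even[OF fin(1,3) assms(4), of i] by simp
qed

subsection \<open>The protocol\<close>

definition bit_law ::
    "('x \<times> 'y \<times> 'z) pmf \<Rightarrow> nat \<Rightarrow> ('y list \<Rightarrow> nat) \<Rightarrow> ('x list \<Rightarrow> nat \<Rightarrow> nat) \<Rightarrow>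
      ('x list \<Rightarrow> nat \<Rightarrow> bool) \<Rightarrow> ('y list \<Rightarrow> nat \<Rightarrow> bool) \<Rightarrow>
      (bool \<times> bool \<times> 'z list \<times> nat \<times> nat) pmf" where
  "bit_law P L s q a b =
     map_pmf (\<lambda>w. (a (Xs w) (s (Ys w)), b (Ys w) (q (Xs w) (s (Ys w))),
       Zs w, s (Ys w), q (Xs w) (s (Ys w)))) (replicate_pmf L P)"

text \<open>Invariance of a law under this map expresses that the bit is uniform given each good
  view, without conditional probabilities.\<close>

definition flip_bit :: "('v \<Rightarrow> bool) \<Rightarrow> bool \<times> 'v \<Rightarrow> bool \<times> 'v" where
  "flip_bit good = (\<lambda>(a, v). (if good v then \<not> a else a, v))"

text \<open>
  On a block of \<open>L\<close> copies Bob publishes \<open>s\<close>, Alice replies with \<open>q\<close>, and they derive the bits \<open>a\<close>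
  and \<open>b\<close>. When Eve's view is good the bits agree and are uniform given the view.
\<close>

locale bit_scheme =
  fixes P :: "('x::finite \<times> 'y::finite \<times> 'z::finite) pmf" and L :: nat
    and s :: "'y list \<Rightarrow> nat" and q :: "'x list \<Rightarrow> nat \<Rightarrow> nat"
    and a :: "'x list \<Rightarrow> nat \<Rightarrow> bool" and b :: "'y list \<Rightarrow> nat \<Rightarrow> bool"
    and good :: "'z list \<times> nat \<times> nat \<Rightarrow> bool"
  assumes L_pos: "L > 0"
    and agree: "\<And>ba bb v. (ba, bb, v) \<in> set_pmf (bit_law P L s q a b) \<Longrightarrow> good v \<Longrightarrow> ba = bb"
    and flip: "map_pmf (flip_bit good) (map_pmf (\<lambda>(ba, bb, v). (ba, v)) (bit_law P L s q a b)) =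
      map_pmf (\<lambda>(ba, bb, v). (ba, v)) (bit_law P L s q a b)"
    and bad: "measure_pmf.prob (bit_law P L s q a b) {(ba, bb, v). \<not> good v} \<le> (1 / 2) ^ 2000"
begin

definition code :: "nat \<Rightarrow> nat \<Rightarrow> nat set" where
  "code N = (SOME \<rho>. key_code N (N div 4) (N div 4) (N div 1000) \<rho>)"

lemma key_code_code: "key_code N (N div 4) (N div 4) (N div 1000) (code N)"
  unfolding code_def using key_code_exists by (rule someI_ex)

definition ones :: "bool list \<Rightarrow> nat set" where
  "ones bs = {i. i < length bs \<and> bs ! i}"

definition check :: "nat \<Rightarrow> nat set \<Rightarrow> nat" where
  "check N A = set_encode (syndrome (N div 4) (code N) A)"

text \<open>\<open>check\<close> and \<open>key\<close> are the lower and upper half of one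
  syndrome. The upper indices are not shifted down, which is why \<open>keys\<close> encodes subsets
  of \<open>{N div 4..<N div 4 + N div 4}\<close>.\<close>

definition key :: "nat \<Rightarrow> nat set \<Rightarrow> nat" where
  "key N A = set_encode (syndrome (N div 4 + N div 4) (code N) A - {..<N div 4})"

definition keys :: "nat \<Rightarrow> nat set" where
  "keys N = set_encode ` Pow {N div 4..<N div 4 + N div 4}"

definition decode :: "nat \<Rightarrow> nat set \<Rightarrow> nat \<Rightarrow> nat set" where
  "decode N B e = (SOME C. C \<subseteq> {..<N} \<and> check N C = e \<and> card (sym_diff C B) \<le> N div 1000)"

definition alice_bits :: "nat \<Rightarrow> 'x list \<Rightarrow> nat list \<Rightarrow> bool list" where
  "alice_bits N x ss = map2 a (chunk L N x) ss"

definition bob_bits :: "nat \<Rightarrow> 'y list \<Rightarrow> nat list \<Rightarrow> bool list" where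
  "bob_bits N y qs = map2 b (chunk L N y) qs"

text \<open>Local randomness is degenerate. Alice's single message carries both her replies for the
  blocks and the check of her bits; Bob reads it back as \<open>F ! 1\<close>.\<close>

definition key_protocol :: "nat \<Rightarrow> ('x list, 'y list, nat, nat) protocol" where
  "key_protocol N = \<lparr>
     alice_rand = return_pmf 0, bob_rand = return_pmf 0, speakers = [Bob, Alice],
     alice_msg = (\<lambda>x _ F. to_nat (map2 q (chunk L N x) (from_nat (hd F)),
       check N (ones (alice_bits N x (from_nat (hd F)))))),
     bob_msg = (\<lambda>y _ _. to_nat (map s (chunk L N y))),
     alice_out = (\<lambda>x _ F. key N (ones (alice_bits N x (from_nat (hd F))))),
     bob_out = (\<lambda>y _ F. case from_nat (F ! 1) of (qs, e) \<Rightarrow>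
       key N (decode N (ones (bob_bits N y qs)) e))\<rparr>"

section \<open>The views of the blocks and the law of the protocol\<close>

definition view :: "('x \<times> 'y \<times> 'z) list \<Rightarrow> bool \<times> bool \<times> 'z list \<times> nat \<times> nat" where
  "view w = (a (Xs w) (s (Ys w)), b (Ys w) (q (Xs w) (s (Ys w))),
     Zs w, s (Ys w), q (Xs w) (s (Ys w)))"

lemma map_view: "map_pmf view (replicate_pmf L P) = bit_law P L s q a b"
  by (simp add: bit_law_def view_def[abs_def])

definition views :: "nat \<Rightarrow> ('x \<times> 'y \<times> 'z) list \<Rightarrow> (bool \<times> bool \<times> 'z list \<times> nat \<times> nat) list" where
  "views N w = map view (chunk L N w)"

definition abits :: "nat \<Rightarrow> ('x \<times> 'y \<times> 'z) list \<Rightarrow> nat set" where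
  "abits N w = ones (map fst (views N w))"

definition bbits :: "nat \<Rightarrow> ('x \<times> 'y \<times> 'z) list \<Rightarrow> nat set" where
  "bbits N w = ones (map (fst \<circ> snd) (views N w))"

definition evs :: "nat \<Rightarrow> ('x \<times> 'y \<times> 'z) list \<Rightarrow> ('z list \<times> nat \<times> nat) list" where
  "evs N w = map (snd \<circ> snd) (views N w)"

definition transcr :: "nat \<Rightarrow> ('x \<times> 'y \<times> 'z) list \<Rightarrow> nat list" where
  "transcr N w = [to_nat (map (fst \<circ> snd) (evs N w)),
     to_nat (map (snd \<circ> snd) (evs N w), check N (abits N w))]"

lemma key_law_key_protocol:
  "key_law P n (key_protocol N) = map_pmf (\<lambda>w. (key N (abits N w),
     key N (decode N (bbits N w) (check N (abits N w))), Zs w, transcr N w)) (replicate_pmf n P)"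
proof -
  have ss: "map s (chunk L N (Ys w)) = map (fst \<circ> snd) (evs N w)" for w :: "('x \<times> 'y \<times> 'z) list"
    by (simp add: evs_def views_def view_def chunk_map comp_def)
  have qs: "map2 q (chunk L N (Xs w)) (map (fst \<circ> snd) (evs N w)) = map (snd \<circ> snd) (evs N w)"
    for w :: "('x \<times> 'y \<times> 'z) list"
    by (simp add: evs_def views_def view_def chunk_map comp_def zip_map_map zip_same_conv_map)
  have as: "alice_bits N (Xs w) (map (fst \<circ> snd) (evs N w)) = map fst (views N w)"
    for w :: "('x \<times> 'y \<times> 'z) list"
    by (simp add: alice_bits_def evs_def views_def view_def chunk_map comp_def zip_map_map
        zip_same_conv_map)
  have bs: "bob_bits N (Ys w) (map (snd \<circ> snd) (evs N w)) = map (fst \<circ> snd) (views N w)"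
    for w :: "('x \<times> 'y \<times> 'z) list"
    by (simp add: bob_bits_def evs_def views_def view_def chunk_map comp_def zip_map_map
        zip_same_conv_map)
  have "run_protocol (key_protocol N) (Xs w) (Ys w) = return_pmf (key N (abits N w),
     key N (decode N (bbits N w) (check N (abits N w))), transcr N w)"
    for w :: "('x \<times> 'y \<times> 'z) list"
    unfolding run_protocol_def
    by (simp add: key_protocol_def transcript_def next_message_def pair_return_pmf1 ss qs as bs
        abits_def bbits_def transcr_def Let_def)
  then show ?thesis
    by (simp add: key_law_def bind_return_pmf map_pmf_def)
qed

abbreviation B where "B \<equiv> bit_law P L s q a b"

lemma iid_views:
  "map_pmf (\<lambda>w. (views N w, drop (N * L) w)) (replicate_pmf (N * L + e) P) =
    pair_pmf (replicate_pmf N B) (replicate_pmf e P)"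
proof -
  have "map_pmf (\<lambda>w. (views N w, drop (N * L) w)) (replicate_pmf (N * L + e) P) =
      map_pmf (\<lambda>(x, y). (map view x, y))
        (map_pmf (\<lambda>w. (chunk L N w, drop (N * L) w)) (replicate_pmf (N * L + e) P))"
    by (simp add: pmf.map_comp comp_def views_def)
  also have "\<dots> = pair_pmf (map_pmf (map view) (replicate_pmf N (replicate_pmf L P)))
      (map_pmf (\<lambda>y. y) (replicate_pmf e P))"
    unfolding chunk_replicate_pmf by (rule map_pair)
  finally show ?thesis by (simp add: map_replicate_pmf map_view)
qed

section \<open>Reliability: few exceptional blocks, and decoding\<close>

definition bads :: "nat \<Rightarrow> ('z list \<times> nat \<times> nat) list \<Rightarrow> nat set" where
  "bads N V = {i. i < N \<and> \<not> good (V ! i)}"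

text \<open>Union bound over the at most \<open>2 ^ N\<close> sets of more than
  \<open>N div 1000\<close> blocks. This is the origin of the exponent 2000 in the hypothesis
  \<open>bad\<close>: \<open>2000 * (N div 1000 + 1) \<ge> 2 * N\<close> pays for the number of sets
  and leaves \<open>(1 / 2) ^ N\<close>.\<close>

lemma prob_many_bads:
  "measure_pmf.prob (replicate_pmf (N * L + e) P) {w. N div 1000 < card (bads N (evs N w))} \<le> (1 / 2) ^ N"
proof -
  let ?t = "N div 1000"
  define Bad where "Bad = {(ba :: bool, bb :: bool, v). \<not> good v}"
  define X where "X S = {os. \<forall>i<N. os ! i \<in> (if i \<in> S then Bad else UNIV)}" for S
  define Ss where "Ss = {S. S \<subseteq> {..<N} \<and> ?t < card S}"
  have finSs: "finite Ss" by (simp add: Ss_def)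
  have evs_nth: "evs N w ! i = snd (snd (views N w ! i))" if "i < N" for w i
    using that by (simp add: evs_def views_def)
  have "{w. ?t < card (bads N (evs N w))} =
      (\<lambda>w. (views N w, drop (N * L) w)) -` ({os. ?t < card {i. i < N \<and> os ! i \<in> Bad}} \<times> UNIV)"
    by (auto simp: bads_def Bad_def evs_nth case_prod_unfold cong: conj_cong)
  then have "measure_pmf.prob (replicate_pmf (N * L + e) P) {w. ?t < card (bads N (evs N w))} =
      measure_pmf.prob (replicate_pmf N B) {os. ?t < card {i. i < N \<and> os ! i \<in> Bad}}"
    by (simp only: measure_map_pmf[symmetric] iid_views prob_pair_pmf_Times) simp
  also have "\<dots> \<le> measure_pmf.prob (replicate_pmf N B) (\<Union>S\<in>Ss. X S)"
  proof (intro measure_pmf.finite_measure_mono subsetI)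
    fix os assume "os \<in> {os. ?t < card {i. i < N \<and> os ! i \<in> Bad}}"
    then have "{i. i < N \<and> os ! i \<in> Bad} \<in> Ss" "os \<in> X {i. i < N \<and> os ! i \<in> Bad}"
      by (auto simp: Ss_def X_def)
    then show "os \<in> (\<Union>S\<in>Ss. X S)" by blast
  qed simp
  also have "\<dots> \<le> (\<Sum>S\<in>Ss. measure_pmf.prob (replicate_pmf N B) (X S))"
    using finSs by (intro measure_pmf.finite_measure_subadditive_finite) auto
  also have "\<dots> \<le> (\<Sum>S\<in>Ss. ((1 / 2) ^ 2000) ^ (?t + 1))"
  proof (rule sum_mono)
    fix S assume S: "S \<in> Ss"
    then have finS: "finite S" by (auto simp: Ss_def intro: finite_subset)
    have "measure_pmf.prob (replicate_pmf N B) (X S) =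
        (\<Prod>i<N. measure_pmf.prob B (if i \<in> S then Bad else UNIV))"
      unfolding X_def by (rule prob_replicate_pmf_nth)
    also have "\<dots> = (\<Prod>i<N. if i \<in> S then measure_pmf.prob B Bad else 1)"
      by (intro prod.cong) auto
    also have "\<dots> = measure_pmf.prob B Bad ^ card ({..<N} \<inter> S)"
      by (simp add: prod.If_cases Int_def)
    also have "{..<N} \<inter> S = S" using S by (auto simp: Ss_def)
    also have "measure_pmf.prob B Bad ^ card S \<le> ((1 / 2) ^ 2000) ^ card S"
      using bad unfolding Bad_def by (intro power_mono) auto
    also have "\<dots> \<le> ((1 / 2) ^ 2000) ^ (?t + 1)"
      using S unfolding power_mult[symmetric]
      by (intro power_decreasing) (auto simp: Ss_def)
    finally show "measure_pmf.prob (replicate_pmf N B) (X S) \<le> ((1 / 2) ^ 2000) ^ (?t + 1)" .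
  qed
  also have "\<dots> \<le> 2 ^ N * ((1 / 2) ^ 2000) ^ (?t + 1)"
  proof -
    have "card Ss \<le> card (Pow {..<N})"
      by (intro card_mono) (auto simp: Ss_def)
    then have "real (card Ss) \<le> 2 ^ N" by (simp add: card_Pow)
    then show ?thesis unfolding sum_constant by (intro mult_right_mono) auto
  qed
  also have "((1 / 2 :: real) ^ 2000) ^ (?t + 1) \<le> (1 / 2) ^ (N + N)"
    unfolding power_mult[symmetric] by (rule power_decreasing) auto
  also have "(2 :: real) ^ N * (1 / 2) ^ (N + N) = (1 / 2) ^ N"
    by (simp add: power_add power_one_over)
  finally show ?thesis by simp
qed

lemma length_views [simp]: "length (views N w) = N" and length_evs [simp]: "length (evs N w) = N"
  by (simp_all add: views_def evs_def)

lemma sym_diff_bits_subset: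
  assumes w: "w \<in> set_pmf (replicate_pmf (N * L + e) P)"
  shows "sym_diff (abits N w) (bbits N w) \<subseteq> bads N (evs N w)"
proof
  fix i assume i: "i \<in> sym_diff (abits N w) (bbits N w)"
  then have iN: "i < N" by (auto simp: abits_def bbits_def ones_def)
  obtain ba bb v where o: "views N w ! i = (ba, bb, v)" by (metis prod_cases3)
  have "(views N w, drop (N * L) w) \<in> set_pmf (pair_pmf (replicate_pmf N B) (replicate_pmf e P))"
    unfolding iid_views[symmetric] using w by auto
  then have "views N w \<in> lists (set_pmf B)"
    by (auto simp: set_replicate_pmf)
  then have "(ba, bb, v) \<in> set_pmf B"
    using iN o by (metis in_lists_conv_set length_views nth_mem)
  moreover have "ba \<noteq> bb"
    using i iN o by (auto simp: abits_def bbits_def ones_def)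
  ultimately have "\<not> good v" using agree by blast
  then show "i \<in> bads N (evs N w)"
    using iN o by (simp add: bads_def evs_def)
qed

lemma check_eq_iff: "check N A = check N C \<longleftrightarrow> syndrome (N div 4) (code N) A = syndrome (N div 4) (code N) C"
  unfolding check_def
  by (intro set_encode_eq) (auto intro: finite_subset[OF syndrome_subset])

lemma decode_correct:
  assumes w: "w \<in> set_pmf (replicate_pmf (N * L + e) P)"
    and few: "card (bads N (evs N w)) \<le> N div 1000"
  shows "decode N (bbits N w) (check N (abits N w)) = abits N w"
proof -
  let ?A = "abits N w" and ?B = "bbits N w"
  have sub: "?A \<subseteq> {..<N}" "?B \<subseteq> {..<N}"
    by (auto simp: abits_def bbits_def ones_def)
  have "card (sym_diff ?A ?B) \<le> card (bads N (evs N w))"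
    using sym_diff_bits_subset[OF w] by (intro card_mono) (auto simp: bads_def)
  with few have d: "card (sym_diff ?A ?B) \<le> N div 1000" by simp
  define C where "C = decode N ?B (check N ?A)"
  have "C \<subseteq> {..<N} \<and> check N C = check N ?A \<and> card (sym_diff C ?B) \<le> N div 1000"
    unfolding C_def decode_def by (rule someI[of _ ?A]) (use sub d in auto)
  then have "C = ?A"
    using key_code_decode[OF key_code_code, of C N ?A ?B] sub d by (simp add: check_eq_iff)
  then show ?thesis by (simp add: C_def)
qed

section \<open>Secrecy: the key is exactly uniform given a view with few exceptions\<close>

abbreviation AV where "AV \<equiv> map_pmf (\<lambda>(ba, bb, v). (ba, v)) B"

lemma pmf_AV_good: "good v \<Longrightarrow> pmf AV (x, v) = pmf AV (y, v)"
proof -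
  assume g: "good v"
  have inj: "inj (flip_bit good)"
    by (rule injI) (auto simp: flip_bit_def split: if_splits prod.splits)
  have "flip_bit good (False, v) = (True, v)" using g by (simp add: flip_bit_def)
  then have "pmf AV (True, v) = pmf (map_pmf (flip_bit good) AV) (flip_bit good (False, v))"
    by (simp only: flip)
  also have "\<dots> = pmf AV (False, v)"
    by (rule pmf_map_inj'[OF inj])
  finally show "pmf AV (x, v) = pmf AV (y, v)" by (cases x; cases y) auto
qed

text \<open>The joint probability that Alice's bits form \<open>A\<close> and Eve's block views are
  \<open>V\<close>. A block with a good view contributes the same factor for either bit.\<close>

definition weight :: "nat \<Rightarrow> ('z list \<times> nat \<times> nat) list \<Rightarrow> nat set \<Rightarrow> real" where
  "weight N V A = (\<Prod>i<N. pmf AV (i \<in> A, V ! i))"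

lemma prob_abits_evs:
  assumes V: "length V = N"
  shows "measure_pmf.prob (replicate_pmf N B) {os. map (snd \<circ> snd) os = V \<and> Q (ones (map fst os))} =
    (\<Sum>A | A \<subseteq> {..<N} \<and> Q A. weight N V A)"
proof -
  let ?S = "{A. A \<subseteq> {..<N} \<and> Q A}"
  let ?l = "\<lambda>A. map (\<lambda>i. (i \<in> A, V ! i)) [0..<N]"
  have "measure_pmf.prob (replicate_pmf N B) {os. map (snd \<circ> snd) os = V \<and> Q (ones (map fst os))} =
      measure_pmf.prob (replicate_pmf N AV) {avs. map snd avs = V \<and> Q (ones (map fst avs))}"
    unfolding map_replicate_pmf[symmetric] measure_map_pmf
    by (simp add: vimage_def comp_def case_prod_unfold)
  also have "{avs. map snd avs = V \<and> Q (ones (map fst avs))} = ?l ` ?S"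
  proof (intro set_eqI iffI)
    fix avs assume *: "avs \<in> {avs. map snd avs = V \<and> Q (ones (map fst avs))}"
    then have len: "length avs = N" using V by auto
    have "avs = ?l (ones (map fst avs))"
      using * len by (intro nth_equalityI) (auto simp: ones_def prod_eq_iff)
    moreover have "ones (map fst avs) \<in> ?S" using * len by (auto simp: ones_def)
    ultimately show "avs \<in> ?l ` ?S" by blast
  next
    fix avs assume "avs \<in> ?l ` ?S"
    then obtain A where A: "A \<subseteq> {..<N}" "Q A" "avs = ?l A" by auto
    moreover have "ones (map fst (?l A)) = A" using A by (auto simp: ones_def)
    moreover have "map snd (?l A) = V" using V by (intro nth_equalityI) auto
    ultimately show "avs \<in> {avs. map snd avs = V \<and> Q (ones (map fst avs))}" by simp
  qed
  also have "measure_pmf.prob (replicate_pmf N AV) (?l ` ?S) = (\<Sum>avs\<in>?l ` ?S. pmf (replicate_pmf N AV) avs)"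
    by (rule measure_measure_pmf_finite) simp
  also have "\<dots> = (\<Sum>A\<in>?S. pmf (replicate_pmf N AV) (?l A))"
  proof (rule sum.reindex_cong[OF _ refl refl])
    show "inj_on ?l ?S"
    proof (rule inj_onI)
      fix A C assume AC: "A \<in> ?S" "C \<in> ?S" "?l A = ?l C"
      have "i \<in> A \<longleftrightarrow> i \<in> C" if "i < N" for i
        using arg_cong[OF AC(3), of "\<lambda>l. fst (l ! i)"] that by simp
      then show "A = C" using AC by blast
    qed
  qed
  also have "\<dots> = (\<Sum>A\<in>?S. weight N V A)"
    unfolding weight_def by (intro sum.cong refl, subst pmf_replicate_pmf_nth) auto
  finally show ?thesis .
qed

text \<open>Splits all that Eve observes into block views, the \<open>Z\<close> part of the leftover
  letters, and the check.\<close>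

lemma transcr_eq_iff:
  assumes w: "length w = N * L + e" and w0: "length w0 = N * L + e"
  shows "Zs w = Zs w0 \<and> transcr N w = transcr N w0 \<longleftrightarrow>
    evs N w = evs N w0 \<and> Zs (drop (N * L) w) = Zs (drop (N * L) w0) \<and>
    check N (abits N w) = check N (abits N w0)"
proof -
  have fst_evs: "map fst (evs N w) = chunk L N (Zs w)" for w :: "('x \<times> 'y \<times> 'z) list"
    by (simp add: evs_def views_def view_def chunk_map comp_def)
  have split: "evs N w = evs N w0 \<longleftrightarrow> map fst (evs N w) = map fst (evs N w0) \<and>
      map (fst \<circ> snd) (evs N w) = map (fst \<circ> snd) (evs N w0) \<and>
      map (snd \<circ> snd) (evs N w) = map (snd \<circ> snd) (evs N w0)"
    by (auto simp: list_eq_iff_nth_eq prod_eq_iff)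
  have "Zs w = Zs w0 \<longleftrightarrow> chunk L N (Zs w) = chunk L N (Zs w0) \<and>
      drop (N * L) (Zs w) = drop (N * L) (Zs w0)"
    using concat_chunk[of L N "Zs w"] concat_chunk[of L N "Zs w0"] by metis
  then show ?thesis
    unfolding split fst_evs by (auto simp: transcr_def drop_map)
qed

text \<open>Check and key together are one full syndrome of Alice's bits. The weight of the bits
  depends only on the few exceptional positions, so \<open>sum_syndrome_fiber_indep\<close> gives
  each syndrome the same probability.\<close>

lemma key_uniform:
  assumes w0: "w0 \<in> set_pmf (replicate_pmf (N * L + e) P)"
    and few: "card (bads N (evs N w0)) \<le> N div 1000"
  obtains c where "\<And>k. k \<in> keys N \<Longrightarrow> measure_pmf.prob (replicate_pmf (N * L + e) P)
    {w. key N (abits N w) = k \<and> Zs w = Zs w0 \<and> transcr N w = transcr N w0} = c"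
proof -
  let ?h = "N div 4" and ?V = "evs N w0" and ?R = "replicate_pmf (N * L + e) P"
  let ?T = "bads N ?V"
  let ?q = "measure_pmf.prob (replicate_pmf e P) {ex. Zs ex = Zs (drop (N * L) w0)}"
  have T: "?T \<subseteq> {..<N}" by (auto simp: bads_def)
  have W: "weight N ?V A = weight N ?V (A \<inter> ?T)" if "A \<subseteq> {..<N}" for A
    unfolding weight_def
  proof (rule prod.cong[OF refl])
    fix i assume "i \<in> {..<N}"
    then show "pmf AV (i \<in> A, ?V ! i) = pmf AV (i \<in> A \<inter> ?T, ?V ! i)"
      by (cases "good (?V ! i)") (rule pmf_AV_good, simp_all add: bads_def)
  qed
  show thesis
  proof (rule that)
    fix k assume "k \<in> keys N"
    then obtain K where K: "K \<subseteq> {?h..<?h + ?h}" "k = set_encode K"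
      by (auto simp: keys_def)
    \<comment> \<open>The observed check and the candidate key occupy disjoint index ranges, so
      their union is the syndrome to be counted.\<close>
    define S0 where "S0 = syndrome ?h (code N) (abits N w0) \<union> K"
    have S0: "S0 \<subseteq> {..<?h + ?h}"
      using syndrome_subset[of ?h "code N" "abits N w0"] K by (auto simp: S0_def)
    have Q: "key N A = k \<and> check N A = check N (abits N w0) \<longleftrightarrow> syndrome (?h + ?h) (code N) A = S0" for A
    proof -
      let ?S = "syndrome (?h + ?h) (code N) A"
      have low: "?S \<inter> {..<?h} = syndrome ?h (code N) A"
        by (auto simp: syndrome_def)
      have "key N A = k \<longleftrightarrow> ?S - {..<?h} = K"
        unfolding key_def K(2) using K(1)
        by (intro set_encode_eq) (auto intro: finite_subset[OF syndrome_subset] finite_subset)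
      moreover have "check N A = check N (abits N w0) \<longleftrightarrow>
          ?S \<inter> {..<?h} = syndrome ?h (code N) (abits N w0)"
        unfolding check_eq_iff low ..
      moreover have "syndrome ?h (code N) (abits N w0) \<subseteq> {..<?h}" by (rule syndrome_subset)
      ultimately show ?thesis using K(1) unfolding S0_def by fastforce
    qed
    have "measure_pmf.prob ?R {w. key N (abits N w) = k \<and> Zs w = Zs w0 \<and> transcr N w = transcr N w0} =
        measure_pmf.prob ?R ((\<lambda>w. (views N w, drop (N * L) w)) -`
          ({os. map (snd \<circ> snd) os = ?V \<and> syndrome (?h + ?h) (code N) (ones (map fst os)) = S0} \<times>
           {ex. Zs ex = Zs (drop (N * L) w0)}))"
    proof (rule measure_pmf.finite_measure_eq_AE)
      show "AE w in ?R. w \<in> {w. key N (abits N w) = k \<and> Zs w = Zs w0 \<and> transcr N w = transcr N w0} \<longleftrightarrow>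
          w \<in> (\<lambda>w. (views N w, drop (N * L) w)) -`
          ({os. map (snd \<circ> snd) os = ?V \<and> syndrome (?h + ?h) (code N) (ones (map fst os)) = S0} \<times>
           {ex. Zs ex = Zs (drop (N * L) w0)})"
        unfolding AE_measure_pmf_iff
      proof
        fix w assume "w \<in> set_pmf ?R"
        then have len: "length w = N * L + e" "length w0 = N * L + e"
          using w0 by (auto dest: length_replicate_pmf)
        show "w \<in> {w. key N (abits N w) = k \<and> Zs w = Zs w0 \<and> transcr N w = transcr N w0} \<longleftrightarrow>
            w \<in> (\<lambda>w. (views N w, drop (N * L) w)) -`
            ({os. map (snd \<circ> snd) os = ?V \<and> syndrome (?h + ?h) (code N) (ones (map fst os)) = S0} \<times>
             {ex. Zs ex = Zs (drop (N * L) w0)})"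
          using transcr_eq_iff[OF len] Q[of "abits N w"]
          by (auto simp: evs_def[of N w, symmetric] abits_def[of N w, symmetric])
      qed
    qed simp_all
    also have "\<dots> = (\<Sum>A | A \<subseteq> {..<N} \<and> syndrome (?h + ?h) (code N) A = S0. weight N ?V A) * ?q"
      unfolding measure_map_pmf[symmetric] iid_views prob_pair_pmf_Times
      by (subst prob_abits_evs) auto
    also have "\<dots> = (\<Sum>D\<in>Pow ?T. weight N ?V D) * 2 ^ card ({..<N} - ?T) / 2 ^ (?h + ?h) * ?q"
      using sum_syndrome_fiber_indep[OF key_code_code T few, of "weight N ?V" S0] W S0 by simp
    finally show "measure_pmf.prob ?R {w. key N (abits N w) = k \<and> Zs w = Zs w0 \<and> transcr N w = transcr N w0} =
        (\<Sum>D\<in>Pow ?T. weight N ?V D) * 2 ^ card ({..<N} - ?T) / 2 ^ (?h + ?h) * ?q" .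
  qed
qed

lemma key_in_keys: "key N A \<in> keys N"
  using syndrome_subset[of "N div 4 + N div 4" "code N" A] by (force simp: key_def keys_def)

lemma finite_keys: "finite (keys N)"
  by (simp add: keys_def)

lemma card_keys: "card (keys N) = 2 ^ (N div 4)"
proof -
  have "inj_on set_encode (Pow {N div 4..<N div 4 + N div 4})"
    by (rule inj_on_subset[OF inj_on_set_encode]) (auto intro: finite_subset)
  then show ?thesis by (simp add: keys_def card_image card_Pow)
qed

lemma key_protocol_bounds:
  fixes N e
  defines "n \<equiv> N * L + e"
  defines "p \<equiv> measure_pmf (key_law P n (key_protocol N))"
  defines "D \<equiv> log 2 (real (card (keys N))) -
      prob_space.entropy p 2 (count_space UNIV) (\<lambda>(ka, kb, zs, F). ka)"
    and "I \<equiv> prob_space.mutual_information p 2 (count_space UNIV) (count_space UNIV)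
      (\<lambda>(ka, kb, zs, F). ka) (\<lambda>(ka, kb, zs, F). (zs, F))"
  shows "0 \<le> D" "0 \<le> I" "D + I \<le> (1 / 2) ^ N * real N"
    and "1 - (1 / 2) ^ N \<le> measure p {(ka, kb, zs, F). ka = kb}"
proof -
  let ?R = "replicate_pmf n P"
  let ?\<Phi> = "\<lambda>w. (key N (abits N w), key N (decode N (bbits N w) (check N (abits N w))), Zs w, transcr N w)"
  let ?few = "\<lambda>w. card (bads N (evs N w)) \<le> N div 1000"
  have law: "key_law P n (key_protocol N) = map_pmf ?\<Phi> ?R"
    by (rule key_law_key_protocol)
  define E where "E = {(Zs w, transcr N w) | w. w \<in> set_pmf ?R \<and> ?few w}"
  have many: "measure_pmf.prob ?R {w. \<not> ?few w} \<le> (1 / 2) ^ N"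
    using prob_many_bads[of N e] by (simp add: n_def not_le)
  have fin: "finite (set_pmf (key_law P n (key_protocol N)))"
    unfolding law using finite_set_replicate_pmf[of P n] by simp
  have sub: "(case x of (ka, kb, zs, F) \<Rightarrow> ka) \<in> keys N"
    if "x \<in> set_pmf (key_law P n (key_protocol N))" for x
    using that by (auto simp: law key_in_keys)
  have unif: "measure_pmf.prob (key_law P n (key_protocol N))
        {x. (case x of (ka, kb, zs, F) \<Rightarrow> ka) = k \<and> (case x of (ka, kb, zs, F) \<Rightarrow> (zs, F)) = y} =
      measure_pmf.prob (key_law P n (key_protocol N))
        {x. (case x of (ka, kb, zs, F) \<Rightarrow> ka) = k' \<and> (case x of (ka, kb, zs, F) \<Rightarrow> (zs, F)) = y}"
    if y: "y \<in> E" and k: "k \<in> keys N" "k' \<in> keys N" for y k k'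
  proof -
    from y obtain w0 where w0: "y = (Zs w0, transcr N w0)" "w0 \<in> set_pmf ?R" "?few w0"
      by (auto simp: E_def)
    from w0(2,3) obtain c where c: "\<And>k. k \<in> keys N \<Longrightarrow> measure_pmf.prob ?R
      {w. key N (abits N w) = k \<and> Zs w = Zs w0 \<and> transcr N w = transcr N w0} = c"
      unfolding n_def by (rule key_uniform) auto
    have eq: "measure_pmf.prob (key_law P n (key_protocol N))
        {x. (case x of (ka, kb, zs, F) \<Rightarrow> ka) = k \<and> (case x of (ka, kb, zs, F) \<Rightarrow> (zs, F)) = y} = c"
      if "k \<in> keys N" for k
      unfolding c[OF that, symmetric] law measure_map_pmf vimage_def w0(1) by simp
    show ?thesis using eq k by simp
  qed
  have notE: "measure_pmf.prob (key_law P n (key_protocol N))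
      {x. (case x of (ka, kb, zs, F) \<Rightarrow> (zs, F)) \<notin> E} \<le> (1 / 2) ^ N"
  proof -
    have "measure_pmf.prob (key_law P n (key_protocol N)) {x. (case x of (ka, kb, zs, F) \<Rightarrow> (zs, F)) \<notin> E} =
        measure_pmf.prob ?R {w. (Zs w, transcr N w) \<notin> E}"
      unfolding law measure_map_pmf vimage_def by simp
    also have "\<dots> = measure_pmf.prob ?R ({w. (Zs w, transcr N w) \<notin> E} \<inter> set_pmf ?R)"
      by (simp only: measure_Int_set_pmf)
    also have "\<dots> \<le> measure_pmf.prob ?R {w. \<not> ?few w}"
      by (rule measure_pmf.finite_measure_mono) (auto simp: E_def)
    also note many
    finally show ?thesis .
  qed
  have bounds: "0 \<le> D" "0 \<le> I" "D + I \<le> (1 / 2) ^ N * log 2 (real (card (keys N)))"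
    unfolding D_def I_def p_def by (rule uniform_key_bounds[OF fin finite_keys sub unif notE]; assumption)+
  show "0 \<le> D" "0 \<le> I" by (rule bounds)+
  have "log 2 (real (card (keys N))) = real (N div 4)"
    by (simp add: card_keys log_nat_power)
  then show "D + I \<le> (1 / 2) ^ N * real N"
    using bounds(3) by (elim order_trans) (auto intro!: mult_left_mono)
  have "1 - (1 / 2) ^ N \<le> 1 - measure_pmf.prob ?R {w. \<not> ?few w}"
    using many by simp
  also have "\<dots> = measure_pmf.prob ?R {w. ?few w}"
    by (subst measure_pmf.prob_compl[symmetric]) (auto intro!: arg_cong[where f = "measure_pmf.prob ?R"])
  also have "\<dots> = measure_pmf.prob ?R ({w. ?few w} \<inter> set_pmf ?R)"
    by (simp only: measure_Int_set_pmf)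
  also have "\<dots> \<le> measure_pmf.prob ?R {w. key N (abits N w) = key N (decode N (bbits N w) (check N (abits N w)))}"
    by (rule measure_pmf.finite_measure_mono) (auto simp: n_def decode_correct)
  also have "\<dots> = measure p {(ka, kb, zs, F). ka = kb}"
    unfolding p_def law measure_map_pmf vimage_def by simp
  finally show "1 - (1 / 2) ^ N \<le> measure p {(ka, kb, zs, F). ka = kb}" .
qed

section \<open>Limits and the rate of the protocol\<close>

lemma filterlim_div_L: "filterlim (\<lambda>n. n div L) sequentially sequentially"
  unfolding filterlim_at_top
proof
  fix M
  show "\<forall>\<^sub>F n in sequentially. M \<le> n div L"
    using eventually_ge_at_top[of "M * L"]
  proof eventually_elim
    case (elim n)
    then have "M * L div L \<le> n div L" by (rule div_le_mono)
    then show ?case using L_pos by simp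
  qed
qed

theorem secret_key_rate_pos: "secret_key_rate P > 0"
proof -
  define p where "p n = key_protocol (n div L)" for n
  define K where "K n = keys (n div L)" for n
  note bounds = key_protocol_bounds[of "n div L" "n mod L" for n, unfolded div_mult_mod_eq]
  have lim1: "(\<lambda>n. (1 / 2) ^ (n div L) * real (n div L)) \<longlonglongrightarrow> 0"
    using filterlim_compose[OF _ filterlim_div_L, of "\<lambda>n. (1 / 2) ^ n * real n"]
      powser_times_n_limit_0[of "1 / 2 :: real"] by (simp add: mult.commute)
  have lim2: "(\<lambda>n. 1 - (1 / 2 :: real) ^ (n div L)) \<longlonglongrightarrow> 1"
  proof -
    have "(\<lambda>n. (1 / 2 :: real) ^ n) \<longlonglongrightarrow> 0" by (rule LIMSEQ_realpow_zero) auto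
    from filterlim_compose[OF this filterlim_div_L]
    show ?thesis using tendsto_diff[OF tendsto_const[of 1]] by fastforce
  qed
  have "admissible P p K"
    unfolding admissible_def
  proof (intro conjI allI ballI)
    fix n
    show "finite_randomness (p n)"
      by (simp add: finite_randomness_def p_def key_protocol_def)
    show "finite (K n)" by (simp add: K_def finite_keys)
    fix x assume "x \<in> set_pmf (key_law P n (p n))"
    then show "case x of (ka, kb, zs, F) \<Rightarrow> ka \<in> K n \<and> kb \<in> K n"
      by (auto simp: p_def K_def key_law_key_protocol key_in_keys)
  next
    show "(\<lambda>n. measure_pmf.prob (key_law P n (p n)) {(ka, kb, zs, F). ka = kb}) \<longlonglongrightarrow> 1"
      by (rule tendsto_sandwich[OF _ _ lim2 tendsto_const])
         (use bounds(4) in \<open>auto simp: p_def\<close>)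
    show "(\<lambda>n. log 2 (real (card (K n))) - prob_space.entropy (measure_pmf (key_law P n (p n))) 2
        (count_space UNIV) (\<lambda>(ka, kb, zs, F). ka)) \<longlonglongrightarrow> 0"
    proof (rule tendsto_sandwich[OF always_eventually always_eventually tendsto_const lim1]; rule allI)
      fix n
      show "0 \<le> log 2 (real (card (K n))) - prob_space.entropy (measure_pmf (key_law P n (p n))) 2
          (count_space UNIV) (\<lambda>(ka, kb, zs, F). ka)"
        unfolding p_def K_def by (rule bounds(1))
      show "log 2 (real (card (K n))) - prob_space.entropy (measure_pmf (key_law P n (p n))) 2
          (count_space UNIV) (\<lambda>(ka, kb, zs, F). ka) \<le> (1 / 2) ^ (n div L) * real (n div L)"
        using bounds(2,3)[of n] unfolding p_def K_def by linarith
    qed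
    show "(\<lambda>n. prob_space.mutual_information (measure_pmf (key_law P n (p n))) 2
        (count_space UNIV) (count_space UNIV)
        (\<lambda>(ka, kb, zs, F). ka) (\<lambda>(ka, kb, zs, F). (zs, F))) \<longlonglongrightarrow> 0"
    proof (rule tendsto_sandwich[OF always_eventually always_eventually tendsto_const lim1]; rule allI)
      fix n
      show "0 \<le> prob_space.mutual_information (measure_pmf (key_law P n (p n))) 2
          (count_space UNIV) (count_space UNIV)
          (\<lambda>(ka, kb, zs, F). ka) (\<lambda>(ka, kb, zs, F). (zs, F))"
        unfolding p_def by (rule bounds(2))
      show "prob_space.mutual_information (measure_pmf (key_law P n (p n))) 2
          (count_space UNIV) (count_space UNIV)
          (\<lambda>(ka, kb, zs, F). ka) (\<lambda>(ka, kb, zs, F). (zs, F)) \<le> (1 / 2) ^ (n div L) * real (n div L)"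
        using bounds(1,3)[of n] unfolding p_def by linarith
    qed
  qed
  then have le: "key_rate K \<le> secret_key_rate P"
    unfolding secret_key_rate_def by (intro Sup_upper) auto
  \<comment> \<open>The rate is about \<open>1 / (4 * L)\<close>; the smaller constant absorbs the
    roundings in \<open>n div L\<close> and \<open>N div 4\<close> for
    \<open>n \<ge> 8 * L\<close>.\<close>
  have "0 < ereal (1 / (16 * real L))" using L_pos by simp
  also have "\<dots> \<le> key_rate K"
    unfolding key_rate_def
  proof (rule Liminf_bounded)
    show "\<forall>\<^sub>F n in sequentially. ereal (1 / (16 * real L)) \<le> ereal (log 2 (real (card (K n))) / real n)"
      using eventually_ge_at_top[of "8 * L"]
    proof eventually_elim
      case (elim n)
      define N where "N = n div L"
      have N8: "N \<ge> 8"
        using div_le_mono[OF elim, of L] L_pos by (simp add: N_def)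
      have "n < (N + 1) * L"
        using L_pos by (simp add: N_def dividend_less_div_times add.commute)
      moreover have "N + 1 \<le> 16 * (N div 4)" using N8 by linarith
      ultimately have "n \<le> 16 * (N div 4) * L"
        by (meson less_imp_le_nat mult_le_mono1 order_trans)
      then have "real n \<le> real (16 * (N div 4) * L)" by (rule of_nat_mono)
      moreover have "real n > 0" using elim L_pos by (cases n) auto
      ultimately have "1 / (16 * real L) \<le> real (N div 4) / real n"
        using L_pos by (simp add: field_simps)
      then show ?case
        by (simp add: K_def N_def card_keys log_nat_power)
    qed
  qed
  also note le
  finally show ?thesis .
qed

end

subsection \<open>Waiting for an accepted block\<close>

lemma chunk_concat:
  assumes "length xss = n" "\<And>xs. xs \<in> set xss \<Longrightarrow> length xs = L"
  shows "chunk L n (concat xss) = xss"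
  using assms by (induction xss arbitrary: n) auto

text \<open>If no entry is true the value is the length of the list; this serves as the reply that
  nothing was accepted.\<close>

primrec first_true :: "bool list \<Rightarrow> nat" where
  "first_true [] = 0"
| "first_true (c # cs) = (if c then 0 else Suc (first_true cs))"

lemma first_true_nth: "first_true cs < length cs \<Longrightarrow> cs ! first_true cs"
  by (induction cs) auto

definition accept_law ::
    "('x \<times> 'y \<times> 'z) pmf \<Rightarrow> nat \<Rightarrow> ('y list \<Rightarrow> nat) \<Rightarrow> ('x list \<Rightarrow> nat \<Rightarrow> bool) \<Rightarrow>
      ('x list \<Rightarrow> nat \<Rightarrow> bool) \<Rightarrow> ('y list \<Rightarrow> bool) \<Rightarrow> (bool \<times> bool \<times> bool \<times> 'z list \<times> nat) pmf" where
  "accept_law P L s c a b =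
     map_pmf (\<lambda>w. (c (Xs w) (s (Ys w)), a (Xs w) (s (Ys w)), b (Ys w), Zs w, s (Ys w)))
       (replicate_pmf L P)"

definition flip_accepted :: "('v \<Rightarrow> bool) \<Rightarrow> bool \<times> bool \<times> 'v \<Rightarrow> bool \<times> bool \<times> 'v" where
  "flip_accepted good = (\<lambda>(c, a, v). (c, if c \<and> good v then \<not> a else a, v))"

text \<open>Alice may reject a block, and exceptions need only be rare relative to good acceptance,
  however small its probability is. The exponent 2001 leaves half of the allowance
  \<open>(1 / 2) ^ 2000\<close> for the case that no block in a long series is accepted.\<close>

locale accept_scheme =
  fixes P :: "('x::finite \<times> 'y::finite \<times> 'z::finite) pmf" and L :: nat
    and s :: "'y list \<Rightarrow> nat" and c :: "'x list \<Rightarrow> nat \<Rightarrow> bool"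
    and a :: "'x list \<Rightarrow> nat \<Rightarrow> bool" and b :: "'y list \<Rightarrow> bool"
    and good :: "'z list \<times> nat \<Rightarrow> bool"
  assumes L_pos: "L > 0"
    and agree: "\<And>ba bb v. (True, ba, bb, v) \<in> set_pmf (accept_law P L s c a b) \<Longrightarrow> good v \<Longrightarrow> ba = bb"
    and flip: "map_pmf (flip_accepted good) (map_pmf (\<lambda>(bc, ba, bb, v). (bc, ba, v)) (accept_law P L s c a b)) =
      map_pmf (\<lambda>(bc, ba, bb, v). (bc, ba, v)) (accept_law P L s c a b)"
    and good_pos: "0 < measure_pmf.prob (accept_law P L s c a b) {(bc, ba, bb, v). bc \<and> good v}"
    and bad: "measure_pmf.prob (accept_law P L s c a b) {(bc, ba, bb, v). bc \<and> \<not> good v} \<le>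
      (1 / 2) ^ 2001 * measure_pmf.prob (accept_law P L s c a b) {(bc, ba, bb, v). bc \<and> good v}"
begin

abbreviation AL where "AL \<equiv> accept_law P L s c a b"

definition "g = measure_pmf.prob AL {(bc, ba, bb, v). bc \<and> good v}"

primrec miss :: "(bool \<times> bool \<times> bool \<times> 'z list \<times> nat) list \<Rightarrow> bool" where
  "miss [] = True"
| "miss (x # os) = (case x of (bc, ba, bb, v) \<Rightarrow> if bc then \<not> good v else miss os)"

text \<open>Write \<open>\<tau>\<close> for \<open>(1 / 2) ^ 2001\<close>. The leading block is
  accepted and bad with probability at most \<open>\<tau> * g\<close> and rejected with probability
  at most \<open>1 - g\<close>; the recursion closes since
  \<open>\<tau> * g + (1 - g) * \<tau> = \<tau>\<close>.\<close>

lemma prob_miss: "measure_pmf.prob (replicate_pmf J AL) {os. miss os} \<le> (1 / 2) ^ 2001 + (1 - g) ^ J"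
proof (induction J)
  case (Suc J)
  let ?\<tau> = "(1 / 2 :: real) ^ 2001"
  let ?X = "{(bc :: bool, ba :: bool, bb :: bool, v). bc \<and> \<not> good v}"
  let ?Y = "{(bc :: bool, ba :: bool, bb :: bool, v :: 'z list \<times> nat). \<not> bc}"
  let ?G = "{(bc :: bool, ba :: bool, bb :: bool, v). bc \<and> good v}"
  have g1: "g \<le> 1" by (simp add: g_def)
  have Y: "measure_pmf.prob AL ?Y \<le> 1 - g"
  proof -
    have "measure_pmf.prob AL ?Y + g = measure_pmf.prob AL (?Y \<union> ?G)"
      unfolding g_def by (rule measure_pmf.finite_measure_Union[symmetric]) auto
    also have "\<dots> \<le> 1" by (rule measure_pmf.prob_le_1)
    finally show ?thesis by simp
  qed
  have "replicate_pmf (Suc J) AL = map_pmf (\<lambda>(x, xs). x # xs) (pair_pmf AL (replicate_pmf J AL))"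
    by (simp add: pair_pmf_def map_bind_pmf map_pmf_def bind_assoc_pmf bind_return_pmf)
  moreover have "(\<lambda>(x, xs). x # xs) -` {os. miss os} = ?X \<times> UNIV \<union> ?Y \<times> {os. miss os}"
    by (auto split: if_splits)
  ultimately have "measure_pmf.prob (replicate_pmf (Suc J) AL) {os. miss os} =
      measure_pmf.prob (pair_pmf AL (replicate_pmf J AL)) (?X \<times> UNIV \<union> ?Y \<times> {os. miss os})"
    by simp
  also have "\<dots> \<le> measure_pmf.prob (pair_pmf AL (replicate_pmf J AL)) (?X \<times> UNIV) +
      measure_pmf.prob (pair_pmf AL (replicate_pmf J AL)) (?Y \<times> {os. miss os})"
    by (rule measure_Un_le) auto
  also have "\<dots> = measure_pmf.prob AL ?X + measure_pmf.prob AL ?Y * measure_pmf.prob (replicate_pmf J AL) {os. miss os}"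
    by (simp add: prob_pair_pmf_Times)
  also have "\<dots> \<le> ?\<tau> * g + (1 - g) * (?\<tau> + (1 - g) ^ J)"
    using bad Suc.IH Y g1 unfolding g_def by (intro add_mono mult_mono) auto
  also have "\<dots> = ?\<tau> + (1 - g) ^ Suc J"
    by (simp add: algebra_simps)
  finally show ?case .
qed simp

definition J :: nat where
  "J = (SOME J. (1 - g) ^ J \<le> (1 / 2) ^ 2001)"

lemma power_J_le: "(1 - g) ^ J \<le> (1 / 2) ^ 2001"
proof -
  have "0 \<le> 1 - g" "1 - g < 1" using good_pos by (simp_all add: g_def)
  then obtain n where "(1 - g) ^ n < (1 / 2) ^ 2001"
    using real_arch_pow_inv[of "(1 / 2) ^ 2001" "1 - g"] by auto
  then have "\<exists>n. (1 - g) ^ n \<le> (1 / 2) ^ 2001" using less_imp_le by blast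
  then show ?thesis unfolding J_def by (rule someI_ex)
qed

lemma J_pos: "J > 0"
proof (rule ccontr)
  assume "\<not> J > 0"
  then have "(1 :: real) \<le> (1 / 2) ^ 2001" using power_J_le by simp
  moreover have "(1 / 2 :: real) ^ 2001 < 1" by (rule power_Suc_less_one[of _ 2000, simplified]) auto
  ultimately show False by simp
qed

definition syndromes :: "'y list \<Rightarrow> nat" where
  "syndromes y = to_nat (map s (chunk L J y))"

definition reply :: "'x list \<Rightarrow> nat \<Rightarrow> nat" where
  "reply x \<sigma> = first_true (map2 c (chunk L J x) (from_nat \<sigma>))"

text \<open>Without an accepted block the bit defaults to \<open>False\<close>;
  \<open>good_reply\<close> counts such a view as bad.\<close>

definition alice_bit :: "'x list \<Rightarrow> nat \<Rightarrow> bool" where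
  "alice_bit x \<sigma> \<longleftrightarrow> reply x \<sigma> < J \<and> a (chunk L J x ! reply x \<sigma>) (from_nat \<sigma> ! reply x \<sigma>)"

definition bob_bit :: "'y list \<Rightarrow> nat \<Rightarrow> bool" where
  "bob_bit y i \<longleftrightarrow> i < J \<and> b (chunk L J y ! i)"

definition good_reply :: "'z list \<times> nat \<times> nat \<Rightarrow> bool" where
  "good_reply = (\<lambda>(z, \<sigma>, i). i < J \<and> good (chunk L J z ! i, from_nat \<sigma> ! i))"

definition out :: "(bool \<times> bool \<times> bool \<times> 'z list \<times> nat) list \<Rightarrow> bool \<times> bool \<times> 'z list \<times> nat \<times> nat" where
  "out os = (let i = first_true (map fst os) in
     (i < J \<and> fst (snd (os ! i)), i < J \<and> fst (snd (snd (os ! i))),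
      concat (map (\<lambda>(bc, ba, bb, z, t). z) os), to_nat (map (\<lambda>(bc, ba, bb, z, t). t) os), i))"

definition out' :: "(bool \<times> bool \<times> 'z list \<times> nat) list \<Rightarrow> bool \<times> 'z list \<times> nat \<times> nat" where
  "out' os = (let i = first_true (map fst os) in
     (i < J \<and> fst (snd (os ! i)),
      concat (map (\<lambda>(bc, ba, z, t). z) os), to_nat (map (\<lambda>(bc, ba, z, t). t) os), i))"

lemma bit_law_out: "bit_law P (J * L) syndromes reply alice_bit bob_bit = map_pmf out (replicate_pmf J AL)"
proof -
  define ob where "ob w = (c (Xs w) (s (Ys w)), a (Xs w) (s (Ys w)), b (Ys w), Zs w, s (Ys w))"
    for w :: "('x \<times> 'y \<times> 'z) list"
  have AL: "AL = map_pmf ob (replicate_pmf L P)" unfolding accept_law_def ob_def[abs_def] ..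
  have "map_pmf out (replicate_pmf J AL) =
      map_pmf (\<lambda>w. out (map ob (chunk L J w))) (replicate_pmf (J * L) P)"
    unfolding AL map_replicate_pmf[symmetric] chunk_replicate_pmf_exact[symmetric]
    by (simp add: pmf.map_comp comp_def)
  also have "\<dots> = bit_law P (J * L) syndromes reply alice_bit bob_bit"
    unfolding bit_law_def
  proof (rule map_pmf_cong[OF refl])
    fix w assume "w \<in> set_pmf (replicate_pmf (J * L) P)"
    then have len: "length w = J * L" by (rule length_replicate_pmf)
    have 1: "map fst (map ob (chunk L J w)) = map2 c (chunk L J (Xs w)) (map s (chunk L J (Ys w)))"
      by (simp add: ob_def chunk_map comp_def zip_map_map zip_same_conv_map)
    have 2: "concat (map (\<lambda>(bc, ba, bb, z, t). z) (map ob (chunk L J w))) = Zs w"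
      using concat_chunk[of L J "Zs w"] len by (simp add: ob_def chunk_map comp_def)
    have 3: "map (\<lambda>(bc, ba, bb, z, t). t) (map ob (chunk L J w)) = map s (chunk L J (Ys w))"
      by (simp add: ob_def chunk_map comp_def)
    have 4: "fst (snd (ob (chunk L J w ! i))) = a (chunk L J (Xs w) ! i) (s (chunk L J (Ys w) ! i))"
      "fst (snd (snd (ob (chunk L J w ! i)))) = b (chunk L J (Ys w) ! i)" if "i < J" for i
      using that by (simp_all add: ob_def chunk_map)
    show "out (map ob (chunk L J w)) = (alice_bit (Xs w) (syndromes (Ys w)), bob_bit (Ys w) (reply (Xs w) (syndromes (Ys w))),
       Zs w, syndromes (Ys w), reply (Xs w) (syndromes (Ys w)))"
      unfolding out_def Let_def 1 2 3 by (auto simp: syndromes_def reply_def alice_bit_def bob_bit_def 4)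
  qed
  finally show ?thesis by simp
qed

lemma length_z: "(bc, ba, bb, z, t) \<in> set_pmf AL \<Longrightarrow> length z = L"
  by (auto simp: accept_law_def dest: length_replicate_pmf)

lemma good_reply_out:
  assumes "length os = J" "\<And>bc ba z t. (bc, ba, z, t) \<in> set os \<Longrightarrow> length z = L"
  shows "good_reply (snd (out' os)) \<longleftrightarrow> (let i = first_true (map fst os) in i < J \<and> good (snd (snd (os ! i))))"
proof -
  have "chunk L J (concat (map (\<lambda>(bc, ba, z, t). z) os)) = map (\<lambda>(bc, ba, z, t). z) os"
    using assms by (intro chunk_concat) auto
  then show ?thesis using assms(1)
    by (auto simp: good_reply_def out'_def Let_def case_prod_unfold)
qed

lemma bit_scheme: "bit_scheme P (J * L) syndromes reply alice_bit bob_bit good_reply"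
proof
  let ?drop = "\<lambda>(bc, ba, bb, v). (bc, ba, v)"
  let ?AC = "map_pmf ?drop AL"
  show "J * L > 0" using J_pos L_pos by simp
  have out': "(\<lambda>(ba, bb, v). (ba, v)) (out os) = out' (map ?drop os)" if "length os = J" for os
    using that by (auto simp: out_def out'_def Let_def case_prod_unfold comp_def)
  have len: "length os = J \<and> (\<forall>(bc, ba, z, t) \<in> set os. length z = L)"
    if "os \<in> set_pmf (replicate_pmf J ?AC)" for os
    using that by (auto simp: set_replicate_pmf dest!: length_z)
  have supp: "map ?drop os \<in> set_pmf (replicate_pmf J ?AC)" if "os \<in> set_pmf (replicate_pmf J AL)" for os
    unfolding map_replicate_pmf[symmetric] using that by auto
  have gg_iff: "good_reply (snd (snd (out os))) \<longleftrightarrow>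
      (let i = first_true (map fst os) in i < J \<and> good (snd (snd (snd (os ! i)))))"
    if "os \<in> set_pmf (replicate_pmf J AL)" for os
  proof -
    have l: "length os = J" using that by (rule length_replicate_pmf)
    have "snd (snd (out os)) = snd (out' (map ?drop os))"
      using out'[OF l] by (auto simp: case_prod_unfold prod_eq_iff)
    also have "good_reply (snd (out' (map ?drop os))) \<longleftrightarrow>
        (let i = first_true (map fst (map ?drop os)) in i < J \<and> good (snd (snd (map ?drop os ! i))))"
      using len[OF supp[OF that]] by (intro good_reply_out) auto
    also have "map fst (map ?drop os) = map fst os" by auto
    finally show ?thesis using l by (auto simp: Let_def case_prod_unfold)
  qed
  show "ba = bb" if "(ba, bb, v) \<in> set_pmf (bit_law P (J * L) syndromes reply alice_bit bob_bit)" "good_reply v" for ba bb v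
  proof -
    from that obtain os where os: "os \<in> set_pmf (replicate_pmf J AL)" "(ba, bb, v) = out os"
      unfolding bit_law_out by auto
    define i where "i = first_true (map fst os)"
    have l: "length os = J" using os(1) by (rule length_replicate_pmf)
    have i: "i < J" "good (snd (snd (snd (os ! i))))"
      using gg_iff[OF os(1)] os(2)[symmetric] that(2) by (auto simp: Let_def i_def)
    have "fst (os ! i)"
      using first_true_nth[of "map fst os"] i l by (simp add: i_def)
    moreover have "os ! i \<in> set_pmf AL"
      using os(1) i l by (auto simp: set_replicate_pmf)
    ultimately have "fst (snd (os ! i)) = fst (snd (snd (os ! i)))"
      using agree i(2) by (metis prod.collapse)
    then show ?thesis using os(2) i by (simp add: out_def Let_def i_def)
  qed
  have AV: "map_pmf (\<lambda>(ba, bb, v). (ba, v)) (bit_law P (J * L) syndromes reply alice_bit bob_bit) =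
      map_pmf out' (replicate_pmf J ?AC)"
    unfolding bit_law_out map_replicate_pmf[symmetric] pmf.map_comp
    by (rule map_pmf_cong) (auto simp del: case_prod_conv simp: out' dest: length_replicate_pmf)
  \<comment> \<open>Flipping every accepted good block leaves acceptance and Eve's view unchanged,
    and of the flipped bits only the one in the selected block reaches the output. The invariance of
    single blocks thus carries over to the series.\<close>
  have "flip_bit good_reply (out' os) = out' (map (flip_accepted good) os)"
    if "os \<in> set_pmf (replicate_pmf J ?AC)" for os
  proof -
    let ?i = "first_true (map fst os)"
    have l: "length os = J" using len[OF that] by simp
    have g: "good_reply (snd (out' os)) \<longleftrightarrow> ?i < J \<and> good (snd (snd (os ! ?i)))"
    proof -
      have "good_reply (snd (out' os)) \<longleftrightarrow>
          (let i = first_true (map fst os) in i < J \<and> good (snd (snd (os ! i))))"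
        by (rule good_reply_out) (use len[OF that] in auto)
      then show ?thesis by (simp only: Let_def)
    qed
    have m: "map fst (map (flip_accepted good) os) = map fst os"
      "map (\<lambda>(bc, ba, z, t). z) (map (flip_accepted good) os) = map (\<lambda>(bc, ba, z, t). z) os"
      "map (\<lambda>(bc, ba, z, t). t) (map (flip_accepted good) os) = map (\<lambda>(bc, ba, z, t). t) os"
      by (auto simp: flip_accepted_def)
    have f: "fst (snd (map (flip_accepted good) os ! ?i)) =
        (if good (snd (snd (os ! ?i))) then \<not> fst (snd (os ! ?i)) else fst (snd (os ! ?i)))" if "?i < J"
      using that l first_true_nth[of "map fst os"] by (auto simp: flip_accepted_def case_prod_unfold)
    show ?thesis
    proof (cases "?i < J")
      case True
      then show ?thesis
        using f g unfolding out'_def[of "map (flip_accepted good) os"] m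
        by (auto simp: flip_bit_def out'_def Let_def)
    next
      case False
      then show ?thesis
        using g unfolding out'_def[of "map (flip_accepted good) os"] m
        by (auto simp: flip_bit_def out'_def Let_def)
    qed
  qed
  then have "map_pmf (flip_bit good_reply) (map_pmf out' (replicate_pmf J ?AC)) =
      map_pmf out' (map_pmf (map (flip_accepted good)) (replicate_pmf J ?AC))"
    unfolding pmf.map_comp by (intro map_pmf_cong refl) simp
  also have "map_pmf (map (flip_accepted good)) (replicate_pmf J ?AC) = replicate_pmf J ?AC"
    by (simp only: map_replicate_pmf flip)
  finally show "map_pmf (flip_bit good_reply) (map_pmf (\<lambda>(ba, bb, v). (ba, v)) (bit_law P (J * L) syndromes reply alice_bit bob_bit)) =
      map_pmf (\<lambda>(ba, bb, v). (ba, v)) (bit_law P (J * L) syndromes reply alice_bit bob_bit)"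
    by (simp only: AV)
  have miss: "miss os \<longleftrightarrow> \<not> (let i = first_true (map fst os) in i < length os \<and> good (snd (snd (snd (os ! i)))))" for os
    by (induction os) (auto simp: Let_def)
  have "measure_pmf.prob (bit_law P (J * L) syndromes reply alice_bit bob_bit) {(ba, bb, v). \<not> good_reply v} =
      measure_pmf.prob (replicate_pmf J AL) {os. \<not> good_reply (snd (snd (out os)))}"
    unfolding bit_law_out measure_map_pmf by (simp add: vimage_def case_prod_unfold)
  also have "\<dots> = measure_pmf.prob (replicate_pmf J AL) {os. miss os}"
    by (intro measure_pmf.finite_measure_eq_AE)
       (auto simp: AE_measure_pmf_iff gg_iff miss dest: length_replicate_pmf)
  also have "\<dots> \<le> (1 / 2) ^ 2001 + (1 - g) ^ J" by (rule prob_miss)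
  also have "\<dots> \<le> (1 / 2) ^ 2001 + (1 / 2) ^ 2001" using power_J_le by simp
  also have "\<dots> = (1 / 2) ^ 2000"
    using power_Suc[of "1 / 2 :: real" 2000] by simp
  finally show "measure_pmf.prob (bit_law P (J * L) syndromes reply alice_bit bob_bit) {(ba, bb, v). \<not> good_reply v} \<le> (1 / 2) ^ 2000" .
qed

lemma secret_key_rate_pos: "secret_key_rate P > 0"
  by (rule bit_scheme.secret_key_rate_pos[OF bit_scheme])

end

section \<open>Sources with additive noise modulo three\<close>

lemma mod3_cases: "x = 0 \<or> x = 1 \<or> x = (2 :: 3)"
  using UNIV_mod3 by auto

definition noisy_triple :: "3 \<times> 3 \<Rightarrow> 3 \<times> 3 \<times> (3 \<times> 3) option" where
  "noisy_triple = (\<lambda>(y, e). (y + e, y, if e = 0 then None else Some (y + e, y)))"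

definition noisy_source :: "3 pmf \<Rightarrow> (3 \<times> 3 \<times> (3 \<times> 3) option) pmf" where
  "noisy_source \<nu> = map_pmf noisy_triple (pair_pmf (pmf_of_set UNIV) \<nu>)"

lemma replicate_pmf_of_set_UNIV:
  "replicate_pmf n (pmf_of_set (UNIV :: 'a::finite set)) = pmf_of_set {ys. length ys = n}"
proof (rule pmf_eqI)
  fix xs :: "'a list"
  have fin: "finite {ys :: 'a list. length ys = n}" and card: "card {ys :: 'a list. length ys = n} = CARD('a) ^ n"
    using finite_lists_length_eq[of "UNIV :: 'a set" n] card_lists_length_eq[of "UNIV :: 'a set" n] by simp_all
  have ne: "{ys :: 'a list. length ys = n} \<noteq> {}" using Ex_list_of_length[of n] by auto
  show "pmf (replicate_pmf n (pmf_of_set (UNIV :: 'a set))) xs = pmf (pmf_of_set {ys. length ys = n}) xs"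
  proof (cases "length xs = n")
    case True
    then have "pmf (replicate_pmf n (pmf_of_set (UNIV :: 'a set))) xs = (1 / CARD('a)) ^ n"
      by (simp add: pmf_replicate_pmf_nth)
    then show ?thesis using True by (simp add: pmf_of_set[OF ne fin] card power_one_over)
  next
    case False
    then have "xs \<notin> set_pmf (replicate_pmf n (pmf_of_set (UNIV :: 'a set)))"
      by (auto dest: length_replicate_pmf)
    then show ?thesis using False by (simp add: pmf_of_set[OF ne fin] set_pmf_iff)
  qed
qed

text \<open>
  A block consists of \<open>R\<close> groups of \<open>k\<close> runs of \<open>m\<close> letters. A word is admissible if it is
  constant on runs and the sums \<open>S\<^sub>j\<close> of the run letters in the \<open>j\<close>-th group satisfy
  \<open>S\<^sub>j = (- 1)\<^sup>j S\<^sub>0\<close>. Bob publishes the coset of his word modulo the admissible words, and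
  the letter \<open>S\<^sub>0\<close> remains secret. Alice accepts if her word, with all \<open>S\<^sub>j\<close> lowered by one, lies in
  the same coset. The shift by one makes a single erased run per group the typical reason for
  acceptance, and an erased run hides \<open>S\<^sub>0\<close> from Eve.
\<close>

locale group_code =
  fixes R k m :: nat
  assumes R_pos: "R > 0" and k_pos: "k > 0" and m_pos: "m > 0"
begin

abbreviation L where "L \<equiv> R * k * m"

definition pos :: "nat \<Rightarrow> nat \<Rightarrow> nat \<Rightarrow> nat" where
  "pos j i l = (j * k + i) * m + l"

definition sg :: "nat \<Rightarrow> 3" where
  "sg j = (if even j then 1 else - 1)"

definition gsum :: "3 list \<Rightarrow> nat \<Rightarrow> 3" where
  "gsum v j = (\<Sum>i<k. v ! pos j i 0)"

definition steps :: "3 list \<Rightarrow> 3 list list list" where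
  "steps v = map (\<lambda>j. map (\<lambda>i. map (\<lambda>l. v ! pos j i l - v ! pos j i 0) [0..<m]) [0..<k]) [0..<R]"

text \<open>\<open>\<delta>\<close> is the amount by which all group sums are lowered: 0 for Bob's
  word and 1 for Alice's.\<close>

definition altsums :: "3 \<Rightarrow> 3 list \<Rightarrow> 3 list" where
  "altsums \<delta> v = map (\<lambda>j. (gsum v j - \<delta>) - sg j * (gsum v 0 - \<delta>)) [0..<R]"

text \<open>The last component announces whether the secret letter is 2. Alice accepts only
  \<open>False\<close>, which reduces the ternary letter to a bit.\<close>

definition bob_coset :: "3 list \<Rightarrow> nat" where
  "bob_coset y = to_nat (steps y, altsums 0 y, gsum y 0 = 2)"

definition accepts :: "3 list \<Rightarrow> nat \<Rightarrow> bool" where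
  "accepts x \<sigma> \<longleftrightarrow> (steps x, altsums 1 x, False) = from_nat \<sigma>"

definition alice_letter :: "3 list \<Rightarrow> nat \<Rightarrow> bool" where
  "alice_letter x \<sigma> \<longleftrightarrow> gsum x 0 - 1 = 1"

definition bob_letter :: "3 list \<Rightarrow> bool" where
  "bob_letter y \<longleftrightarrow> gsum y 0 = 1"

definition noise :: "(3 \<times> 3) option \<Rightarrow> 3" where
  "noise z = (case z of None \<Rightarrow> 0 | Some (x, y) \<Rightarrow> x - y)"

definition const_runs :: "3 list \<Rightarrow> bool" where
  "const_runs e \<longleftrightarrow> (\<forall>j<R. \<forall>i<k. \<forall>l<m. e ! pos j i l = e ! pos j i 0)"

definition accepted_noise :: "3 list \<Rightarrow> bool" where
  "accepted_noise e \<longleftrightarrow> const_runs e \<and> (\<forall>j<R. gsum e j - 1 = sg j * (gsum e 0 - 1))"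

text \<open>A sum of 1 does not by itself hide the letter, since it can also arise from letters 1
  and 2 alone; hence the separate demand for an erased run.\<close>

definition good_noise :: "3 list \<Rightarrow> bool" where
  "good_noise e \<longleftrightarrow> const_runs e \<and> (\<forall>j<R. gsum e j = 1 \<and> (\<exists>i<k. e ! pos j i 0 = 0))"

definition good_view :: "(3 \<times> 3) option list \<times> nat \<Rightarrow> bool" where
  "good_view = (\<lambda>(z, \<sigma>). good_noise (map noise z))"

lemma pos_less:
  assumes "j < R" "i < k" "l < m"
  shows "pos j i l < L"
proof -
  have "Suc (j * k + i) \<le> Suc j * k" using assms by simp
  also have "\<dots> \<le> R * k" using assms by (intro mult_right_mono) auto
  finally have "Suc (j * k + i) * m \<le> L" by (rule mult_right_mono) simp
  then show ?thesis using assms by (simp add: pos_def)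
qed

lemma pos_div: "l < m \<Longrightarrow> pos j i l div m = j * k + i"
  by (simp add: pos_def)

lemma sg_0 [simp]: "sg 0 = 1"
  by (simp add: sg_def)

lemma gsum_add:
  assumes "length u = L" "length v = L" "j < R"
  shows "gsum (map2 (+) u v) j = gsum u j + gsum v j"
  using assms pos_less[of j _ 0] m_pos by (simp add: gsum_def sum.distrib)

lemma nth_add:
  assumes "length u = L" "length v = L" "j < R" "i < k" "l < m"
  shows "map2 (+) u v ! pos j i l = u ! pos j i l + v ! pos j i l"
  using assms pos_less[of j i l] by simp

lemma steps_eq_iff: "steps u = steps v \<longleftrightarrow>
    (\<forall>j<R. \<forall>i<k. \<forall>l<m. u ! pos j i l - u ! pos j i 0 = v ! pos j i l - v ! pos j i 0)"
  by (auto simp: steps_def)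

lemma altsums_eq_iff: "altsums \<delta> u = altsums \<epsilon> v \<longleftrightarrow>
    (\<forall>j<R. (gsum u j - \<delta>) - sg j * (gsum u 0 - \<delta>) = (gsum v j - \<epsilon>) - sg j * (gsum v 0 - \<epsilon>))"
  by (auto simp: altsums_def)

text \<open>Steps and alternating sums are linear, so Bob's word cancels and, apart from the
  announced flag, acceptance depends on the noise alone.\<close>

lemma accepts_iff:
  assumes y: "length y = L" and e: "length e = L"
  shows "accepts (map2 (+) y e) (bob_coset y) \<longleftrightarrow> gsum y 0 \<noteq> 2 \<and> accepted_noise e"
proof -
  have "steps (map2 (+) y e) = steps y \<longleftrightarrow> const_runs e"
    unfolding steps_eq_iff const_runs_def
    by (simp add: nth_add[OF y e] m_pos)
  moreover have "altsums 1 (map2 (+) y e) = altsums 0 y \<longleftrightarrow> (\<forall>j<R. gsum e j - 1 = sg j * (gsum e 0 - 1))"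
    unfolding altsums_eq_iff
    by (simp add: gsum_add[OF y e] R_pos) (auto simp: algebra_simps)
  ultimately show ?thesis by (auto simp: accepts_def bob_coset_def accepted_noise_def)
qed

section \<open>A shift of Bob's word that Eve cannot see\<close>

definition erased_run :: "3 list \<Rightarrow> nat \<Rightarrow> nat" where
  "erased_run e j = (SOME i. i < k \<and> e ! pos j i 0 = 0)"

text \<open>For good noise this is an admissible word with \<open>S\<^sub>0 = 1\<close> supported on
  one erased run per group. The divisions recover group and run from the position
  \<open>(j * k + i) * m + l\<close>.\<close>

definition hidden_word :: "3 list \<Rightarrow> 3 list" where
  "hidden_word e = map (\<lambda>t. if (t div m) mod k = erased_run e ((t div m) div k)
     then sg ((t div m) div k) else 0) [0..<L]"

lemma length_hidden_word [simp]: "length (hidden_word e) = L"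
  by (simp add: hidden_word_def)

lemma hidden_word_nth:
  assumes "j < R" "i < k" "l < m"
  shows "hidden_word e ! pos j i l = (if i = erased_run e j then sg j else 0)"
proof -
  let ?t = "pos j i l"
  have "hidden_word e ! ?t = (if (?t div m) mod k = erased_run e ((?t div m) div k)
      then sg ((?t div m) div k) else 0)"
    unfolding hidden_word_def using pos_less[OF assms] by (subst nth_map) simp_all
  also have "\<dots> = (if i = erased_run e j then sg j else 0)"
    unfolding pos_div[OF assms(3)] using assms(2) by simp
  finally show ?thesis .
qed

lemma erased_run:
  assumes "good_noise e" "j < R"
  shows "erased_run e j < k" "e ! pos j (erased_run e j) 0 = 0"
proof -
  have "\<exists>i. i < k \<and> e ! pos j i 0 = 0" using assms by (auto simp: good_noise_def)
  then have "erased_run e j < k \<and> e ! pos j (erased_run e j) 0 = 0"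
    unfolding erased_run_def by (rule someI_ex)
  then show "erased_run e j < k" "e ! pos j (erased_run e j) 0 = 0" by auto
qed

lemma gsum_hidden_word:
  assumes "good_noise e" "j < R"
  shows "gsum (hidden_word e) j = sg j"
  using assms erased_run[OF assms] m_pos by (simp add: gsum_def hidden_word_nth)

text \<open>Good noise is constant on runs, so a run that starts with 0 is erased entirely. Eve sees
  Bob's letters only where the noise is nonzero and so never sees the shift.\<close>

lemma hidden_word_support:
  assumes "good_noise e" "t < L" "e ! t \<noteq> 0"
  shows "hidden_word e ! t = 0"
proof (rule ccontr)
  let ?j = "(t div m) div k" and ?i = "(t div m) mod k" and ?l = "t mod m"
  assume h: "hidden_word e ! t \<noteq> 0"
  have t: "t = pos ?j ?i ?l" by (simp add: pos_def)
  have j: "?j < R" using assms(2) k_pos m_pos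
    by (simp add: div_less_iff_less_mult mult.assoc mult.commute[of k m] div_mult2_eq[symmetric])
  have i: "?i < k" and l: "?l < m" using k_pos m_pos by simp_all
  have "?i = erased_run e ?j"
    using h hidden_word_nth[OF j i l, of e] t by (metis)
  then have "e ! pos ?j ?i 0 = 0" using erased_run[OF assms(1) j] by simp
  moreover have "e ! pos ?j ?i ?l = e ! pos ?j ?i 0"
    using assms(1) j i l unfolding good_noise_def const_runs_def by blast
  ultimately have "e ! pos ?j ?i ?l = 0" by simp
  then show False using assms(3) t by simp
qed

text \<open>
  Shifting Bob's word by a word supported on erased runs exchanges the letters \<open>0\<close> and \<open>1\<close> and is
  invisible to Eve.
\<close>

definition swap_word :: "3 list \<Rightarrow> 3 list \<Rightarrow> 3 list" where
  "swap_word e y = (if good_noise e then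
     if gsum y 0 = 0 then map2 (+) y (hidden_word e)
     else if gsum y 0 = 1 then map2 (\<lambda>a b. a - b) y (hidden_word e) else y else y)"

lemma map2_uminus: "map2 (\<lambda>a b. a - b) u v = map2 (+) u (map uminus (v :: 3 list))"
  by (simp add: zip_map2 case_prod_unfold)

lemma gsum_uminus:
  assumes "length v = L" "j < R"
  shows "gsum (map uminus v) j = - gsum v j"
  using assms pos_less[of j _ 0] m_pos by (simp add: gsum_def sum_negf)

text \<open>Adding the hidden word and subtracting it are both additions of an admissible word
  \<open>h\<close>; later arguments then need no case split.\<close>

lemma swap_word_cases:
  assumes "good_noise e" "length y = L" "gsum y 0 \<noteq> 2"
  obtains h where "length h = L" "swap_word e y = map2 (+) y h" "const_runs h"
    "\<And>j. j < R \<Longrightarrow> gsum h j = sg j * gsum h 0" "gsum y 0 + gsum h 0 = 1 - gsum y 0"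
    "\<And>t. t < L \<Longrightarrow> e ! t \<noteq> 0 \<Longrightarrow> h ! t = 0"
proof -
  let ?h = "hidden_word e"
  have c: "const_runs ?h" using m_pos by (auto simp: const_runs_def hidden_word_nth)
  have c': "const_runs (map uminus ?h)"
    unfolding const_runs_def
  proof (intro allI impI)
    fix j i l assume ji: "j < R" "i < k" and l: "l < m"
    have "map uminus ?h ! pos j i l' = - ?h ! pos j i l'" if "l' < m" for l'
      using pos_less[OF ji that] by simp
    moreover have "?h ! pos j i l = ?h ! pos j i 0"
      using c ji l unfolding const_runs_def by blast
    ultimately show "map uminus ?h ! pos j i l = map uminus ?h ! pos j i 0"
      using l m_pos by presburger
  qed
  have g: "gsum ?h j = sg j" if "j < R" for j by (rule gsum_hidden_word[OF assms(1) that])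
  have g': "gsum (map uminus ?h) j = - sg j" if "j < R" for j
    using gsum_uminus[of ?h j] g[OF that] that by simp
  consider "gsum y 0 = 0" | "gsum y 0 = 1" using assms(3) mod3_cases by blast
  then show thesis
  proof cases
    case 1
    show thesis
      by (rule that[of ?h])
         (use assms 1 c g R_pos in \<open>auto simp: swap_word_def hidden_word_support\<close>)
  next
    case 2
    show thesis
      by (rule that[of "map uminus ?h"])
         (use assms 2 c' g' R_pos in \<open>auto simp: swap_word_def hidden_word_support map2_uminus\<close>)
  qed
qed

lemma length_swap_word: "length y = L \<Longrightarrow> length (swap_word e y) = L"
  by (simp add: swap_word_def)

lemma swap_word_id: "\<not> good_noise e \<or> gsum y 0 = 2 \<Longrightarrow> swap_word e y = y"
  by (auto simp: swap_word_def)

lemma gsum_swap_word: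
  assumes "good_noise e" "length y = L" "gsum y 0 \<noteq> 2"
  shows "gsum (swap_word e y) 0 = 1 - gsum y 0"
proof -
  from assms obtain h where "length h = L" "swap_word e y = map2 (+) y h"
    "gsum y 0 + gsum h 0 = 1 - gsum y 0"
    by (rule swap_word_cases)
  then show ?thesis using assms(2) R_pos by (simp add: gsum_add)
qed

lemma swap_word_invol:
  assumes "length y = L"
  shows "swap_word e (swap_word e y) = y"
proof (cases "good_noise e \<and> gsum y 0 \<noteq> 2")
  case True
  have plus_minus: "map2 (\<lambda>a b. a - b) (map2 (+) y (hidden_word e)) (hidden_word e) = y"
    "map2 (+) (map2 (\<lambda>a b. a - b) y (hidden_word e)) (hidden_word e) = y"
    using assms by (auto intro!: nth_equalityI)
  consider "gsum y 0 = 0" | "gsum y 0 = 1" using True mod3_cases by blast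
  then show ?thesis
  proof cases
    case 1
    then have "gsum (swap_word e y) 0 = 1" using gsum_swap_word[of e y] True assms by simp
    then show ?thesis using True 1 plus_minus by (simp add: swap_word_def)
  next
    case 2
    then have "gsum (swap_word e y) 0 = 0" using gsum_swap_word[of e y] True assms by simp
    then show ?thesis using True 2 plus_minus by (simp add: swap_word_def)
  qed
qed (simp add: swap_word_id)

lemma bob_coset_swap_word:
  assumes y: "length y = L"
  shows "bob_coset (swap_word e y) = bob_coset y"
proof (cases "good_noise e \<and> gsum y 0 \<noteq> 2")
  case True
  then obtain h where h: "length h = L" "swap_word e y = map2 (+) y h" "const_runs h"
    "\<And>j. j < R \<Longrightarrow> gsum h j = sg j * gsum h 0" "gsum y 0 + gsum h 0 = 1 - gsum y 0"
    using y swap_word_cases[of e y] by metis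
  have "steps (map2 (+) y h) = steps y"
    unfolding steps_eq_iff
  proof (intro allI impI)
    fix j i l assume jil: "j < R" "i < k" "l < m"
    moreover have "h ! pos j i l = h ! pos j i 0"
      using h(3) jil unfolding const_runs_def by blast
    ultimately show "map2 (+) y h ! pos j i l - map2 (+) y h ! pos j i 0 = y ! pos j i l - y ! pos j i 0"
      using nth_add[OF y h(1) jil] nth_add[OF y h(1) jil(1,2) m_pos] by simp
  qed
  moreover have "altsums 0 (map2 (+) y h) = altsums 0 y"
    unfolding altsums_eq_iff
  proof (intro allI impI)
    fix j assume j: "j < R"
    show "(gsum (map2 (+) y h) j - 0) - sg j * (gsum (map2 (+) y h) 0 - 0) =
        (gsum y j - 0) - sg j * (gsum y 0 - 0)"
      unfolding gsum_add[OF y h(1) j] gsum_add[OF y h(1) R_pos] h(4)[OF j]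
      by (simp add: algebra_simps)
  qed
  moreover have "gsum (map2 (+) y h) 0 \<noteq> 2"
    using gsum_swap_word[of e y] True y mod3_cases[of "gsum y 0"] unfolding h(2) by auto
  ultimately show ?thesis using True by (simp add: bob_coset_def h(2))
qed (simp add: swap_word_id)

lemma noisy_swap_word:
  assumes y: "length y = L" and e: "length e = L"
  shows "Zs (map noisy_triple (zip (swap_word e y) e)) = Zs (map noisy_triple (zip y e))"
proof (cases "good_noise e \<and> gsum y 0 \<noteq> 2")
  case True
  then obtain h where h: "length h = L" "swap_word e y = map2 (+) y h"
    "\<And>t. t < L \<Longrightarrow> e ! t \<noteq> 0 \<Longrightarrow> h ! t = 0"
    using y swap_word_cases[of e y] by metis
  show ?thesis
    unfolding h(2) using y e h(1) h(3)
    by (auto intro!: nth_equalityI simp: noisy_triple_def)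
qed (simp add: swap_word_id)

text \<open>For fixed noise the swap is an involution of the words of length \<open>L\<close>, hence
  preserves Bob's uniform law; the noise is independent and untouched.\<close>

lemma pair_swap_word:
  "map_pmf (\<lambda>(ys, es). (swap_word es ys, es)) (pair_pmf (replicate_pmf L (pmf_of_set UNIV)) N) =
    pair_pmf (replicate_pmf L (pmf_of_set UNIV)) N"
proof -
  let ?A = "{ys :: 3 list. length ys = L}"
  have "map_pmf (swap_word es) (pmf_of_set ?A) = pmf_of_set ?A" for es
  proof (rule map_pmf_of_set_bij_betw)
    show "bij_betw (swap_word es) ?A ?A"
      by (rule bij_betwI[where g = "swap_word es"])
         (auto simp: length_swap_word swap_word_invol)
    show "?A \<noteq> {}" using Ex_list_of_length[of L] by auto
    show "finite ?A" using finite_lists_length_eq[of "UNIV :: 3 set" L] by simp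
  qed
  then have *: "map_pmf (swap_word es) (replicate_pmf L (pmf_of_set UNIV)) = replicate_pmf L (pmf_of_set UNIV)" for es
    by (simp add: replicate_pmf_of_set_UNIV)
  have pair: "pair_pmf (replicate_pmf L (pmf_of_set UNIV)) N =
      N \<bind> (\<lambda>es. map_pmf (\<lambda>ys. (ys, es)) (replicate_pmf L (pmf_of_set (UNIV :: 3 set))))"
    unfolding pair_pmf_def map_pmf_def by (rule bind_commute_pmf)
  have "map_pmf (\<lambda>(ys, es). (swap_word es ys, es)) (pair_pmf (replicate_pmf L (pmf_of_set UNIV)) N) =
      N \<bind> (\<lambda>es. map_pmf (\<lambda>ys. (ys, es)) (map_pmf (swap_word es) (replicate_pmf L (pmf_of_set UNIV))))"
    unfolding pair by (simp add: map_bind_pmf pmf.map_comp comp_def)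
  then show ?thesis by (simp only: * pair)
qed

section \<open>The law of a block and its symmetry\<close>

definition block_out :: "3 list \<times> 3 list \<Rightarrow> bool \<times> bool \<times> bool \<times> (3 \<times> 3) option list \<times> nat" where
  "block_out = (\<lambda>(y, e). (gsum y 0 \<noteq> 2 \<and> accepted_noise e, gsum y 0 + gsum e 0 - 1 = 1, gsum y 0 = 1,
     Zs (map noisy_triple (zip y e)), bob_coset y))"

lemma accept_law_noisy:
  "accept_law (noisy_source \<nu>) L bob_coset accepts alice_letter bob_letter =
    map_pmf block_out (pair_pmf (replicate_pmf L (pmf_of_set UNIV)) (replicate_pmf L \<nu>))"
proof -
  have zip: "replicate_pmf L (pair_pmf (pmf_of_set UNIV) \<nu>) =
      map_pmf (\<lambda>(ys, es). zip ys es) (pair_pmf (replicate_pmf L (pmf_of_set UNIV)) (replicate_pmf L \<nu>))"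
    by (simp add: pair_replicate_pmf pmf.map_comp comp_def zip_map_fst_snd)
  show ?thesis
    unfolding accept_law_def noisy_source_def map_replicate_pmf[symmetric] zip pmf.map_comp
  proof (rule map_pmf_cong[OF refl])
    fix w assume "w \<in> set_pmf (pair_pmf (replicate_pmf L (pmf_of_set (UNIV :: 3 set))) (replicate_pmf L \<nu>))"
    then obtain y e where w: "w = (y, e)" "length y = L" "length e = L"
      by (auto dest: length_replicate_pmf)
    have x: "Xs (map noisy_triple (zip y e)) = map2 (+) y e"
      and y: "Ys (map noisy_triple (zip y e)) = y"
      using w by (auto simp: noisy_triple_def intro!: nth_equalityI)
    show "((\<lambda>w. (accepts (Xs w) (bob_coset (Ys w)), alice_letter (Xs w) (bob_coset (Ys w)), bob_letter (Ys w),
          Zs w, bob_coset (Ys w))) \<circ> (map noisy_triple \<circ> (\<lambda>(ys, es). zip ys es))) w = block_out w"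
      unfolding w(1) comp_def prod.case x y
      using w R_pos by (simp add: accepts_iff block_out_def alice_letter_def bob_letter_def gsum_add)
  qed
qed

lemma noise_noisy: "length y = length e \<Longrightarrow> map noise (Zs (map noisy_triple (zip y e))) = e"
  by (rule nth_equalityI) (auto simp: noise_def noisy_triple_def)

lemma good_noise_gsum: "good_noise e \<Longrightarrow> gsum e 0 = 1" and good_accepted: "good_noise e \<Longrightarrow> accepted_noise e"
  using R_pos by (auto simp: good_noise_def accepted_noise_def)

lemma accept_scheme:
  assumes pos: "0 < measure_pmf.prob (replicate_pmf L \<nu>) {e. good_noise e}"
    and bad: "measure_pmf.prob (replicate_pmf L \<nu>) {e. accepted_noise e \<and> \<not> good_noise e} \<le>
      (1 / 2) ^ 2001 * measure_pmf.prob (replicate_pmf L \<nu>) {e. good_noise e}"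
  shows "accept_scheme (noisy_source \<nu>) L bob_coset accepts alice_letter bob_letter good_view"
proof -
  let ?U = "replicate_pmf L (pmf_of_set (UNIV :: 3 set))" and ?N = "replicate_pmf L \<nu>"
  let ?AL = "accept_law (noisy_source \<nu>) L bob_coset accepts alice_letter bob_letter"
  let ?drop = "\<lambda>(bc, ba, bb, v). (bc, ba, v)"
  have supp: "length (fst w) = L \<and> length (snd w) = L" if "w \<in> set_pmf (pair_pmf ?U ?N)" for w
    using that by (auto dest: length_replicate_pmf)
  have view: "good_view (snd (snd (snd (block_out (y, e))))) \<longleftrightarrow> good_noise e"
    if "length y = L" "length e = L" for y e
    using that by (simp add: block_out_def good_view_def noise_noisy del: map_map)
  \<comment> \<open>The probability that Bob's letter is not 2 is independent of the noise and
    multiplies both sides of the required inequality.\<close>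
  define u where "u = measure_pmf.prob ?U {y. gsum y 0 \<noteq> 2}"
  have u_pos: "u > 0"
  proof -
    have "gsum (replicate L 0) 0 = 0"
      using pos_less[OF R_pos _ m_pos] m_pos pos_less[of 0 _ 0] R_pos by (simp add: gsum_def)
    then have "replicate L 0 \<in> {y. gsum y 0 \<noteq> 2}" by simp
    moreover have "replicate L 0 \<in> set_pmf ?U" by (simp add: set_replicate_pmf)
    ultimately show ?thesis unfolding u_def by (intro measure_pmf_posI) auto
  qed
  have prob: "measure_pmf.prob ?AL {(bc, ba, bb, v). bc \<and> good_view v = g} =
      u * measure_pmf.prob ?N {e. accepted_noise e \<and> good_noise e = g}" for g
  proof -
    have "measure_pmf.prob ?AL {(bc, ba, bb, v). bc \<and> good_view v = g} =
        measure_pmf.prob (pair_pmf ?U ?N) ({y. gsum y 0 \<noteq> 2} \<times> {e. accepted_noise e \<and> good_noise e = g})"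
      unfolding accept_law_noisy measure_map_pmf
    proof (rule measure_pmf.finite_measure_eq_AE)
      show "AE w in pair_pmf ?U ?N. w \<in> block_out -` {(bc, ba, bb, v). bc \<and> good_view v = g} \<longleftrightarrow>
          w \<in> {y. gsum y 0 \<noteq> 2} \<times> {e. accepted_noise e \<and> good_noise e = g}"
        unfolding AE_measure_pmf_iff
      proof
        fix w assume "w \<in> set_pmf (pair_pmf ?U ?N)"
        then have "length (fst w) = L" "length (snd w) = L" using supp by auto
        then show "w \<in> block_out -` {(bc, ba, bb, v). bc \<and> good_view v = g} \<longleftrightarrow>
          w \<in> {y. gsum y 0 \<noteq> 2} \<times> {e. accepted_noise e \<and> good_noise e = g}"
          using view[of "fst w" "snd w"] by (auto simp: block_out_def case_prod_unfold mem_Times_iff)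
      qed
    qed simp_all
    also have "\<dots> = u * measure_pmf.prob ?N {e. accepted_noise e \<and> good_noise e = g}"
      unfolding prob_pair_pmf_Times u_def ..
    finally show ?thesis .
  qed
  have good: "{e. accepted_noise e \<and> good_noise e = True} = {e. good_noise e}"
    using good_accepted by auto
  show ?thesis
  proof
    show "L > 0" using R_pos k_pos m_pos by simp
    show "ba = bb" if "(True, ba, bb, v) \<in> set_pmf ?AL" "good_view v" for ba bb v
    proof -
      from that obtain y e where ye: "(True, ba, bb, v) = block_out (y, e)" "length y = L" "length e = L"
        unfolding accept_law_noisy using supp by auto
      then have "good_noise e" using view[of y e] that(2) by (metis snd_conv)
      then show ?thesis using ye by (auto simp: block_out_def good_noise_gsum)
    qed
    \<comment> \<open>Under good noise Alice's bit equals Bob's and the swap exchanges 0 and 1. If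
      the letter is 2 or the noise is not good, both maps are the identity on this block.\<close>
    have flip_out: "flip_accepted good_view (?drop (block_out (y, e))) = ?drop (block_out (swap_word e y, e))"
      if "length y = L" "length e = L" for y e
    proof -
      have g: "good_view (Zs (map noisy_triple (zip y e)), bob_coset y) \<longleftrightarrow> good_noise e"
        using view[OF that] by (simp add: block_out_def)
      show ?thesis
      proof (cases "good_noise e \<and> gsum y 0 \<noteq> 2")
        case True
        have s: "gsum (swap_word e y) 0 = 1 - gsum y 0"
          using True that by (intro gsum_swap_word) auto
        consider "gsum y 0 = 0" | "gsum y 0 = 1" using True mod3_cases by blast
        then show ?thesis
          using True g s that
          by cases (auto simp: flip_accepted_def block_out_def bob_coset_swap_word noisy_swap_word
            good_accepted good_noise_gsum simp del: map_map)
      next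
        case False
        then show ?thesis using g
          by (auto simp: flip_accepted_def block_out_def swap_word_id)
      qed
    qed
    have "map_pmf (flip_accepted good_view) (map_pmf ?drop ?AL) =
        map_pmf (\<lambda>w. ?drop (block_out w)) (map_pmf (\<lambda>(y, e). (swap_word e y, e)) (pair_pmf ?U ?N))"
      unfolding accept_law_noisy pmf.map_comp
    proof (rule map_pmf_cong[OF refl])
      fix w assume "w \<in> set_pmf (pair_pmf ?U ?N)"
      then obtain y e where "w = (y, e)" "length y = L" "length e = L"
        using supp[of w] by (cases w) auto
      then show "(flip_accepted good_view \<circ> (?drop \<circ> block_out)) w =
          ((\<lambda>w. ?drop (block_out w)) \<circ> (\<lambda>(y, e). (swap_word e y, e))) w"
        using flip_out[of y e] by (simp only: comp_def prod.case)
    qed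
    then show "map_pmf (flip_accepted good_view) (map_pmf ?drop ?AL) = map_pmf ?drop ?AL"
      unfolding pair_swap_word accept_law_noisy pmf.map_comp by (simp add: comp_def)
    show "0 < measure_pmf.prob ?AL {(bc, ba, bb, v). bc \<and> good_view v}"
      using prob[of True] pos u_pos unfolding good by simp
    show "measure_pmf.prob ?AL {(bc, ba, bb, v). bc \<and> \<not> good_view v} \<le>
        (1 / 2) ^ 2001 * measure_pmf.prob ?AL {(bc, ba, bb, v). bc \<and> good_view v}"
      using prob[of True] prob[of False] mult_left_mono[OF bad, of u] u_pos unfolding good
      by (simp add: mult.left_commute)
  qed
qed

end

subsection \<open>The number of erased runs in a group\<close>

text \<open>The \<open>k\<close>-fold convolution of \<open>W\<close> on the integers modulo
  three.\<close>

primrec conv_weight :: "(3 \<Rightarrow> real) \<Rightarrow> nat \<Rightarrow> 3 \<Rightarrow> real" where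
  "conv_weight W 0 \<sigma> = (if \<sigma> = 0 then 1 else 0)"
| "conv_weight W (Suc k) \<sigma> = W 0 * conv_weight W k \<sigma> + W 1 * conv_weight W k (\<sigma> - 1) +
     W 2 * conv_weight W k (\<sigma> - 2)"

text \<open>
  Normalized by the dominant letter \<open>2 = - 1\<close> and with the sum shifted by the number of letters,
  so that an erased run counts as a step \<open>1\<close> of small weight \<open>\<epsilon>\<close>, and a letter \<open>1\<close> as a
  step \<open>- 1\<close> of even smaller weight \<open>\<eta>\<close>.
\<close>

primrec walk :: "real \<Rightarrow> real \<Rightarrow> nat \<Rightarrow> 3 \<Rightarrow> real" where
  "walk \<epsilon> \<eta> 0 v = (if v = 0 then 1 else 0)"
| "walk \<epsilon> \<eta> (Suc k) v = walk \<epsilon> \<eta> k v + \<epsilon> * walk \<epsilon> \<eta> k (v - 1) + \<eta> * walk \<epsilon> \<eta> k (v + 1)"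

lemma conv_weight_walk:
  assumes "W 2 \<noteq> 0"
  shows "conv_weight W k \<sigma> = W 2 ^ k * walk (W 0 / W 2) (W 1 / W 2) k (\<sigma> + of_nat k)"
proof (induction k arbitrary: \<sigma>)
  case (Suc k)
  define v where "v = \<sigma> + of_nat k"
  have "(- 1 :: 3) = 2" "(- 2 :: 3) = 1" by simp_all
  then have eqs: "\<sigma> - 1 + of_nat k = v + 2" "\<sigma> - 2 + of_nat k = v + 1"
    unfolding v_def by (metis add.assoc add.commute diff_conv_add_uminus)+
  have "\<sigma> + of_nat (Suc k) = v + 1" "v + 1 - 1 = v" "v + 1 + 1 = v + 2"
    by (simp_all add: v_def)
  then show ?case
    using assms unfolding conv_weight.simps Suc.IH eqs
    by (simp only: walk.simps v_def[symmetric]) (simp add: field_simps)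
qed simp

lemma walk_Suc:
  "walk \<epsilon> \<eta> (Suc k) 0 = walk \<epsilon> \<eta> k 0 + \<epsilon> * walk \<epsilon> \<eta> k 2 + \<eta> * walk \<epsilon> \<eta> k 1"
  "walk \<epsilon> \<eta> (Suc k) 1 = walk \<epsilon> \<eta> k 1 + \<epsilon> * walk \<epsilon> \<eta> k 0 + \<eta> * walk \<epsilon> \<eta> k 2"
  "walk \<epsilon> \<eta> (Suc k) 2 = walk \<epsilon> \<eta> k 2 + \<epsilon> * walk \<epsilon> \<eta> k 1 + \<eta> * walk \<epsilon> \<eta> k 0"
proof -
  have "(0 - 1 :: 3) = 2" "(0 + 1 :: 3) = 1" "(1 - 1 :: 3) = 0" "(1 + 1 :: 3) = 2"
    "(2 - 1 :: 3) = 1" "(2 + 1 :: 3) = 0" by simp_all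
  then show "walk \<epsilon> \<eta> (Suc k) 0 = walk \<epsilon> \<eta> k 0 + \<epsilon> * walk \<epsilon> \<eta> k 2 + \<eta> * walk \<epsilon> \<eta> k 1"
    "walk \<epsilon> \<eta> (Suc k) 1 = walk \<epsilon> \<eta> k 1 + \<epsilon> * walk \<epsilon> \<eta> k 0 + \<eta> * walk \<epsilon> \<eta> k 2"
    "walk \<epsilon> \<eta> (Suc k) 2 = walk \<epsilon> \<eta> k 2 + \<epsilon> * walk \<epsilon> \<eta> k 1 + \<eta> * walk \<epsilon> \<eta> k 0"
    by (simp_all only: walk.simps)
qed

context
  fixes \<epsilon> \<eta> :: real
  assumes nonneg: "0 \<le> \<epsilon>" "0 \<le> \<eta>"
begin

lemma walk_nonneg: "0 \<le> walk \<epsilon> \<eta> k v"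
  by (induction k arbitrary: v) (auto simp: nonneg)

lemma walk_sum: "walk \<epsilon> \<eta> k 0 + walk \<epsilon> \<eta> k 1 + walk \<epsilon> \<eta> k 2 = (1 + \<epsilon> + \<eta>) ^ k"
proof (induction k)
  case (Suc k)
  have "walk \<epsilon> \<eta> (Suc k) 0 + walk \<epsilon> \<eta> (Suc k) 1 + walk \<epsilon> \<eta> (Suc k) 2 =
      (1 + \<epsilon> + \<eta>) * (walk \<epsilon> \<eta> k 0 + walk \<epsilon> \<eta> k 1 + walk \<epsilon> \<eta> k 2)"
    unfolding walk_Suc by (simp add: algebra_simps)
  then show ?case by (simp add: Suc.IH)
qed simp

lemma walk_le: "walk \<epsilon> \<eta> k 0 \<le> (1 + \<epsilon> + \<eta>) ^ k" "walk \<epsilon> \<eta> k 1 \<le> (1 + \<epsilon> + \<eta>) ^ k"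
    "walk \<epsilon> \<eta> k 2 \<le> (1 + \<epsilon> + \<eta>) ^ k"
  using walk_sum[of k] walk_nonneg[of k 0] walk_nonneg[of k 1] walk_nonneg[of k 2] by linarith+

lemma total_mono: "(1 + \<epsilon> + \<eta>) ^ k \<le> (1 + \<epsilon> + \<eta>) ^ Suc k"
  using nonneg by (intro power_increasing) auto

lemma walk_0_ge: "1 \<le> walk \<epsilon> \<eta> k 0"
proof (induction k)
  case (Suc k)
  have "0 \<le> \<epsilon> * walk \<epsilon> \<eta> k (0 - 1) + \<eta> * walk \<epsilon> \<eta> k (0 + 1)"
    using nonneg walk_nonneg by simp
  then show ?case using Suc by simp
qed simp

lemma walk_1_ge: "real k * \<epsilon> \<le> walk \<epsilon> \<eta> k 1"
proof (induction k)
  case (Suc k)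
  have "0 \<le> \<eta> * walk \<epsilon> \<eta> k 2" using nonneg walk_nonneg by simp
  moreover have "\<epsilon> * 1 \<le> \<epsilon> * walk \<epsilon> \<eta> k 0" using nonneg walk_0_ge by (intro mult_left_mono)
  moreover note walk_Suc(2)[of \<epsilon> \<eta> k]
  ultimately show ?case using Suc by (simp add: algebra_simps del: walk.simps)
qed simp

lemma walk_1_le: "walk \<epsilon> \<eta> k 1 \<le> real k * (\<epsilon> + \<eta>) * (1 + \<epsilon> + \<eta>) ^ k"
proof (induction k)
  case (Suc k)
  let ?s = "(1 + \<epsilon> + \<eta>) ^ k"
  have "walk \<epsilon> \<eta> (Suc k) 1 = walk \<epsilon> \<eta> k 1 + \<epsilon> * walk \<epsilon> \<eta> k 0 + \<eta> * walk \<epsilon> \<eta> k 2"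
    by (rule walk_Suc)
  also have "\<dots> \<le> real k * (\<epsilon> + \<eta>) * ?s + \<epsilon> * ?s + \<eta> * ?s"
    using Suc walk_le nonneg by (intro add_mono mult_left_mono) auto
  also have "\<dots> = real (Suc k) * (\<epsilon> + \<eta>) * ?s" by (simp add: algebra_simps)
  also have "\<dots> \<le> real (Suc k) * (\<epsilon> + \<eta>) * (1 + \<epsilon> + \<eta>) ^ Suc k"
    using nonneg total_mono by (intro mult_left_mono) auto
  finally show ?case .
qed simp

text \<open>The sum 2 needs two steps 1, chosen among at most \<open>k ^ 2 / 2\<close> pairs, or a
  step \<open>- 1\<close>. The halving of the pairs is reproduced by
  \<open>k ^ 2 / 2 + k \<le> (k + 1) ^ 2 / 2\<close> in the induction.\<close>

lemma walk_2_le: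
  "walk \<epsilon> \<eta> k 2 \<le> (real k ^ 2 / 2 * (\<epsilon> * (\<epsilon> + \<eta>)) + real k * \<eta>) * (1 + \<epsilon> + \<eta>) ^ k"
proof (induction k)
  case (Suc k)
  let ?s = "(1 + \<epsilon> + \<eta>) ^ k" and ?p = "\<epsilon> * (\<epsilon> + \<eta>)"
  have p: "0 \<le> ?p" using nonneg by simp
  have s: "0 \<le> ?s" using nonneg by simp
  have "walk \<epsilon> \<eta> (Suc k) 2 = walk \<epsilon> \<eta> k 2 + \<epsilon> * walk \<epsilon> \<eta> k 1 + \<eta> * walk \<epsilon> \<eta> k 0"
    by (rule walk_Suc)
  also have "\<dots> \<le> (real k ^ 2 / 2 * ?p + real k * \<eta>) * ?s + \<epsilon> * (real k * (\<epsilon> + \<eta>) * ?s) + \<eta> * ?s"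
    using Suc walk_le walk_1_le nonneg by (intro add_mono mult_left_mono) auto
  also have "\<dots> = ((real k ^ 2 / 2 + real k) * ?p + real (Suc k) * \<eta>) * ?s"
    by (simp add: algebra_simps)
  also have "\<dots> \<le> (real (Suc k) ^ 2 / 2 * ?p + real (Suc k) * \<eta>) * ?s"
  proof -
    have "real k ^ 2 / 2 + real k \<le> real (Suc k) ^ 2 / 2"
      by (simp add: power2_eq_square algebra_simps)
    then show ?thesis using p s nonneg by (intro mult_right_mono add_mono) auto
  qed
  also have "\<dots> \<le> (real (Suc k) ^ 2 / 2 * ?p + real (Suc k) * \<eta>) * (1 + \<epsilon> + \<eta>) ^ Suc k"
    using p nonneg total_mono by (intro mult_left_mono) auto
  finally show ?case .
qed simp

end

text \<open>
  With \<open>x = k \<epsilon>\<close>, the weights of the sums \<open>0\<close>, \<open>1\<close>, \<open>2\<close> are about \<open>1\<close>, \<open>x\<close> and \<open>x\<^sup>2 / 2\<close> if \<open>\<eta>\<close> is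
  negligible. The factor \<open>1 / 2\<close> makes acceptance with the sum \<open>1\<close> win over errors.
\<close>

lemma walk_bounds:
  fixes \<epsilon> \<eta> \<beta> \<zeta> :: real
  assumes "0 < \<epsilon>" "0 \<le> \<beta>" and \<eta>: "\<eta> = \<beta> * \<epsilon>"
    and x: "1 / 16 \<le> real k * \<epsilon>" "real k * \<epsilon> \<le> 1 / 8"
    and \<beta>: "\<beta> \<le> 1 / 1000" "2 * \<beta> * (1 + \<zeta>) \<le> \<zeta>" and \<zeta>: "0 < \<zeta>"
  defines "h \<equiv> walk \<epsilon> \<eta> k 1 - walk 0 \<eta> k 1"
  shows "0 < h" "walk \<epsilon> \<eta> k 1 \<le> (1 + \<zeta>) * h" "walk \<epsilon> \<eta> k 0 * walk \<epsilon> \<eta> k 2 \<le> 3 / 4 * h ^ 2"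
proof -
  define X where "X = real k * \<epsilon>"
  have nn: "0 \<le> \<epsilon>" "0 \<le> \<eta>" "0 \<le> (0 :: real)" using assms by auto
  have X: "1 / 16 \<le> X" "X \<le> 1 / 8" using x by (simp_all add: X_def)
  have k\<eta>: "real k * \<eta> = X * \<beta>" by (simp add: X_def \<eta>)
  have X\<beta>: "X * \<beta> \<le> 1 / 8 * (1 / 1000)" using X assms(2) \<beta>(1) by (intro mult_mono) auto
  have small: "walk 0 \<eta> k 1 \<le> 2 * (X * \<beta>)"
  proof -
    have X\<beta>0: "0 \<le> X * \<beta>" using X assms(2) by simp
    have "(1 + \<eta>) ^ k \<le> exp \<eta> ^ k"
      using nn exp_ge_add_one_self[of \<eta>] by (intro power_mono) auto
    also have "\<dots> = exp (X * \<beta>)" by (simp add: exp_of_nat_mult[symmetric] k\<eta>)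
    also have "\<dots> \<le> 1 + X * \<beta> + (X * \<beta>)\<^sup>2"
      using X\<beta> X\<beta>0 by (intro exp_bound) auto
    also have "\<dots> \<le> 2"
    proof -
      have "(X * \<beta>)\<^sup>2 \<le> (1 / 2)\<^sup>2" using X\<beta> X\<beta>0 by (intro power_mono) auto
      then show ?thesis using X\<beta> by (simp add: power2_eq_square)
    qed
    finally have p2: "(1 + \<eta>) ^ k \<le> 2" .
    have "walk 0 \<eta> k 1 \<le> X * \<beta> * (1 + \<eta>) ^ k"
      using walk_1_le[of 0 \<eta> k] nn by (simp add: k\<eta>)
    also have "\<dots> \<le> X * \<beta> * 2" using p2 X\<beta>0 by (rule mult_left_mono)
    finally show ?thesis by simp
  qed
  have f1: "X \<le> walk \<epsilon> \<eta> k 1"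
    using walk_1_ge[OF nn(1,2), of k] by (simp add: X_def)
  have h_ge: "X * (1 - 2 * \<beta>) \<le> h"
    using small f1 by (simp add: h_def algebra_simps)
  have "0 < X * (1 - 2 * \<beta>)" using X \<beta> by (intro mult_pos_pos) auto
  with h_ge show hpos: "0 < h" by simp
  have "walk 0 \<eta> k 1 * (1 + \<zeta>) \<le> 2 * (X * \<beta>) * (1 + \<zeta>)"
    using small \<zeta> by (intro mult_right_mono) auto
  also have "\<dots> = X * (2 * \<beta> * (1 + \<zeta>))" by simp
  also have "\<dots> \<le> X * \<zeta>" using \<beta>(2) X by (intro mult_left_mono) auto
  also have "\<dots> \<le> walk \<epsilon> \<eta> k 1 * \<zeta>" using f1 \<zeta> by (intro mult_right_mono) auto
  finally show "walk \<epsilon> \<eta> k 1 \<le> (1 + \<zeta>) * h" by (simp add: h_def algebra_simps)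
  define s where "s = (1 + \<epsilon> + \<eta>) ^ k"
  have s0: "0 \<le> s" using nn by (simp add: s_def)
  \<comment> \<open>\<open>X \<le> 1 / 8\<close> keeps the exponent
    \<open>2 * (X + X * \<beta>)\<close> below \<open>26 / 100\<close>, whose exponential is under
    \<open>4 / 3\<close>.\<close>
  have s2: "s * s \<le> 4 / 3"
  proof -
    have "s \<le> exp (\<epsilon> + \<eta>) ^ k"
      unfolding s_def using nn exp_ge_add_one_self[of "\<epsilon> + \<eta>"]
      by (intro power_mono) (simp_all add: add.assoc)
    also have "\<dots> = exp (X + X * \<beta>)"
      by (simp add: exp_of_nat_mult[symmetric] distrib_left k\<eta> X_def[symmetric])
    finally have "s * s \<le> exp (X + X * \<beta>) * exp (X + X * \<beta>)"
      using s0 by (intro mult_mono) auto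
    also have "\<dots> = exp (2 * (X + X * \<beta>))" by (simp add: exp_add[symmetric])
    also have "\<dots> \<le> exp (26 / 100)" using X X\<beta> by simp
    also have "\<dots> \<le> 1 + 26 / 100 + (26 / 100)\<^sup>2" by (rule exp_bound) auto
    also have "\<dots> \<le> 4 / 3" by (simp add: power2_eq_square)
    finally show ?thesis .
  qed
  \<comment> \<open>\<open>X \<ge> 1 / 16\<close> absorbs the linear term \<open>X * \<beta>\<close>
    into \<open>16 * X\<^sup>2 * \<beta>\<close>; with \<open>\<beta> \<le> 1 / 1000\<close> the
    coefficient \<open>1 / 2\<close> grows only to \<open>517 / 1000\<close>. Times
    \<open>4 / 3\<close> this is about \<open>0.69\<close>, still below
    \<open>3 / 4\<close>.\<close>
  have f2: "walk \<epsilon> \<eta> k 2 \<le> X\<^sup>2 * (517 / 1000) * s"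
  proof -
    have "walk \<epsilon> \<eta> k 2 \<le> (real k ^ 2 / 2 * (\<epsilon> * (\<epsilon> + \<eta>)) + real k * \<eta>) * s"
      unfolding s_def by (rule walk_2_le[OF nn(1,2)])
    also have "real k ^ 2 / 2 * (\<epsilon> * (\<epsilon> + \<eta>)) + real k * \<eta> = X\<^sup>2 * ((1 + \<beta>) / 2) + X * \<beta>"
      by (simp add: X_def \<eta> power2_eq_square field_simps)
    also have "\<dots> \<le> X\<^sup>2 * ((1 + \<beta>) / 2) + X * (16 * X) * \<beta>"
    proof -
      have "X * 1 * \<beta> \<le> X * (16 * X) * \<beta>"
        using X assms(2) by (intro mult_right_mono mult_left_mono) auto
      then show ?thesis by simp
    qed
    also have "\<dots> = X\<^sup>2 * ((1 + \<beta>) / 2 + 16 * \<beta>)" by (simp add: power2_eq_square algebra_simps)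
    also have "\<dots> \<le> X\<^sup>2 * (517 / 1000)"
    proof (rule mult_left_mono)
      have "(1 + \<beta>) / 2 + 16 * \<beta> = 1 / 2 + 33 / 2 * \<beta>" by (simp add: field_simps)
      also have "\<dots> \<le> 1 / 2 + 33 / 2 * (1 / 1000)" using \<beta>(1) by (intro add_left_mono mult_left_mono) auto
      also have "\<dots> \<le> 517 / 1000" by simp
      finally show "(1 + \<beta>) / 2 + 16 * \<beta> \<le> 517 / 1000" .
    qed simp
    finally show ?thesis using s0 by (simp add: mult_right_mono)
  qed
  have "walk \<epsilon> \<eta> k 0 * walk \<epsilon> \<eta> k 2 \<le> s * (X\<^sup>2 * (517 / 1000) * s)"
    using f2 walk_le(1)[OF nn(1,2), of k] walk_nonneg[OF nn(1,2)] s0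
    by (intro mult_mono) (auto simp: s_def)
  also have "\<dots> = X\<^sup>2 * (517 / 1000) * (s * s)" by simp
  also have "\<dots> \<le> X\<^sup>2 * (517 / 1000) * (4 / 3)" using s2 by (intro mult_left_mono) auto
  also have "\<dots> \<le> 3 / 4 * (X * (1 - 2 * \<beta>))\<^sup>2"
  proof -
    have "(998 / 1000)\<^sup>2 \<le> (1 - 2 * \<beta>)\<^sup>2" using \<beta>(1) by (intro power_mono) auto
    then have "X\<^sup>2 * (998 / 1000)\<^sup>2 \<le> X\<^sup>2 * (1 - 2 * \<beta>)\<^sup>2" by (intro mult_left_mono) auto
    moreover have "X\<^sup>2 * (517 / 1000) * (4 / 3) \<le> 3 / 4 * (X\<^sup>2 * (998 / 1000)\<^sup>2)"
      by (simp add: power2_eq_square)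
    ultimately show ?thesis by (simp add: power_mult_distrib)
  qed
  also have "\<dots> \<le> 3 / 4 * h\<^sup>2"
    using h_ge X \<beta> by (intro mult_left_mono power_mono) auto
  finally show "walk \<epsilon> \<eta> k 0 * walk \<epsilon> \<eta> k 2 \<le> 3 / 4 * h ^ 2" .
qed

subsection \<open>The probability of acceptance\<close>

text \<open>\<open>None\<close> stands for a run that is not constant and is thereby excluded.
  \<open>D = - {0}\<close> singles out groups without an erased run.\<close>

definition words :: "3 set \<Rightarrow> 3 \<Rightarrow> 3 option list set" where
  "words D \<sigma> = {os. \<exists>ds. os = map Some ds \<and> set ds \<subseteq> D \<and> sum_list ds = \<sigma>}"

lemma Nil_in_words: "[] \<in> words D \<sigma> \<longleftrightarrow> \<sigma> = 0"
  by (auto simp: words_def)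

lemma Cons_in_words: "x # xs \<in> words D \<sigma> \<longleftrightarrow> (\<exists>d\<in>D. x = Some d \<and> xs \<in> words D (\<sigma> - d))"
proof
  assume "x # xs \<in> words D \<sigma>"
  then obtain ds where ds: "x # xs = map Some ds" "set ds \<subseteq> D" "sum_list ds = \<sigma>"
    unfolding words_def mem_Collect_eq by (elim exE conjE) (rule that)
  then obtain d ds' where "ds = d # ds'" by (cases ds) auto
  with ds show "\<exists>d\<in>D. x = Some d \<and> xs \<in> words D (\<sigma> - d)"
    by (intro bexI[of _ d]) (auto simp: words_def)
next
  assume "\<exists>d\<in>D. x = Some d \<and> xs \<in> words D (\<sigma> - d)"
  then obtain d ds where "d \<in> D" "x = Some d" "xs = map Some ds" "set ds \<subseteq> D" "sum_list ds = \<sigma> - d"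
    by (auto simp: words_def)
  then show "x # xs \<in> words D \<sigma>"
    unfolding words_def by (intro CollectI exI[of _ "d # ds"]) auto
qed

lemma prob_words:
  "measure_pmf.prob (replicate_pmf k \<rho>) (words D \<sigma>) =
    conv_weight (\<lambda>d. if d \<in> D then pmf \<rho> (Some d) else 0) k \<sigma>"
proof (induction k arbitrary: \<sigma>)
  case 0
  show ?case by (simp add: Nil_in_words)
next
  case (Suc k)
  let ?A = "\<lambda>d. if d \<in> D then {Some d} \<times> words D (\<sigma> - d) else {}"
  let ?W = "\<lambda>d. if d \<in> D then pmf \<rho> (Some d) else 0"
  have "replicate_pmf (Suc k) \<rho> = map_pmf (\<lambda>(x, xs). x # xs) (pair_pmf \<rho> (replicate_pmf k \<rho>))"
    by (simp add: pair_pmf_def map_bind_pmf map_pmf_def bind_assoc_pmf bind_return_pmf)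
  moreover have "(\<lambda>(x, xs). x # xs) -` words D \<sigma> = (\<Union>d\<in>UNIV. ?A d)"
    by (auto simp: Cons_in_words split: if_splits)
  ultimately have "measure_pmf.prob (replicate_pmf (Suc k) \<rho>) (words D \<sigma>) =
      measure_pmf.prob (pair_pmf \<rho> (replicate_pmf k \<rho>)) (\<Union>d\<in>UNIV. ?A d)"
    by simp
  also have "\<dots> = (\<Sum>d\<in>UNIV. measure_pmf.prob (pair_pmf \<rho> (replicate_pmf k \<rho>)) (?A d))"
    by (rule measure_pmf.finite_measure_finite_Union) (auto simp: disjoint_family_on_def)
  also have "\<dots> = (\<Sum>d\<in>UNIV. ?W d * conv_weight ?W k (\<sigma> - d))"
    by (intro sum.cong refl) (simp add: prob_pair_pmf_Times measure_pmf_single Suc.IH)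
  also have "\<dots> = conv_weight ?W (Suc k) \<sigma>"
    unfolding UNIV_mod3 by simp
  finally show ?case .
qed

context group_code
begin

section \<open>Noise words seen as groups of run letters\<close>

definition run_letter :: "3 list \<Rightarrow> 3 option" where
  "run_letter run = (if \<forall>l<m. run ! l = run ! 0 then Some (run ! 0) else None)"

lemma run_letter_eq_Some: "run_letter run = Some d \<longleftrightarrow> (\<forall>l<m. run ! l = d)"
proof (cases "\<forall>l<m. run ! l = run ! 0")
  case True
  then have "run_letter run = Some (run ! 0)" unfolding run_letter_def by (rule if_P)
  then show ?thesis using True m_pos by (metis option.inject)
next
  case False
  then have "run_letter run = None" unfolding run_letter_def by (rule if_not_P)
  then show ?thesis using False m_pos by (metis option.distinct(1))
qed

lemma pmf_run_letter: "pmf (map_pmf run_letter (replicate_pmf m \<nu>)) (Some d) = pmf \<nu> d ^ m"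
proof -
  have "pmf (map_pmf run_letter (replicate_pmf m \<nu>)) (Some d) =
      measure_pmf.prob (replicate_pmf m \<nu>) {run. \<forall>l<m. run ! l \<in> {d}}"
    by (simp add: pmf_map vimage_def run_letter_eq_Some)
  also have "\<dots> = pmf \<nu> d ^ m"
    unfolding prob_replicate_pmf_nth by (simp add: measure_pmf_single)
  finally show ?thesis .
qed

definition groups :: "3 list \<Rightarrow> 3 option list list" where
  "groups e = chunk k R (map run_letter (chunk m (R * k) e))"

lemma map_groups:
  "map_pmf groups (replicate_pmf L \<nu>) =
    replicate_pmf R (replicate_pmf k (map_pmf run_letter (replicate_pmf m \<nu>)))"
proof -
  have "map_pmf groups (replicate_pmf L \<nu>) =
      map_pmf (chunk k R) (map_pmf (map run_letter) (map_pmf (chunk m (R * k)) (replicate_pmf L \<nu>)))"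
    by (simp add: pmf.map_comp comp_def groups_def[abs_def])
  then show ?thesis
    by (simp only: chunk_replicate_pmf_exact map_replicate_pmf)
qed

lemma groups_nth:
  assumes e: "length e = L" and j: "j < R"
  shows "length (groups e ! j) = k"
    and "i < k \<Longrightarrow> groups e ! j ! i = Some d \<longleftrightarrow> (\<forall>l<m. e ! pos j i l = d)"
proof -
  let ?ls = "map run_letter (chunk m (R * k) e)"
  have G: "groups e ! j = take k (drop (j * k) ?ls)"
    using j by (simp add: groups_def nth_chunk)
  have "Suc j * k \<le> R * k" using j by (intro mult_right_mono) auto
  then have jk: "j * k + k \<le> R * k" by simp
  then show "length (groups e ! j) = k" by (simp add: G)
  assume i: "i < k"
  have jik: "j * k + i < R * k" using jk i by simp
  have "groups e ! j ! i = ?ls ! (j * k + i)"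
  proof -
    have "j * k \<le> length ?ls" using jk by (metis add_leD1 length_chunk length_map)
    then show ?thesis unfolding G using i by (simp only: nth_take nth_drop)
  qed
  also have "\<dots> = run_letter (take m (drop ((j * k + i) * m) e))"
    using jik by (simp add: nth_chunk)
  finally have g: "groups e ! j ! i = run_letter (take m (drop ((j * k + i) * m) e))" .
  have "take m (drop ((j * k + i) * m) e) ! l = e ! pos j i l" if "l < m" for l
  proof -
    have "(j * k + i) * m \<le> length e" using jik e by (simp add: mult_le_mono1)
    then show ?thesis using that by (simp add: pos_def)
  qed
  then show "groups e ! j ! i = Some d \<longleftrightarrow> (\<forall>l<m. e ! pos j i l = d)"
    unfolding g run_letter_eq_Some by simp
qed

lemma group_in_words:
  assumes e: "length e = L" and j: "j < R"
  shows "groups e ! j \<in> words D \<sigma> \<longleftrightarrow>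
    (\<forall>i<k. \<forall>l<m. e ! pos j i l = e ! pos j i 0) \<and> gsum e j = \<sigma> \<and> (\<forall>i<k. e ! pos j i 0 \<in> D)"
proof
  assume "groups e ! j \<in> words D \<sigma>"
  then obtain ds where ds: "groups e ! j = map Some ds" "set ds \<subseteq> D" "sum_list ds = \<sigma>"
    by (auto simp: words_def)
  have len: "length ds = k" using groups_nth(1)[OF e j] ds(1) by simp
  have d: "e ! pos j i l = ds ! i" if "i < k" "l < m" for i l
    using groups_nth(2)[OF e j that(1), of "ds ! i"] ds(1) len that by simp
  have "gsum e j = (\<Sum>i<k. ds ! i)"
    unfolding gsum_def using d m_pos by simp
  then have "gsum e j = \<sigma>"
    using ds(3) len by (simp add: sum_list_sum_nth atLeast0LessThan)
  moreover have "e ! pos j i 0 \<in> D" if "i < k" for i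
    using d[OF that m_pos] ds(2) len that by auto
  moreover have "e ! pos j i l = e ! pos j i 0" if "i < k" "l < m" for i l
    using d[OF that] d[OF that(1) m_pos] by simp
  ultimately show "(\<forall>i<k. \<forall>l<m. e ! pos j i l = e ! pos j i 0) \<and> gsum e j = \<sigma> \<and> (\<forall>i<k. e ! pos j i 0 \<in> D)"
    by blast
next
  assume *: "(\<forall>i<k. \<forall>l<m. e ! pos j i l = e ! pos j i 0) \<and> gsum e j = \<sigma> \<and> (\<forall>i<k. e ! pos j i 0 \<in> D)"
  define ds where "ds = map (\<lambda>i. e ! pos j i 0) [0..<k]"
  have "groups e ! j = map Some ds"
  proof (rule nth_equalityI)
    show "length (groups e ! j) = length (map Some ds)"
      using groups_nth(1)[OF e j] by (simp add: ds_def)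
    fix i assume "i < length (groups e ! j)"
    then have i: "i < k" using groups_nth(1)[OF e j] by simp
    then have "groups e ! j ! i = Some (e ! pos j i 0)"
      using * groups_nth(2)[OF e j i] by blast
    then show "groups e ! j ! i = map Some ds ! i" using i by (simp add: ds_def)
  qed
  moreover have "sum_list ds = \<sigma>"
    using * by (simp add: ds_def gsum_def sum_list_sum_nth atLeast0LessThan)
  moreover have "set ds \<subseteq> D" using * by (auto simp: ds_def)
  ultimately show "groups e ! j \<in> words D \<sigma>" unfolding words_def by blast
qed

lemma prob_groups:
  "measure_pmf.prob (replicate_pmf L \<nu>) {e. \<forall>j<R. groups e ! j \<in> S j} =
    (\<Prod>j<R. measure_pmf.prob (replicate_pmf k (map_pmf run_letter (replicate_pmf m \<nu>))) (S j))"
proof -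
  have "measure_pmf.prob (replicate_pmf L \<nu>) {e. \<forall>j<R. groups e ! j \<in> S j} =
      measure_pmf.prob (map_pmf groups (replicate_pmf L \<nu>)) {os. \<forall>j<R. os ! j \<in> S j}"
    by (simp add: vimage_def)
  then show ?thesis by (simp only: map_groups prob_replicate_pmf_nth)
qed

lemma good_noise_iff:
  assumes "length e = L"
  shows "good_noise e \<longleftrightarrow> (\<forall>j<R. groups e ! j \<in> words UNIV 1 - words (- {0}) 1)"
proof -
  have "groups e ! j \<in> words UNIV 1 - words (- {0}) 1 \<longleftrightarrow>
      (\<forall>i<k. \<forall>l<m. e ! pos j i l = e ! pos j i 0) \<and> gsum e j = 1 \<and> (\<exists>i<k. e ! pos j i 0 = 0)"
    if "j < R" for j
    unfolding Diff_iff group_in_words[OF assms that] Compl_iff singleton_iff by blast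
  then show ?thesis unfolding good_noise_def const_runs_def by blast
qed

lemma accepted_noiseD:
  assumes "length e = L" "accepted_noise e"
  shows "\<forall>j<R. groups e ! j \<in> words UNIV (1 + sg j * (gsum e 0 - 1))"
proof (intro allI impI)
  fix j assume j: "j < R"
  then have "gsum e j - 1 = sg j * (gsum e 0 - 1)"
    using assms(2) unfolding accepted_noise_def by blast
  then have "gsum e j = 1 + sg j * (gsum e 0 - 1)" by (metis add.commute diff_add_cancel)
  then show "groups e ! j \<in> words UNIV (1 + sg j * (gsum e 0 - 1))"
    using assms(2) j unfolding group_in_words[OF assms(1) j] accepted_noise_def const_runs_def by blast
qed

lemma prod_alternating:
  fixes f :: "bool \<Rightarrow> real"
  shows "(\<Prod>j<2 * r. f (even j)) = (f True * f False) ^ r"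
  by (induction r) (simp_all add: algebra_simps)

text \<open>Accepted noise has group sums \<open>1 + sg j * \<delta>\<close> for one of three
  \<open>\<delta>\<close>. For \<open>\<delta> = 1, 2\<close> the sums alternate between 2 and 0,
  giving \<open>(q 0 * q 2) ^ r\<close> each; for \<open>\<delta> = 0\<close> it fails to be good
  only if some group lacks an erased run.\<close>

lemma prob_noise_bounds:
  fixes \<nu> :: "3 pmf"
  defines "q \<equiv> conv_weight (\<lambda>d. pmf \<nu> d ^ m) k"
    and "n \<equiv> conv_weight (\<lambda>d. if d = 0 then 0 else pmf \<nu> d ^ m) k"
  assumes R: "R = 2 * r"
  shows "measure_pmf.prob (replicate_pmf L \<nu>) {e. good_noise e} = (q 1 - n 1) ^ R"
    and "measure_pmf.prob (replicate_pmf L \<nu>) {e. accepted_noise e \<and> \<not> good_noise e} \<le>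
      2 * (q 0 * q 2) ^ r + (q 1 ^ R - (q 1 - n 1) ^ R)"
proof -
  let ?N = "replicate_pmf L \<nu>"
  let ?K = "replicate_pmf k (map_pmf run_letter (replicate_pmf m \<nu>))"
  have q: "measure_pmf.prob ?K (words UNIV \<sigma>) = q \<sigma>" for \<sigma>
    by (simp add: prob_words pmf_run_letter q_def)
  have n: "measure_pmf.prob ?K (words (- {0}) \<sigma>) = n \<sigma>" for \<sigma>
  proof -
    have "(\<lambda>d. if d \<in> - {0} then pmf (map_pmf run_letter (replicate_pmf m \<nu>)) (Some d) else 0) =
        (\<lambda>d. if d = 0 then 0 else pmf \<nu> d ^ m)"
      by (auto simp: pmf_run_letter)
    then show ?thesis by (simp only: prob_words n_def)
  qed
  have h: "measure_pmf.prob ?K (words UNIV 1 - words (- {0}) 1) = q 1 - n 1"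
  proof -
    have "words (- {0}) 1 \<subseteq> words UNIV 1" by (auto simp: words_def)
    from measure_pmf.finite_measure_Diff[OF _ _ this, of ?K] show ?thesis by (simp add: q n)
  qed
  define Good where "Good = {e. \<forall>j<R. groups e ! j \<in> words UNIV 1 - words (- {0}) 1}"
  define E where "E \<delta> = {e. \<forall>j<R. groups e ! j \<in> words UNIV (1 + sg j * \<delta>)}" for \<delta>
  have Good: "measure_pmf.prob ?N Good = (q 1 - n 1) ^ R"
    unfolding Good_def prob_groups by (simp add: h)
  have "measure_pmf.prob ?N {e. good_noise e} = measure_pmf.prob ?N Good"
  proof (rule measure_pmf.finite_measure_eq_AE)
    show "AE e in ?N. e \<in> {e. good_noise e} \<longleftrightarrow> e \<in> Good"
      unfolding AE_measure_pmf_iff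
    proof
      fix e assume "e \<in> set_pmf ?N"
      then show "e \<in> {e. good_noise e} \<longleftrightarrow> e \<in> Good"
        unfolding Good_def mem_Collect_eq by (intro good_noise_iff length_replicate_pmf)
    qed
  qed simp_all
  then show "measure_pmf.prob ?N {e. good_noise e} = (q 1 - n 1) ^ R" using Good by simp
  have E0: "measure_pmf.prob ?N (E 0 - Good) = q 1 ^ R - (q 1 - n 1) ^ R"
  proof -
    have "measure_pmf.prob ?N (E 0 - Good) = measure_pmf.prob ?N (E 0) - measure_pmf.prob ?N Good"
      by (rule measure_pmf.finite_measure_Diff) (auto simp: E_def Good_def)
    also have "measure_pmf.prob ?N (E 0) = q 1 ^ R"
      unfolding E_def prob_groups by (simp add: q)
    finally show ?thesis by (simp only: Good)
  qed
  have E1: "measure_pmf.prob ?N (E 1) = (q 0 * q 2) ^ r"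
  proof -
    have "measure_pmf.prob ?N (E 1) = (\<Prod>j<R. if even j then q 2 else q 0)"
      unfolding E_def prob_groups q by (intro prod.cong refl) (simp add: sg_def)
    then show ?thesis
      using prod_alternating[of "\<lambda>b. if b then q 2 else q 0" r] by (simp add: R mult.commute)
  qed
  have E2: "measure_pmf.prob ?N (E 2) = (q 0 * q 2) ^ r"
  proof -
    have mod3: "(1 + 1 * 2 :: 3) = 0" "(1 + - 1 * 2 :: 3) = 2" by simp_all
    have "q (1 + sg j * 2) = (if even j then q 0 else q 2)" for j
      by (cases "even j") (simp_all only: sg_def if_True if_False mod3)
    then have "measure_pmf.prob ?N (E 2) = (\<Prod>j<R. if even j then q 0 else q 2)"
      unfolding E_def prob_groups q by (intro prod.cong refl)
    then show ?thesis
      using prod_alternating[of "\<lambda>b. if b then q 0 else q 2" r] by (simp add: R)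
  qed
  have "measure_pmf.prob ?N {e. accepted_noise e \<and> \<not> good_noise e} =
      measure_pmf.prob ?N ({e. accepted_noise e \<and> \<not> good_noise e} \<inter> set_pmf ?N)"
    by (simp only: measure_Int_set_pmf)
  also have "\<dots> \<le> measure_pmf.prob ?N (E 1 \<union> (E 2 \<union> (E 0 - Good)))"
  proof (rule measure_pmf.finite_measure_mono)
    show "{e. accepted_noise e \<and> \<not> good_noise e} \<inter> set_pmf ?N \<subseteq> E 1 \<union> (E 2 \<union> (E 0 - Good))"
    proof
      fix e assume "e \<in> {e. accepted_noise e \<and> \<not> good_noise e} \<inter> set_pmf ?N"
      then have e: "accepted_noise e" "\<not> good_noise e" "length e = L"
        by (auto dest: length_replicate_pmf)
      have "e \<in> E (gsum e 0 - 1)" using accepted_noiseD[OF e(3,1)] by (simp add: E_def)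
      moreover have "e \<notin> Good" using e good_noise_iff by (simp add: Good_def)
      ultimately show "e \<in> E 1 \<union> (E 2 \<union> (E 0 - Good))"
        using mod3_cases[of "gsum e 0 - 1"] by auto
    qed
  qed simp
  also have "\<dots> \<le> measure_pmf.prob ?N (E 1) + (measure_pmf.prob ?N (E 2) + measure_pmf.prob ?N (E 0 - Good))"
    by (intro order_trans[OF measure_Un_le] add_left_mono) auto
  finally show "measure_pmf.prob ?N {e. accepted_noise e \<and> \<not> good_noise e} \<le>
      2 * (q 0 * q 2) ^ r + (q 1 ^ R - (q 1 - n 1) ^ R)"
    by (simp add: E0 E1 E2)
qed

end

text \<open>The order of choices matters: \<open>r\<close> so that wrong patterns are rare, then
  \<open>\<zeta>\<close> depending on \<open>r\<close> so that groups without erasure stay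
  negligible over \<open>2 * r\<close> groups, then \<open>m\<close> depending on
  \<open>\<zeta>\<close>, and \<open>k\<close> last.\<close>

theorem secret_key_rate_noisy_source_pos:
  assumes p0: "0 < pmf \<nu> 0" and p20: "pmf \<nu> 0 < pmf \<nu> 2" and p10: "pmf \<nu> 1 < pmf \<nu> 0"
  shows "secret_key_rate (noisy_source \<nu>) > 0"
proof -
  define \<tau> :: real where "\<tau> = (1 / 2) ^ 2001"
  have \<tau>: "0 < \<tau>" "\<tau> \<le> 1" unfolding \<tau>_def by (rule zero_less_power, simp) (rule power_le_one, simp_all)
  obtain r0 where "(3 / 4 :: real) ^ r0 < \<tau> / 8"
    using real_arch_pow_inv[of "\<tau> / 8" "3 / 4"] \<tau> by auto
  define r where "r = Suc r0"
  have r: "r > 0" "(3 / 4 :: real) ^ r \<le> \<tau> / 8"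
    using \<open>(3 / 4 :: real) ^ r0 < \<tau> / 8\<close> zero_le_power[of "3 / 4 :: real" r0]
    unfolding r_def power_Suc by (simp, linarith)
  define \<zeta> where "\<zeta> = \<tau> / (16 * real r)"
  have \<zeta>: "0 < \<zeta>" using \<tau> r by (simp add: \<zeta>_def)
  have \<zeta>_pow: "(1 + \<zeta>) ^ (2 * r) \<le> 1 + \<tau> / 4"
  proof -
    have "(1 + \<zeta>) ^ (2 * r) \<le> exp \<zeta> ^ (2 * r)"
      using \<zeta> by (intro power_mono) auto
    also have "\<dots> = exp (\<tau> / 8)"
      using r by (simp add: exp_of_nat_mult[symmetric] \<zeta>_def)
    also have "\<dots> \<le> 1 + 2 * (\<tau> / 8)"
      using \<tau> by (intro real_exp_bound_lemma) auto
    finally show ?thesis by simp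
  qed
  let ?p0 = "pmf \<nu> 0" and ?p1 = "pmf \<nu> 1" and ?p2 = "pmf \<nu> 2"
  have "(\<lambda>m. (?p0 / ?p2) ^ m) \<longlonglongrightarrow> 0" "(\<lambda>m. (?p1 / ?p0) ^ m) \<longlonglongrightarrow> 0"
    using p0 p20 p10 by (auto intro!: LIMSEQ_realpow_zero)
  \<comment> \<open>The bounds on \<open>(?p1 / ?p0) ^ m\<close> are the two conditions on
    \<open>\<beta>\<close> in \<open>walk_bounds\<close>; the bound \<open>1 / 48\<close> leaves
    room for rounding \<open>k\<close>.\<close>
  then have "\<forall>\<^sub>F m in sequentially. (?p0 / ?p2) ^ m < 1 / 48 \<and>
      (?p1 / ?p0) ^ m < min (1 / 1000) (\<zeta> / (2 * (1 + \<zeta>))) \<and> 0 < m"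
    using \<zeta> by (intro eventually_conj order_tendstoD(2)[of _ 0] eventually_gt_at_top) auto
  then obtain m where m: "(?p0 / ?p2) ^ m < 1 / 48"
    "(?p1 / ?p0) ^ m < min (1 / 1000) (\<zeta> / (2 * (1 + \<zeta>)))" "0 < m"
    by (auto simp: eventually_sequentially)
  define \<epsilon> where "\<epsilon> = (?p0 / ?p2) ^ m"
  define \<beta> where "\<beta> = (?p1 / ?p0) ^ m"
  define \<eta> where "\<eta> = \<beta> * \<epsilon>"
  have \<epsilon>: "0 < \<epsilon>" "\<epsilon> \<le> 1 / 48" using m(1) p0 p20 by (simp_all add: \<epsilon>_def)
  have \<beta>: "0 \<le> \<beta>" "\<beta> \<le> 1 / 1000" using m(2) by (simp_all add: \<beta>_def)
  have \<beta>\<zeta>: "2 * \<beta> * (1 + \<zeta>) \<le> \<zeta>"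
  proof -
    have "\<beta> \<le> \<zeta> / (2 * (1 + \<zeta>))" using m(2) by (simp add: \<beta>_def)
    then show ?thesis using \<zeta> by (simp add: le_divide_eq mult_ac)
  qed
  \<comment> \<open>Without rounding \<open>3 * u * \<epsilon>\<close> would be
    \<open>1 / 8\<close>; rounding loses at most \<open>3 * \<epsilon> \<le> 1 / 16\<close>. The
    multiple of three makes a group of letters 2 sum to 0, so that replacing one by an erased run
    gives the sum 1.\<close>
  define u where "u = nat \<lfloor>1 / (24 * \<epsilon>)\<rfloor>"
  define k where "k = 3 * u"
  have u: "real u \<le> 1 / (24 * \<epsilon>)" "1 / (24 * \<epsilon>) - 1 \<le> real u"
  proof -
    have "0 \<le> 1 / (24 * \<epsilon>)" using \<epsilon> by simp
    then show "real u \<le> 1 / (24 * \<epsilon>)" "1 / (24 * \<epsilon>) - 1 \<le> real u"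
      unfolding u_def by linarith+
  qed
  have x2: "real k * \<epsilon> \<le> 1 / 8"
    using mult_right_mono[OF u(1), of "3 * \<epsilon>"] \<epsilon> by (simp add: k_def mult_ac)
  have x1: "1 / 16 \<le> real k * \<epsilon>"
  proof -
    have "1 / 16 \<le> (1 / (24 * \<epsilon>) - 1) * (3 * \<epsilon>)" using \<epsilon> by (simp add: field_simps)
    also have "\<dots> \<le> real u * (3 * \<epsilon>)" using \<epsilon> by (intro mult_right_mono u(2)) auto
    finally show ?thesis by (simp add: k_def mult_ac)
  qed
  have k: "k > 0" using x1 by (cases k) auto
  interpret group_code "2 * r" k m
    by unfold_locales (use r k m in auto)
  note walk = walk_bounds[OF \<epsilon>(1) \<beta>(1) \<eta>_def x1 x2 \<beta>(2) \<beta>\<zeta> \<zeta>]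
  define h where "h = walk \<epsilon> \<eta> k 1 - walk 0 \<eta> k 1"
  have h: "0 < h" "walk \<epsilon> \<eta> k 1 \<le> (1 + \<zeta>) * h" "walk \<epsilon> \<eta> k 0 * walk \<epsilon> \<eta> k 2 \<le> 3 / 4 * h ^ 2"
    unfolding h_def by (rule walk)+
  define q where "q = conv_weight (\<lambda>d. pmf \<nu> d ^ m) k"
  define n where "n = conv_weight (\<lambda>d. if d = 0 then 0 else pmf \<nu> d ^ m) k"
  define c where "c = (?p2 ^ m) ^ k"
  have c: "0 < c" using p0 p20 by (simp add: c_def)
  have "(3 :: 3) = 0" by simp
  then have k3: "of_nat k = (0 :: 3)"
    by (simp only: k_def of_nat_mult of_nat_numeral mult_zero_left)
  have \<eta>': "?p1 ^ m / ?p2 ^ m = \<eta>" using p0 by (simp add: \<eta>_def \<beta>_def \<epsilon>_def power_divide)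
  have \<epsilon>': "?p0 ^ m / ?p2 ^ m = \<epsilon>" by (simp add: \<epsilon>_def power_divide)
  have W2: "?p2 ^ m \<noteq> 0" using p0 p20 by simp
  have q: "q \<sigma> = c * walk \<epsilon> \<eta> k \<sigma>" for \<sigma>
    using conv_weight_walk[of "\<lambda>d. pmf \<nu> d ^ m" k \<sigma>] W2 by (simp add: q_def c_def \<eta>' \<epsilon>' k3)
  have n: "n \<sigma> = c * walk 0 \<eta> k \<sigma>" for \<sigma>
    using conv_weight_walk[of "\<lambda>d. if d = 0 then 0 else pmf \<nu> d ^ m" k \<sigma>] W2
    by (simp add: n_def c_def \<eta>' k3)
  have qn: "q 1 - n 1 = c * h" by (simp add: q n h_def algebra_simps)
  have nn: "0 \<le> walk \<epsilon> \<eta> k \<sigma>" for \<sigma>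
    using \<epsilon> \<beta> by (intro walk_nonneg) (auto simp: \<eta>_def)
  note prob = prob_noise_bounds[OF refl, of \<nu>, folded q_def n_def, unfolded qn]
  have "2 * (q 0 * q 2) ^ r + (q 1 ^ (2 * r) - (c * h) ^ (2 * r)) \<le>
      2 * ((3 / 4) ^ r * (c * h) ^ (2 * r)) + ((1 + \<tau> / 4) * (c * h) ^ (2 * r) - (c * h) ^ (2 * r))"
  proof (intro add_mono mult_left_mono diff_right_mono)
    have "q 0 * q 2 = c\<^sup>2 * (walk \<epsilon> \<eta> k 0 * walk \<epsilon> \<eta> k 2)" by (simp add: q power2_eq_square)
    also have "\<dots> \<le> c\<^sup>2 * (3 / 4 * h\<^sup>2)" using h(3) by (intro mult_left_mono) auto
    finally have "(q 0 * q 2) ^ r \<le> (c\<^sup>2 * (3 / 4 * h\<^sup>2)) ^ r"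
      using c nn by (intro power_mono) (auto simp: q)
    also have "\<dots> = (3 / 4 * (c * h)\<^sup>2) ^ r" by (simp only: power_mult_distrib mult.left_commute)
    also have "\<dots> = (3 / 4) ^ r * (c * h) ^ (2 * r)" by (simp only: power_mult_distrib power_mult)
    finally show "(q 0 * q 2) ^ r \<le> (3 / 4) ^ r * (c * h) ^ (2 * r)" .
    have "q 1 \<le> (1 + \<zeta>) * (c * h)" using mult_left_mono[OF h(2), of c] c by (simp add: q mult_ac)
    then have "q 1 ^ (2 * r) \<le> ((1 + \<zeta>) * (c * h)) ^ (2 * r)"
      using c nn by (intro power_mono) (auto simp: q)
    also have "\<dots> = (1 + \<zeta>) ^ (2 * r) * (c * h) ^ (2 * r)" by (simp only: power_mult_distrib)
    also have "\<dots> \<le> (1 + \<tau> / 4) * (c * h) ^ (2 * r)"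
      using \<zeta>_pow c h(1) by (intro mult_right_mono) auto
    finally show "q 1 ^ (2 * r) \<le> (1 + \<tau> / 4) * (c * h) ^ (2 * r)" .
  qed simp
  also have "\<dots> = (2 * (3 / 4) ^ r + \<tau> / 4) * (c * h) ^ (2 * r)" by (simp add: algebra_simps)
  also have "\<dots> \<le> \<tau> * (c * h) ^ (2 * r)"
    using r(2) \<tau> c h(1) by (intro mult_right_mono) auto
  finally have "measure_pmf.prob (replicate_pmf (2 * r * k * m) \<nu>) {e. accepted_noise e \<and> \<not> good_noise e} \<le>
      (1 / 2) ^ 2001 * measure_pmf.prob (replicate_pmf (2 * r * k * m) \<nu>) {e. good_noise e}"
    unfolding \<tau>_def prob(1) by (rule order_trans[OF prob(2)])
  moreover have "0 < measure_pmf.prob (replicate_pmf (2 * r * k * m) \<nu>) {e. good_noise e}"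
    unfolding prob(1) using c h(1) by simp
  ultimately show ?thesis
    by (intro accept_scheme.secret_key_rate_pos[OF accept_scheme])
qed

section \<open>The family of distributions\<close>

text \<open>The sign is opposite to \<open>y - x\<close> in \<open>XY_pmf\<close>, so \<alpha>
  becomes the weight of \<open>2 = - 1\<close> and \<open>5 - \<alpha>\<close> that of 1.\<close>

definition diff_pmf :: "real \<Rightarrow> 3 pmf" where
  "diff_pmf \<alpha> = map_pmf (\<lambda>(x, y). x - y) (XY_pmf \<alpha>)"

lemma pmf_diff_pmf:
  assumes "2 \<le> \<alpha>" "\<alpha> \<le> 5"
  shows "pmf (diff_pmf \<alpha>) 0 = 2 / 7" "pmf (diff_pmf \<alpha>) 1 = (5 - \<alpha>) / 7" "pmf (diff_pmf \<alpha>) 2 = \<alpha> / 7"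
proof -
  have sum: "pmf (diff_pmf \<alpha>) d = (\<Sum>y\<in>UNIV. pmf (XY_pmf \<alpha>) (y + d, y))" for d
  proof -
    have "(\<lambda>(x, y). x - y) -` {d} = (\<lambda>y. (y + d, y)) ` UNIV"
      by (auto simp: image_iff algebra_simps)
    then have "pmf (diff_pmf \<alpha>) d = measure_pmf.prob (XY_pmf \<alpha>) ((\<lambda>y. (y + d, y)) ` UNIV)"
      by (simp add: diff_pmf_def pmf_map)
    also have "\<dots> = (\<Sum>y\<in>UNIV. pmf (XY_pmf \<alpha>) (y + d, y))"
      by (subst measure_measure_pmf_finite) (auto simp: sum.reindex inj_on_def)
    finally show ?thesis .
  qed
  have d: "y - (y + 0) = 0" "y - (y + 1) = 2" "y - (y + 2) = 1" for y :: 3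
    by simp_all
  have "pmf (diff_pmf \<alpha>) 0 = (\<Sum>y\<in>(UNIV :: 3 set). 2 / 21)"
    unfolding sum by (intro sum.cong refl pmf_XY_pmf(1)[OF assms d(1)])
  then show "pmf (diff_pmf \<alpha>) 0 = 2 / 7" by simp
  have "pmf (diff_pmf \<alpha>) 1 = (\<Sum>y\<in>(UNIV :: 3 set). (5 - \<alpha>) / 21)"
    unfolding sum by (intro sum.cong refl pmf_XY_pmf(3)[OF assms d(2)])
  then show "pmf (diff_pmf \<alpha>) 1 = (5 - \<alpha>) / 7" by simp
  have "pmf (diff_pmf \<alpha>) 2 = (\<Sum>y\<in>(UNIV :: 3 set). \<alpha> / 21)"
    unfolding sum by (intro sum.cong refl pmf_XY_pmf(2)[OF assms d(3)])
  then show "pmf (diff_pmf \<alpha>) 2 = \<alpha> / 7" by simp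
qed

lemma XYZ_pmf_eq_noisy_source:
  assumes "2 \<le> \<alpha>" "\<alpha> \<le> 5"
  shows "XYZ_pmf \<alpha> = noisy_source (diff_pmf \<alpha>)"
proof -
  let ?g = "\<lambda>(y :: 3, e). (y + e, y)"
  have "XY_pmf \<alpha> = map_pmf ?g (pair_pmf (pmf_of_set UNIV) (diff_pmf \<alpha>))"
  proof (rule pmf_eqI)
    fix p :: "3 \<times> 3"
    obtain x y where p: "p = (x, y)" by force
    have "inj ?g" by (auto simp: inj_on_def)
    then have "pmf (map_pmf ?g (pair_pmf (pmf_of_set UNIV) (diff_pmf \<alpha>))) (?g (y, x - y)) =
        pmf (pair_pmf (pmf_of_set UNIV) (diff_pmf \<alpha>)) (y, x - y)"
      by (rule pmf_map_inj')
    then have r: "pmf (map_pmf ?g (pair_pmf (pmf_of_set UNIV) (diff_pmf \<alpha>))) p = pmf (diff_pmf \<alpha>) (x - y) / 3"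
      by (simp add: p pmf_pair)
    have s: "y - x = - (x - y)" by simp
    consider "x - y = 0" | "x - y = 1" | "x - y = 2" using mod3_cases by blast
    then show "pmf (XY_pmf \<alpha>) p = pmf (map_pmf ?g (pair_pmf (pmf_of_set UNIV) (diff_pmf \<alpha>))) p"
    proof cases
      case 1
      then have yx: "y - x = 0" unfolding s by simp
      show ?thesis unfolding r unfolding 1 p pmf_diff_pmf[OF assms] pmf_XY_pmf(1)[OF assms yx] by simp
    next
      case 2
      then have yx: "y - x = 2" unfolding s by simp
      show ?thesis unfolding r unfolding 2 p pmf_diff_pmf[OF assms] pmf_XY_pmf(3)[OF assms yx] by simp
    next
      case 3
      then have yx: "y - x = 1" unfolding s by simp
      show ?thesis unfolding r unfolding 3 p pmf_diff_pmf[OF assms] pmf_XY_pmf(2)[OF assms yx] by simp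
    qed
  qed
  then show ?thesis
    by (auto simp: XYZ_pmf_def noisy_source_def noisy_triple_def pmf.map_comp comp_def case_prod_unfold
        intro!: map_pmf_cong)
qed

lemma secret_key_rate_XYZ_pos:
  assumes "3 < \<alpha>" "\<alpha> \<le> 5"
  shows "secret_key_rate (XYZ_pmf \<alpha>) > 0"
proof -
  have \<alpha>: "2 \<le> \<alpha>" "\<alpha> \<le> 5" using assms by auto
  show ?thesis
    unfolding XYZ_pmf_eq_noisy_source[OF \<alpha>]
    by (rule secret_key_rate_noisy_source_pos) (use assms in \<open>simp_all add: pmf_diff_pmf[OF \<alpha>]\<close>)
qed

text \<open>
  Erasing an unequal pair with probability \<open>2 / \<alpha>\<close> or \<open>2 / (5 - \<alpha>)\<close>, respectively, gives all nine
  pairs the same weight \<open>2 / 21\<close> conditionally on erasure.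
\<close>

definition erasure :: "real \<Rightarrow> (3 \<times> 3) option \<Rightarrow> (3 \<times> 3) option pmf" where
  "erasure \<alpha> z = (case z of None \<Rightarrow> return_pmf None
     | Some (x, y) \<Rightarrow> map_pmf (\<lambda>b. if b then None else Some (x, y))
         (bernoulli_pmf (2 / (if y - x = 1 then \<alpha> else 5 - \<alpha>))))"

lemma pmf_bind_Pair: "pmf (p \<bind> (\<lambda>a. map_pmf (Pair a) (f a))) (a, c) = pmf p a * pmf (f a) c"
proof -
  have "pmf (map_pmf (Pair a') (f a')) (a, c) = indicator {a} a' * pmf (f a) c" for a'
  proof (cases "a' = a")
    case True
    have "inj (Pair a)" by (auto simp: inj_on_def)
    from pmf_map_inj'[OF this, of "f a" c] show ?thesis using True by simp
  next
    case False
    then have "Pair a' -` {(a, c)} = {}" by auto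
    then show ?thesis using False by (simp add: pmf_map)
  qed
  then show ?thesis by (simp add: pmf_bind measure_pmf_single)
qed

text \<open>The bounds on \<alpha> are what makes \<open>2 / \<alpha>\<close> and
  \<open>2 / (5 - \<alpha>)\<close> probabilities.\<close>

lemma formation_cost_XYZ_eq_0:
  assumes "2 \<le> \<alpha>" "\<alpha> \<le> 3"
  shows "formation_cost (XYZ_pmf \<alpha>) = 0"
proof -
  have \<alpha>: "2 \<le> \<alpha>" "\<alpha> \<le> 5" using assms by auto
  define z where "z = (\<lambda>(x :: 3, y). if x = y then None else Some (x, y))"
  define J where "J = XYZ_pmf \<alpha> \<bind> (\<lambda>(x, y, z). map_pmf (\<lambda>c. (x, y, c)) (erasure \<alpha> z))"
  let ?h = "\<lambda>((x :: 3, y :: 3), c :: (3 \<times> 3) option). (x, y, c)"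
  have J: "J = map_pmf ?h (XY_pmf \<alpha> \<bind> (\<lambda>a. map_pmf (Pair a) (erasure \<alpha> (z a))))"
    unfolding J_def XYZ_pmf_def z_def
    by (simp add: bind_map_pmf map_bind_pmf pmf.map_comp comp_def case_prod_unfold)
  have pmf_J: "pmf J (x, y, c) = pmf (XY_pmf \<alpha>) (x, y) * pmf (erasure \<alpha> (z (x, y))) c" for x y c
  proof -
    have "inj ?h" by (auto simp: inj_on_def)
    from pmf_map_inj'[OF this, of "XY_pmf \<alpha> \<bind> (\<lambda>a. map_pmf (Pair a) (erasure \<alpha> (z a)))" "((x, y), c)"]
    show ?thesis unfolding J by (simp add: pmf_bind_Pair)
  qed
  have None_prob: "pmf (map_pmf (\<lambda>b. if b then None else Some (x, y)) (bernoulli_pmf t)) None = t"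
    if "0 \<le> t" "t \<le> 1" for t :: real and x y :: 3
  proof -
    have "(\<lambda>b. if b then None else Some (x, y)) -` {None} = {True}"
      by (auto split: if_splits)
    then show ?thesis using that by (simp add: pmf_map measure_pmf_single)
  qed
  have None: "pmf J (x, y, None) = 2 / 21" for x y
  proof -
    consider "y - x = 0" | "y - x = 1" | "y - x = 2" using mod3_cases by blast
    then show ?thesis
    proof cases
      case 1
      then have "z (x, y) = None" by (simp add: z_def)
      then show ?thesis unfolding pmf_J pmf_XY_pmf(1)[OF \<alpha> 1] by (simp add: erasure_def)
    next
      case 2
      then have "z (x, y) = Some (x, y)" by (auto simp: z_def)
      then show ?thesis
        unfolding pmf_J pmf_XY_pmf(2)[OF \<alpha> 2] using 2 assms by (simp add: erasure_def None_prob)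
    next
      case 3
      then have "z (x, y) = Some (x, y)" by (auto simp: z_def)
      then show ?thesis
        unfolding pmf_J pmf_XY_pmf(3)[OF \<alpha> 3] using 3 assms
        by (simp add: erasure_def None_prob) (simp add: divide_simps)
    qed
  qed
  have "uniform_degradation (XYZ_pmf \<alpha>) (erasure \<alpha>)"
    unfolding uniform_degradation_def J_def[symmetric]
  proof (intro conjI allI impI)
    show "pmf J (x, y, None) = pmf J (x', y', None)" for x y x' y'
      by (simp only: None)
    show "x = a" "y = b" if "(x, y, Some (a, b)) \<in> set_pmf J" for x y a b
      using that by (auto simp: J z_def erasure_def split: if_splits)
  qed
  then show ?thesis by (rule uniform_degradation.formation_cost_eq_0)
qed

theorem theorem2:
  shows "(\<forall>\<alpha>::real. 3 < \<alpha> \<and> \<alpha> \<le> 5 \<longrightarrow> secret_key_rate (XYZ_pmf \<alpha>) > 0) \<and>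
         (\<forall>\<alpha>::real. 2 \<le> \<alpha> \<and> \<alpha> \<le> 3 \<longrightarrow> formation_cost (XYZ_pmf \<alpha>) = 0)"
  using secret_key_rate_XYZ_pos formation_cost_XYZ_eq_0 by blast

end
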